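(* Let $\Omega\subset\mathbf{C}^n$ be open, $\Phi\in C^\infty(\Omega;\mathbf{R})$ strictly plurisubharmonic, $x_0\in\Omega$, and let $V\Subset\Omega$ be a (sufficiently) small open neighborhood of $x_0$ with $C^\infty$ boundary. Let $\Psi$ be an almost holomorphic polarization of $\Phi$, let $a$ be an associated Bergman amplitude, and let $\widetilde\Pi_V$ be the operator $$\widetilde\Pi_Vu(x)=\frac1{h^n}\int_Ve^{\frac2h\Psi(x,\overline y)}a(x,\overline y;h)u(y)e^{-\frac2h\Phi(y)}\,dy\,d\overline y.$$ There exists a small open neighborhood $W\Subset V$ of $x_0$ with $C^\infty$ boundary such that for every $\Phi_1\in C(\Omega;\mathbf{R})$ with $\Phi_1\le\Phi$ in $\Omega$ and $\Phi_1<\Phi$ on $\Omega\setminus\overline W$, and every $N\in\mathbf{N}$, there exists $C_N$ such that for all $u\in H_\Phi(V)$, $v\in H_{\Phi_1}(V)$ (and all sufficiently small $h>0$), we have $$\left|(\widetilde\Pi_Vu,v)_{L^2_\Phi(V)}-(u,v)_{H_\Phi(V)}\right|\le C_Nh^N\|u\|_{H_\Phi(V)}\|v\|_{H_{\Phi_1}(V)}.$$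
   Context: $h>0$ is a small parameter; $\mathcal{O}(h^\infty)$ means $\mathcal{O}_N(h^N)$ for every $N$, uniformly. $\mathrm{neigh}(p,E)$ denotes a sufficiently small open neighborhood of $p$ in $E$; $W\Subset V$ means $\overline W$ is a compact subset of $V$. For a real continuous weight $\Phi_\bullet$, $L^2_{\Phi_\bullet}(V)=L^2(V,e^{-2\Phi_\bullet/h}L(dx))$ with $L(dx)$ Lebesgue measure, scalar product $(f,g)_{L^2_{\Phi_\bullet}(V)}=\int_Vf\overline g\,e^{-2\Phi_\bullet/h}L(dx)$, and $H_{\Phi_\bullet}(V)=\mathrm{Hol}(V)\cap L^2_{\Phi_\bullet}(V)$ with the induced norm and scalar product. $\Phi$ strictly plurisubharmonic means $\sum_{j,k}\frac{\partial^2\Phi}{\partial x_j\partial\overline{x}_k}(x)\xi_j\overline{\xi}_k\ge c(x)|\xi|^2$ for $x\in\Omega$, $\xi\in\mathbf{C}^n$, with some $0<c\in C(\Omega)$. Almost holomorphic polarization: $\Psi\in C^\infty(\mathrm{neigh}((x_0,\overline{x_0}),\mathbf{C}^{2n}_{x,y}))$ with $\Psi(x,\overline x)=\Phi(x)$ near $x_0$ and, for all $N$ and $j$, $\partial_{\overline x_j}\Psi(x,y)$ and $\partial_{\overline y_j}\Psi(x,y)$ both $\mathcal{O}_N(|y-\overline x|^N)$, locally uniformly. Put $\varphi(y,\widetilde x;x,\widetilde y)=\Psi(x,\widetilde y)-\Psi(x,\widetilde x)-\Psi(y,\widetilde y)+\Psi(y,\widetilde x)$. Bergman amplitude associated with $\Psi$: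 an elliptic symbol $a(x,\widetilde y;h)\sim\sum_{j\ge0}h^ja_j(x,\widetilde y)$ in $S^0_{\mathrm{cl}}(\mathrm{neigh}((x_0,\overline{x_0}),\mathbf{C}^{2n}))$ (for every $N$ all derivatives of $a-\sum_{j<N}h^ja_j$ are $\mathcal{O}(h^N)$ locally uniformly; $a_0\neq0$), with $a_j\in C^\infty$, $\partial_{\overline x}a_j$ and $\partial_{\overline{\widetilde y}}a_j$ both $\mathcal{O}_N(|\widetilde y-\overline x|^N)$ for all $N$, such that for $y\in\mathrm{neigh}(x_0,\mathbf{C}^n)$ $$\frac1{h^n}\iint_{\Gamma(y,\overline y)}e^{\frac2h\varphi(y,\overline y;x,\widetilde y)}a(x,\widetilde y;h)\,dx\,d\widetilde y=1+\mathcal{O}(h^\infty).$$ Such amplitudes exist. Here $\Gamma(y,\overline y)$ is a good contour, for instance the affine contour $\mathrm{neigh}(0,\mathbf{C}^n)\ni z\mapsto(y+z,\overline y-\overline z)\in\mathbf{C}^{2n}_{x,\widetilde y}$ (in general: a smooth $2n$-dimensional contour through $(y,\overline y)$, depending smoothly on $y$, along which $\mathrm{Re}\,\varphi(y,\overline y;x,\widetilde y)\le-\frac1C\mathrm{dist}((x,\widetilde y),(y,\overline y))^2$; the choice matters only up to $\mathcal{O}(h^\infty)$). Measure convention: $dy\,d\overline y=dy_1\wedge\dots\wedge dy_n\wedge d\overline y_1\wedge\dots\wedge d\overline y_n=c_nL(dy)$ with a constant $c_n\ne0$ depending only on $n$, $dx\,d\widetilde y=dx_1\wedge\dots\wedge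 dx_n\wedge d\widetilde y_1\wedge\dots\wedge d\widetilde y_n$, and the affine contour is oriented so that $\iint_\Gamma g\,dx\,d\widetilde y=c_n\int g(y+z,\overline y-\overline z)L(dz)$ with the same $c_n$. The functions $\Psi$ and $a$ are assumed to be defined in a neighborhood of the closure of $V\times\rho(V)$, where $\rho(x)=\overline x$. *)

theory Defs
  imports "HOL-Analysis.Analysis"
begin

primrec iter_deriv ::
  "'a::euclidean_space list \<Rightarrow> ('a \<Rightarrow> 'b::real_normed_vector) \<Rightarrow> 'a \<Rightarrow> 'b" where
  "iter_deriv [] f = f"
| "iter_deriv (v # vs) f = (\<lambda>x. frechet_derivative (iter_deriv vs f) (at x) v)"

text \<open>On an open set this is the class of \<open>C\<^sup>\<infinity>\<close> functions in the real sense; it is only used for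
  open sets.\<close>

definition smooth_on :: "'a::euclidean_space set \<Rightarrow> ('a \<Rightarrow> 'b::real_normed_vector) \<Rightarrow> bool" where
  "smooth_on S f \<longleftrightarrow> (\<forall>vs. \<forall>x\<in>S. iter_deriv vs f differentiable (at x))"

definition smooth_boundary :: "'a::euclidean_space set \<Rightarrow> bool" where
  "smooth_boundary V \<longleftrightarrow>
     (\<forall>p\<in>frontier V. \<exists>U (g :: 'a \<Rightarrow> real).
        open U \<and> p \<in> U \<and> smooth_on U g \<and>
        (\<forall>x\<in>U. frechet_derivative g (at x) \<noteq> (\<lambda>_. 0)) \<and>
        V \<inter> U = {x\<in>U. g x < 0})"

definition vcnj :: "complex^'n \<Rightarrow> complex^'n" where
  "vcnj x = (\<chi> j. cnj (x $ j))"

definition d_z :: "'n::finite \<Rightarrow> (complex^'n \<Rightarrow> complex) \<Rightarrow> complex^'n \<Rightarrow> complex" where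
  "d_z j f x = (frechet_derivative f (at x) (axis j 1) - \<i> * frechet_derivative f (at x) (axis j \<i>)) / 2"

definition d_zbar :: "'n::finite \<Rightarrow> (complex^'n \<Rightarrow> complex) \<Rightarrow> complex^'n \<Rightarrow> complex" where
  "d_zbar j f x = (frechet_derivative f (at x) (axis j 1) + \<i> * frechet_derivative f (at x) (axis j \<i>)) / 2"

definition hol_on :: "(complex^'n) set \<Rightarrow> (complex^'n \<Rightarrow> complex) \<Rightarrow> bool" where
  "hol_on V u \<longleftrightarrow> (\<forall>x\<in>V. u differentiable (at x) \<and> (\<forall>j. d_zbar j u x = 0))"

text \<open>The Levi form is real; \<open>Re\<close> only converts its type.\<close>

definition strictly_psh_on :: "(complex^'n) set \<Rightarrow> (complex^'n \<Rightarrow> real) \<Rightarrow> bool" where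
  "strictly_psh_on \<Omega> \<Phi> \<longleftrightarrow>
     (\<exists>c. continuous_on \<Omega> c \<and> (\<forall>x\<in>\<Omega>. 0 < c x) \<and>
       (\<forall>x\<in>\<Omega>. \<forall>\<xi>.
          Re (\<Sum>j\<in>UNIV. \<Sum>k\<in>UNIV.
                d_z j (d_zbar k (\<lambda>w. complex_of_real (\<Phi> w))) x * (\<xi> $ j) * cnj (\<xi> $ k))
          \<ge> c x * (norm \<xi>)\<^sup>2))"

definition weighted_L2 :: "real \<Rightarrow> (complex^'n \<Rightarrow> real) \<Rightarrow> (complex^'n) set \<Rightarrow> (complex^'n \<Rightarrow> complex) set" where
  "weighted_L2 h \<Phi> V =
     {u. set_borel_measurable lebesgue V u \<and>
         set_integrable lebesgue V (\<lambda>x. (norm (u x))\<^sup>2 * exp (- 2 * \<Phi> x / h))}"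

definition weighted_inner ::
  "real \<Rightarrow> (complex^'n \<Rightarrow> real) \<Rightarrow> (complex^'n) set \<Rightarrow>
   (complex^'n \<Rightarrow> complex) \<Rightarrow> (complex^'n \<Rightarrow> complex) \<Rightarrow> complex" where
  "weighted_inner h \<Phi> V f g =
     (LINT x:V|lebesgue. f x * cnj (g x) * complex_of_real (exp (- 2 * \<Phi> x / h)))"

definition weighted_norm ::
  "real \<Rightarrow> (complex^'n \<Rightarrow> real) \<Rightarrow> (complex^'n) set \<Rightarrow> (complex^'n \<Rightarrow> complex) \<Rightarrow> real" where
  "weighted_norm h \<Phi> V f = sqrt (LINT x:V|lebesgue. (norm (f x))\<^sup>2 * exp (- 2 * \<Phi> x / h))"

definition weighted_hol :: "real \<Rightarrow> (complex^'n \<Rightarrow> real) \<Rightarrow> (complex^'n) set \<Rightarrow> (complex^'n \<Rightarrow> complex) set" where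
  "weighted_hol h \<Phi> V = {u. hol_on V u} \<inter> weighted_L2 h \<Phi> V"

definition flat_antidiagonal ::
  "((complex^'n) \<times> (complex^'n)) set \<Rightarrow> ((complex^'n) \<times> (complex^'n) \<Rightarrow> complex) \<Rightarrow> bool" where
  "flat_antidiagonal G f \<longleftrightarrow>
     (\<forall>K. compact K \<and> K \<subseteq> G \<longrightarrow>
        (\<forall>N::nat. \<exists>C. \<forall>(x, y)\<in>K. norm (f (x, y)) \<le> C * norm (y - vcnj x) ^ N))"

definition almost_holomorphic ::
  "((complex^'n) \<times> (complex^'n)) set \<Rightarrow> ((complex^'n) \<times> (complex^'n) \<Rightarrow> complex) \<Rightarrow> bool" where
  "almost_holomorphic G f \<longleftrightarrow>
     smooth_on G f \<and>
     (\<forall>j. flat_antidiagonal G (\<lambda>(x, y). d_zbar j (\<lambda>x'. f (x', y)) x)) \<and>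
     (\<forall>j. flat_antidiagonal G (\<lambda>(x, y). d_zbar j (\<lambda>y'. f (x, y')) y))"

definition almost_holomorphic_polarization ::
  "complex^'n \<Rightarrow> (complex^'n \<Rightarrow> real) \<Rightarrow> ((complex^'n) \<times> (complex^'n)) set \<Rightarrow>
   ((complex^'n) \<times> (complex^'n) \<Rightarrow> complex) \<Rightarrow> bool" where
  "almost_holomorphic_polarization x\<^sub>0 \<Phi> G \<Psi> \<longleftrightarrow>
     almost_holomorphic G \<Psi> \<and>
     (\<forall>\<^sub>F x in nhds x\<^sub>0. \<Psi> (x, vcnj x) = complex_of_real (\<Phi> x))"

definition phase ::
  "((complex^'n) \<times> (complex^'n) \<Rightarrow> complex) \<Rightarrow>
   complex^'n \<Rightarrow> complex^'n \<Rightarrow> complex^'n \<Rightarrow> complex^'n \<Rightarrow> complex" where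
  "phase \<Psi> y xt x yt = \<Psi> (x, yt) - \<Psi> (x, xt) - \<Psi> (y, yt) + \<Psi> (y, xt)"

definition classical_symbol ::
  "'a::euclidean_space set \<Rightarrow> (real \<Rightarrow> 'a \<Rightarrow> complex) \<Rightarrow> (nat \<Rightarrow> 'a \<Rightarrow> complex) \<Rightarrow> bool" where
  "classical_symbol G a as \<longleftrightarrow>
     (\<forall>\<^sub>F h in at_right 0. smooth_on G (a h)) \<and>
     (\<forall>j. smooth_on G (as j)) \<and>
     (\<forall>N vs K. compact K \<and> K \<subseteq> G \<longrightarrow>
        (\<exists>C. \<forall>\<^sub>F h in at_right 0. \<forall>p\<in>K.
           norm (iter_deriv vs (\<lambda>q. a h q - (\<Sum>j<N. complex_of_real h ^ j * as j q)) p) \<le> C * h ^ N))"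

text \<open>The constant \<open>c\<^sub>n\<close> in \<open>dy\<^sub>1 \<and> \<dots> \<and> dy\<^sub>n \<and> d(cnj y\<^sub>1) \<and> \<dots> \<and> d(cnj y\<^sub>n) = c\<^sub>n L(dy)\<close>: reordering into
  the factors \<open>dy\<^sub>j \<and> d(cnj y\<^sub>j) = -2\<i> d(Re y\<^sub>j) \<and> d(Im y\<^sub>j)\<close> costs the sign
  \<open>(-1)\<close> to the power \<open>n(n-1)/2\<close>.\<close>

definition vol_const :: "'n::finite itself \<Rightarrow> complex" where
  "vol_const _ = (- 1) ^ (CARD('n) choose 2) * (- 2 * \<i>) ^ CARD('n)"

text \<open>The integral over \<open>\<Gamma>(y, cnj y)\<close> is taken over the affine contour
  \<open>z \<mapsto> (y + z, cnj y - cnj z)\<close>, \<open>|z| < r\<close>, oriented so that \<open>dx\<^sub>1 \<and> \<dots> \<and> dx\<^sub>n \<and> dyt\<^sub>1 \<and> \<dots> \<and> dyt\<^sub>n\<close> pulls back to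
  \<open>c\<^sub>n L(dz)\<close>; \<open>y\<close> ranges over \<open>ball x\<^sub>0 s\<close>. The inclusion in \<open>G\<close> makes all four terms of the
  phase defined, and the bound on its real part says that the contour is good.\<close>

definition bergman_amplitude ::
  "complex^'n \<Rightarrow> ((complex^'n) \<times> (complex^'n)) set \<Rightarrow> ((complex^'n) \<times> (complex^'n) \<Rightarrow> complex) \<Rightarrow>
   (real \<Rightarrow> (complex^'n) \<times> (complex^'n) \<Rightarrow> complex) \<Rightarrow> bool" where
  "bergman_amplitude x\<^sub>0 G \<Psi> a \<longleftrightarrow>
     (\<exists>as. classical_symbol G a as \<and>
           (\<forall>p\<in>G. as 0 p \<noteq> 0) \<and>
           (\<forall>j. almost_holomorphic G (as j))) \<and>
     (\<exists>r s C\<^sub>0. 0 < r \<and> 0 < s \<and> 0 < C\<^sub>0 \<and>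
        cball x\<^sub>0 (s + r) \<times> cball (vcnj x\<^sub>0) (s + r) \<subseteq> G \<and>
        (\<forall>y\<in>ball x\<^sub>0 s. \<forall>z\<in>ball 0 r.
           Re (phase \<Psi> y (vcnj y) (y + z) (vcnj y - vcnj z))
           \<le> - (dist (y + z, vcnj y - vcnj z) (y, vcnj y))\<^sup>2 / C\<^sub>0) \<and>
        (\<forall>N::nat. \<exists>C. \<forall>\<^sub>F h in at_right 0. \<forall>y\<in>ball x\<^sub>0 s.
           norm (vol_const TYPE('n) / complex_of_real h ^ CARD('n) *
                   (LINT z:ball 0 r|lebesgue.
                      exp (2 / complex_of_real h * phase \<Psi> y (vcnj y) (y + z) (vcnj y - vcnj z)) *
                      a h (y + z, vcnj y - vcnj z))
                 - 1) \<le> C * h ^ N))"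

definition bergman_op ::
  "real \<Rightarrow> (complex^'n \<Rightarrow> real) \<Rightarrow> ((complex^'n) \<times> (complex^'n) \<Rightarrow> complex) \<Rightarrow>
   (real \<Rightarrow> (complex^'n) \<times> (complex^'n) \<Rightarrow> complex) \<Rightarrow> (complex^'n) set \<Rightarrow>
   (complex^'n \<Rightarrow> complex) \<Rightarrow> complex^'n \<Rightarrow> complex" where
  "bergman_op h \<Phi> \<Psi> a V u x =
     vol_const TYPE('n) / complex_of_real h ^ CARD('n) *
       (LINT y:V|lebesgue.
          exp (2 / complex_of_real h * \<Psi> (x, vcnj y)) * a h (x, vcnj y) * u y *
          complex_of_real (exp (- 2 * \<Phi> y / h)))"

end

(* A change of contour, made infinitesimal. Writing kernel and weights through the polarization,
   the sesquilinear form of the operator is an integral over y and z with x = y + z. For fixed z, replace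
   the argument cnj y of the kernel by cnj (y - (1 - t) z) and the argument of v by y + t z. At t = 1 this
   is the given form; at t = 0 the integral over z is the integral over the good contour, equal to
   1 + O(h^infinity), and what remains is (u, v). The t-derivative of the integrand differs from a
   d-bar derivative in y, whose integral vanishes, only by the defects of holomorphy of Psi and a, which are
   O(|z|^N) or O(h^N), and by the derivative of a cutoff supported where v is exponentially small. The
   integrand is O(exp(-c |z|^2 / h)) relative to the weights all along the homotopy, so these errors
   are O(h^infinity), with the Cauchy-Schwarz inequality in y for fixed z. *)

theory Submission
  imports Defs "HOL-Complex_Analysis.Cauchy_Integral_Formula"
begin

section \<open>Smooth functions and antilinear parts\<close>

text \<open>No differential forms are needed: the integral over all y of a first-order derivative of
  a compactly supported function vanishes by translation invariance of Lebesgue measure, and the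
  cutoff does away with boundary terms. The obstacle is that u and v are controlled only in L^2. The
  exponent along the homotopy therefore has to split into a gaussian in z and half weights exp(-
  \<Phi> / h) placed exactly at the points y and y + t z where u and v are evaluated. Translations
  preserve L^2 norms, so each z then costs a mere product of norms. Two losses are to be paid for:
  the factor h^(-n) in front of the operator and the 1/h from differentiating the exponential. Since
  |z|^(2m) times the gaussian is O(h^m), flatness of order 2(N + n + 1) suffices. All radii are
  multiples of one \<rho>: W has radius \<rho>, v is exponentially small beyond 2\<rho>, the cutoff
  varies between 3\<rho> and 4\<rho>, and t z has length at most \<rho>/2. So the derivative of the
  cutoff meets v only where v is small.\<close>

lemma vcnj_nth [simp]: "vcnj x $ j = cnj (x $ j)"
  by (simp add: vcnj_def)

lemma vcnj_vcnj [simp]: "vcnj (vcnj x) = x"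
  by (simp add: vec_eq_iff)

lemma vcnj_add: "vcnj (x + y) = vcnj x + vcnj y"
  by (simp add: vec_eq_iff)

lemma vcnj_diff: "vcnj (x - y) = vcnj x - vcnj y"
  by (simp add: vec_eq_iff)

lemma vcnj_scaleR: "vcnj (c *\<^sub>R x) = c *\<^sub>R vcnj x"
  by (simp add: vec_eq_iff)

lemma norm_vcnj [simp]: "norm (vcnj x) = norm x"
  by (simp add: norm_vec_def)

lemma bounded_linear_vcnj: "bounded_linear vcnj"
  by (rule bounded_linear_intro[where K = 1]) (simp_all add: vcnj_add vcnj_scaleR)

lemma dist_vcnj [simp]: "dist (vcnj x) (vcnj y) = dist x y"
  by (simp add: dist_norm flip: vcnj_diff)

lemma continuous_on_vcnj: "continuous_on S vcnj"
  by (simp add: bounded_linear_vcnj linear_continuous_on)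

lemma vcnj_imult: "vcnj (\<i> *s x) = - (\<i> *s vcnj x)"
  by (simp add: vec_eq_iff)

lemma norm_imult [simp]: "norm (\<i> *s (x :: complex^'n)) = norm x"
  by (simp add: norm_vec_def norm_mult)

lemma complex_vec_expand:
  fixes z :: "complex^'n"
  shows "z = (\<Sum>j\<in>UNIV. Re (z $ j) *\<^sub>R axis j 1 + Im (z $ j) *\<^sub>R axis j \<i>)"
proof -
  have "(\<Sum>j\<in>UNIV. Re (z $ j) *\<^sub>R axis j 1 + Im (z $ j) *\<^sub>R axis j \<i>) $ k = z $ k" for k
  proof -
    have "(\<Sum>j\<in>UNIV. Re (z $ j) *\<^sub>R axis j 1 + Im (z $ j) *\<^sub>R axis j \<i>) $ k
      = (\<Sum>j\<in>UNIV. if j = k then z $ k else 0)"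
      unfolding sum_component
      by (rule sum.cong) (auto simp: axis_def complex_eq_iff)
    then show ?thesis by simp
  qed
  then show ?thesis by (simp add: vec_eq_iff)
qed

text \<open>The left side is twice the conjugate-linear part of the real-linear map
  \<open>f\<close>: in the real basis \<open>axis j 1\<close>, \<open>axis j \<i>\<close> only the
  conjugated coordinates survive. For a derivative, the coefficients are twice the values of
  \<open>d_zbar\<close>.\<close>

lemma antilinear_part_expand:
  fixes f :: "complex^'n \<Rightarrow> complex"
  assumes "linear f"
  shows "f z + \<i> * f (\<i> *s z) = (\<Sum>j\<in>UNIV. cnj (z $ j) * (f (axis j 1) + \<i> * f (axis j \<i>)))"
proof -
  interpret linear f by fact
  have e: "f w = (\<Sum>j\<in>UNIV. complex_of_real (Re (w $ j)) * f (axis j 1) + complex_of_real (Im (w $ j)) * f (axis j \<i>))" for w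
    by (subst complex_vec_expand[of w], simp only: sum add scale) (simp add: scaleR_conv_of_real)
  have "f z + \<i> * f (\<i> *s z) = (\<Sum>j\<in>UNIV. complex_of_real (Re (z $ j)) * f (axis j 1) + complex_of_real (Im (z $ j)) * f (axis j \<i>)
     + \<i> * (complex_of_real (- Im (z $ j)) * f (axis j 1) + complex_of_real (Re (z $ j)) * f (axis j \<i>)))"
    unfolding sum.distrib[of _ "\<lambda>j. \<i> * _ j"] e[of z] e[of "\<i> *s z"] by (simp add: sum_distrib_left sum.distrib)
  also have "\<dots> = (\<Sum>j\<in>UNIV. cnj (z $ j) * (f (axis j 1) + \<i> * f (axis j \<i>)))"
  proof (rule sum.cong)
    fix j
    have c: "cnj (z $ j) = complex_of_real (Re (z $ j)) - \<i> * complex_of_real (Im (z $ j))"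
      by (simp add: complex_eq_iff)
    show "complex_of_real (Re (z $ j)) * f (axis j 1) + complex_of_real (Im (z $ j)) * f (axis j \<i>)
     + \<i> * (complex_of_real (- Im (z $ j)) * f (axis j 1) + complex_of_real (Re (z $ j)) * f (axis j \<i>))
     = cnj (z $ j) * (f (axis j 1) + \<i> * f (axis j \<i>))"
      unfolding c by (simp add: algebra_simps)
  qed simp
  finally show ?thesis .
qed

text \<open>Passes from coordinatewise d-bar bounds, as the definitions give them, to an arbitrary
  direction z, which is what a homotopy along z requires.\<close>

lemma antilinear_part_bound:
  fixes f :: "complex^'n \<Rightarrow> complex"
  assumes "f differentiable (at x)" and "\<And>j. norm (d_zbar j f x) \<le> e"
  shows "norm (frechet_derivative f (at x) z + \<i> * frechet_derivative f (at x) (\<i> *s z))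
     \<le> 2 * real CARD('n) * e * norm z"
proof -
  let ?f = "frechet_derivative f (at x)"
  have "linear ?f"
    by (rule linear_frechet_derivative[OF assms(1)])
  moreover have "?f (axis j 1) + \<i> * ?f (axis j \<i>) = 2 * d_zbar j f x" for j
    by (simp add: d_zbar_def)
  ultimately have "norm (?f z + \<i> * ?f (\<i> *s z)) = norm (\<Sum>j\<in>UNIV. cnj (z $ j) * (2 * d_zbar j f x))"
    by (simp only: antilinear_part_expand)
  also have "\<dots> \<le> (\<Sum>j\<in>(UNIV::'n set). norm z * (2 * e))"
    by (rule sum_norm_le) (auto simp: norm_mult intro!: mult_mono assms(2) Finite_Cartesian_Product.norm_nth_le)
  finally show ?thesis by (simp add: mult_ac)
qed

lemma hol_on_derivative_imult:
  assumes "hol_on V u" "x \<in> V"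
  shows "frechet_derivative u (at x) (\<i> *s z) = \<i> * frechet_derivative u (at x) z"
proof -
  have "norm (frechet_derivative u (at x) z + \<i> * frechet_derivative u (at x) (\<i> *s z)) \<le> 2 * real CARD('a) * 0 * norm z"
    by (rule antilinear_part_bound) (use assms in \<open>auto simp: hol_on_def\<close>)
  then have "frechet_derivative u (at x) z + \<i> * frechet_derivative u (at x) (\<i> *s z) = 0"
    by simp
  then have "\<i> * (frechet_derivative u (at x) z + \<i> * frechet_derivative u (at x) (\<i> *s z)) = 0"
    by simp
  then show ?thesis by (simp add: algebra_simps)
qed

section \<open>Smooth functions: derivative bounds and a uniform Taylor expansion\<close>

lemma smooth_onD: "smooth_on S f \<Longrightarrow> x \<in> S \<Longrightarrow> iter_deriv vs f differentiable (at x)"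
  by (auto simp: smooth_on_def)

lemma smooth_on_differentiable: "smooth_on S f \<Longrightarrow> x \<in> S \<Longrightarrow> f differentiable (at x)"
  using smooth_onD[of S f x "[]"] by simp

lemma smooth_on_continuous: "smooth_on S f \<Longrightarrow> continuous_on S (iter_deriv vs f)"
  by (meson continuous_at_imp_continuous_on differentiable_imp_continuous_within smooth_onD)

lemma frechet_derivative_expand:
  assumes "f differentiable (at x)"
  shows "frechet_derivative f (at x) w = (\<Sum>b\<in>Basis. (w \<bullet> b) *\<^sub>R iter_deriv [b] f x)"
proof -
  interpret linear "frechet_derivative f (at x)"
    by (rule linear_frechet_derivative[OF assms])
  show ?thesis
    by (subst euclidean_representation[of w, symmetric]) (simp add: sum scale)
qed

lemma frechet_derivative_bound:
  fixes f :: "'a::euclidean_space \<Rightarrow> 'b::real_normed_vector"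
  assumes "f differentiable (at x)" and "\<And>b. b \<in> Basis \<Longrightarrow> norm (iter_deriv [b] f x) \<le> e"
  shows "norm (frechet_derivative f (at x) w) \<le> real DIM('a) * e * norm w"
proof -
  have "norm (frechet_derivative f (at x) w) \<le> (\<Sum>b\<in>(Basis::'a set). norm w * e)"
    unfolding frechet_derivative_expand[OF assms(1)]
    by (rule sum_norm_le) (auto intro!: mult_mono assms(2) simp: Basis_le_norm simp del: iter_deriv.simps)
  then show ?thesis by (simp add: mult_ac)
qed

lemma smooth_on_derivative_bound:
  fixes f :: "'a::euclidean_space \<Rightarrow> 'b::real_normed_vector"
  assumes "smooth_on S f" "compact K" "K \<subseteq> S"
  obtains B where "B \<ge> 0" "\<And>x w. x \<in> K \<Longrightarrow> norm (frechet_derivative f (at x) w) \<le> B * norm w"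
proof -
  have "\<exists>e. \<forall>x\<in>K. norm (iter_deriv [b] f x) \<le> e" for b
  proof -
    have "bounded (iter_deriv [b] f ` K)"
      using assms by (meson compact_continuous_image compact_imp_bounded continuous_on_subset smooth_on_continuous)
    then show ?thesis by (auto simp: bounded_iff)
  qed
  then obtain e where e: "\<And>b x. x \<in> K \<Longrightarrow> norm (iter_deriv [b] f x) \<le> e b"
    by metis
  define E where "E = (\<Sum>b\<in>Basis. \<bar>e b\<bar>)"
  have "norm (iter_deriv [b] f x) \<le> E" if "x \<in> K" "b \<in> Basis" for b x
  proof -
    have "norm (iter_deriv [b] f x) \<le> \<bar>e b\<bar>"
      using e[OF that(1), of b] by linarith
    also have "\<dots> \<le> E" unfolding E_def
      by (rule member_le_sum) (use that in auto)
    finally show ?thesis .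
  qed
  then have "norm (frechet_derivative f (at x) w) \<le> real DIM('a) * E * norm w" if "x \<in> K" for x w
    using that assms by (intro frechet_derivative_bound) (auto intro: smooth_on_differentiable)
  moreover have "real DIM('a) * E \<ge> 0" by (auto simp: E_def sum_nonneg)
  ultimately show ?thesis using that by blast
qed

lemma lipschitz_on_derivative_bound:
  assumes "convex K" "B \<ge> 0" "\<And>x. x \<in> K \<Longrightarrow> f differentiable (at x)"
    and "\<And>x w. x \<in> K \<Longrightarrow> norm (frechet_derivative f (at x) w) \<le> B * norm w"
  shows "B-lipschitz_on K f"
proof (rule lipschitz_onI)
  fix x y assume "x \<in> K" "y \<in> K"
  show "dist (f x) (f y) \<le> B * dist x y"
    unfolding dist_norm
  proof (rule differentiable_bound[where f' = "\<lambda>x. frechet_derivative f (at x)", OF assms(1) _ _ \<open>x \<in> K\<close> \<open>y \<in> K\<close>])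
    fix x assume x: "x \<in> K"
    show "(f has_derivative frechet_derivative f (at x)) (at x within K)"
      using assms(3)[OF x] frechet_derivative_works has_derivative_at_withinI by blast
    show "onorm (frechet_derivative f (at x)) \<le> B"
      by (rule onorm_bound[OF assms(2)]) (rule assms(4)[OF x])
  qed
qed (fact assms)

text \<open>The linear term is taken at the moving point \<open>p\<close>, the quadratic term at the
  fixed point \<open>p\<^sub>0\<close>; continuity of the second derivatives makes the error small
  relative to the square of |w|, uniformly in \<open>p\<close>. Freezing the quadratic term is what
  later yields a single quadratic form for all pairs of points.\<close>

lemma smooth_on_taylor2:
  fixes f :: "'a::euclidean_space \<Rightarrow> 'b::real_normed_vector"
  assumes "open S" "smooth_on S f" "p\<^sub>0 \<in> S" "e > 0"
  obtains d where "d > 0" "ball p\<^sub>0 d \<subseteq> S"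
    "\<And>p w. p \<in> ball p\<^sub>0 d \<Longrightarrow> p + w \<in> ball p\<^sub>0 d \<Longrightarrow>
      norm (f (p + w) - f p - frechet_derivative f (at p) w -
        (1/2) *\<^sub>R (\<Sum>b\<in>Basis. \<Sum>c\<in>Basis. ((w \<bullet> b) * (w \<bullet> c)) *\<^sub>R iter_deriv [c, b] f p\<^sub>0)) \<le> e * (norm w)\<^sup>2"
proof -
  let ?n = "real DIM('a)"
  define H where "H p w = (\<Sum>b\<in>Basis. \<Sum>c\<in>Basis. ((w \<bullet> b) * (w \<bullet> c)) *\<^sub>R iter_deriv [c, b] f p)" for p w
  \<comment> \<open>The quadratic term is a double sum over \<open>Basis\<close>, whence the
    division by the squared dimension.\<close>
  define e' where "e' = e / ?n\<^sup>2"
  have e': "e' > 0" using assms(4) by (simp add: e'_def)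
  have "\<forall>\<^sub>F p in at p\<^sub>0. dist (iter_deriv [c, b] f p) (iter_deriv [c, b] f p\<^sub>0) < e'" for b c
  proof -
    have "iter_deriv [c, b] f differentiable (at p\<^sub>0)"
      using smooth_onD assms by blast
    then have "isCont (iter_deriv [c, b] f) p\<^sub>0"
      by (rule differentiable_imp_continuous_within)
    then show ?thesis using e' unfolding isCont_def by (rule tendstoD)
  qed
  then have "\<forall>\<^sub>F p in at p\<^sub>0. \<forall>b\<in>Basis. \<forall>c\<in>Basis. dist (iter_deriv [c, b] f p) (iter_deriv [c, b] f p\<^sub>0) < e'"
    by (intro eventually_ball_finite ballI finite_Basis)
  then obtain d1 where d1: "d1 > 0" "\<And>p b c. p \<noteq> p\<^sub>0 \<Longrightarrow> dist p p\<^sub>0 < d1 \<Longrightarrow> b \<in> Basis \<Longrightarrow> c \<in> Basis \<Longrightarrow>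
      dist (iter_deriv [c, b] f p) (iter_deriv [c, b] f p\<^sub>0) < e'"
    unfolding eventually_at by blast
  obtain d2 where d2: "d2 > 0" "ball p\<^sub>0 d2 \<subseteq> S"
    using assms openE by blast
  define d where "d = min d1 d2"
  have Hb: "norm (H p w - H p\<^sub>0 w) \<le> e * (norm w)\<^sup>2" if "p \<in> ball p\<^sub>0 d" for p w
  proof -
    have "norm (H p w - H p\<^sub>0 w) = norm (\<Sum>b\<in>Basis. \<Sum>c\<in>Basis. ((w \<bullet> b) * (w \<bullet> c)) *\<^sub>R (iter_deriv [c, b] f p - iter_deriv [c, b] f p\<^sub>0))"
      by (simp add: H_def sum_subtractf scaleR_diff_right)
    also have "\<dots> \<le> (\<Sum>b\<in>(Basis::'a set). \<Sum>c\<in>(Basis::'a set). (norm w * norm w) * e')"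
    proof (intro sum_norm_le)
      fix b c :: 'a assume bc: "b \<in> Basis" "c \<in> Basis"
      have "norm (iter_deriv [c, b] f p - iter_deriv [c, b] f p\<^sub>0) \<le> e'"
        using d1(2)[of p b c] bc that e' by (cases "p = p\<^sub>0") (auto simp: d_def dist_norm norm_minus_commute simp del: iter_deriv.simps)
      moreover have "\<bar>(w \<bullet> b) * (w \<bullet> c)\<bar> \<le> norm w * norm w"
        unfolding abs_mult using bc by (intro mult_mono) (auto simp: Basis_le_norm)
      ultimately show "norm (((w \<bullet> b) * (w \<bullet> c)) *\<^sub>R (iter_deriv [c, b] f p - iter_deriv [c, b] f p\<^sub>0)) \<le> (norm w * norm w) * e'"
        unfolding norm_scaleR by (intro mult_mono) auto
    qed
    also have "\<dots> = e * (norm w)\<^sup>2"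
      by (simp add: e'_def power2_eq_square)
    finally show ?thesis .
  qed
  show ?thesis
  proof (rule that[of d])
    show "d > 0" using d1 d2 by (simp add: d_def)
    show sub: "ball p\<^sub>0 d \<subseteq> S" using d2 by (auto simp: d_def)
    fix p w assume pw: "p \<in> ball p\<^sub>0 d" "p + w \<in> ball p\<^sub>0 d"
    have seg: "p + s *\<^sub>R w \<in> ball p\<^sub>0 d" if "s \<in> {0..1}" for s
    proof -
      have "p + s *\<^sub>R w = (1 - s) *\<^sub>R p + s *\<^sub>R (p + w)" by (simp add: algebra_simps)
      then show ?thesis using convex_ball[of p\<^sub>0 d] pw that unfolding convex_alt
        by (metis atLeastAtMost_iff)
    qed
    have diff: "iter_deriv vs f differentiable (at x)" if "x \<in> ball p\<^sub>0 d" for x vs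
      using smooth_onD assms(2) sub that by blast
    let ?D = "\<lambda>p. frechet_derivative f (at p) w"
    have path: "((\<lambda>s. p + s *\<^sub>R w) has_vector_derivative w) (at s within A)" for s A
      by (auto intro!: derivative_eq_intros)
    have k1: "((\<lambda>s. f (p + s *\<^sub>R w)) has_vector_derivative ?D (p + s *\<^sub>R w)) (at s within {0..1})"
      if "s \<in> {0..1}" for s
    proof -
      have "(f has_derivative frechet_derivative f (at (p + s *\<^sub>R w))) (at (p + s *\<^sub>R w))"
        using diff[of _ "[]"] seg[OF that] frechet_derivative_works by auto
      from vector_derivative_diff_chain_within[OF path has_derivative_at_withinI[OF this]]
      show ?thesis by (simp add: o_def)
    qed
    have k2: "((\<lambda>s. ?D (p + s *\<^sub>R w)) has_vector_derivative H (p + s *\<^sub>R w) w) (at s within {0..1})"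
      if "s \<in> {0..1}" for s
    proof -
      have "((\<lambda>s. \<Sum>b\<in>Basis. (w \<bullet> b) *\<^sub>R iter_deriv [b] f (p + s *\<^sub>R w)) has_vector_derivative
           (\<Sum>b\<in>Basis. (w \<bullet> b) *\<^sub>R frechet_derivative (iter_deriv [b] f) (at (p + s *\<^sub>R w)) w)) (at s within {0..1})"
      proof (intro has_vector_derivative_sum)
        fix b :: 'a
        have "(iter_deriv [b] f has_derivative frechet_derivative (iter_deriv [b] f) (at (p + s *\<^sub>R w))) (at (p + s *\<^sub>R w))"
          using diff[OF seg[OF that]] frechet_derivative_works by blast
        from vector_derivative_diff_chain_within[OF path has_derivative_at_withinI[OF this]]
        have "((\<lambda>s. iter_deriv [b] f (p + s *\<^sub>R w)) has_vector_derivative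
           frechet_derivative (iter_deriv [b] f) (at (p + s *\<^sub>R w)) w) (at s within {0..1})"
          by (simp add: o_def)
        then show "((\<lambda>s. (w \<bullet> b) *\<^sub>R iter_deriv [b] f (p + s *\<^sub>R w)) has_vector_derivative
           (w \<bullet> b) *\<^sub>R frechet_derivative (iter_deriv [b] f) (at (p + s *\<^sub>R w)) w) (at s within {0..1})"
          by (rule bounded_linear.has_vector_derivative[OF bounded_linear_scaleR_right])
      qed
      moreover have "(\<Sum>b\<in>Basis. (w \<bullet> b) *\<^sub>R frechet_derivative (iter_deriv [b] f) (at (p + s *\<^sub>R w)) w) = H (p + s *\<^sub>R w) w"
        unfolding H_def
        by (intro sum.cong refl, subst frechet_derivative_expand[OF diff[OF seg[OF that]]])
           (simp add: scaleR_sum_right)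
      moreover have "(\<Sum>b\<in>Basis. (w \<bullet> b) *\<^sub>R iter_deriv [b] f (p + s *\<^sub>R w)) = ?D (p + s *\<^sub>R w)" if "s \<in> {0..1}" for s
        using frechet_derivative_expand[of f "p + s *\<^sub>R w" w] diff[of "p + s *\<^sub>R w" "[]"] seg[OF that] by simp
      ultimately show ?thesis
        by (metis (no_types, lifting) has_vector_derivative_transform that)
    qed
    \<comment> \<open>The s-derivative of \<open>?r\<close> is \<open>?r1\<close>, and that of
      \<open>?r1\<close> is the variation of the quadratic term estimated in \<open>Hb\<close>. The
      mean value inequality on the unit interval is applied to each in turn and keeps the
      bound.\<close>
    let ?r1 = "\<lambda>s. ?D (p + s *\<^sub>R w) - ?D p - s *\<^sub>R H p\<^sub>0 w"
    let ?r = "\<lambda>s. f (p + s *\<^sub>R w) - f p - s *\<^sub>R ?D p - (s\<^sup>2 / 2) *\<^sub>R H p\<^sub>0 w"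
    have r1: "norm (?r1 s) \<le> e * (norm w)\<^sup>2" if "s \<in> {0..1}" for s
    proof -
      have "norm (?r1 s - ?r1 0) \<le> (e * (norm w)\<^sup>2) * norm (s - 0)"
      proof (rule differentiable_bound[where S = "{0..1}" and f' = "\<lambda>s x. x *\<^sub>R (H (p + s *\<^sub>R w) w - H p\<^sub>0 w)"])
        fix x :: real assume x: "x \<in> {0..1}"
        show "(?r1 has_derivative (\<lambda>y. y *\<^sub>R (H (p + x *\<^sub>R w) w - H p\<^sub>0 w))) (at x within {0..1})"
          using k2[OF x] unfolding has_vector_derivative_def[symmetric]
          by (auto intro!: derivative_eq_intros)
        show "onorm (\<lambda>y. y *\<^sub>R (H (p + x *\<^sub>R w) w - H p\<^sub>0 w)) \<le> e * (norm w)\<^sup>2"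
          by (rule onorm_le) (use Hb[OF seg[OF x], of w] in \<open>auto simp: mult_left_mono mult.commute[of _ "\<bar>_\<bar>"]\<close>)
      qed (use that in auto)
      moreover have "(e * (norm w)\<^sup>2) * norm (s - 0) \<le> (e * (norm w)\<^sup>2) * 1"
        using that assms(4) by (intro mult_left_mono) auto
      ultimately show ?thesis by simp
    qed
    have "norm (?r 1 - ?r 0) \<le> (e * (norm w)\<^sup>2) * norm (1 - 0 :: real)"
    proof (rule differentiable_bound[where S = "{0..1}" and f' = "\<lambda>s x. x *\<^sub>R ?r1 s"])
      fix x :: real assume x: "x \<in> {0..1}"
      show "(?r has_derivative (\<lambda>y. y *\<^sub>R ?r1 x)) (at x within {0..1})"
        using k1[OF x] unfolding has_vector_derivative_def[symmetric]
        by (auto intro!: derivative_eq_intros)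
      show "onorm (\<lambda>y. y *\<^sub>R ?r1 x) \<le> e * (norm w)\<^sup>2"
        by (rule onorm_le) (use r1[OF x] in \<open>auto simp: mult_left_mono mult.commute[of _ "\<bar>_\<bar>"]\<close>)
    qed auto
    then show "norm (f (p + w) - f p - frechet_derivative f (at p) w -
        (1/2) *\<^sub>R (\<Sum>b\<in>Basis. \<Sum>c\<in>Basis. ((w \<bullet> b) * (w \<bullet> c)) *\<^sub>R iter_deriv [c, b] f p\<^sub>0)) \<le> e * (norm w)\<^sup>2"
      by (simp add: H_def)
  qed
qed

section \<open>Defects of holomorphy and the diastasis\<close>

text \<open>Conjugating the second slot makes both arguments points near \<open>x\<^sub>0\<close>,
  so that the homotopy moves them by plain translations.\<close>

definition twist :: "((complex^'n) \<times> (complex^'n) \<Rightarrow> complex) \<Rightarrow> (complex^'n) \<times> (complex^'n) \<Rightarrow> complex" where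
  "twist g p = g (fst p, vcnj (snd p))"

text \<open>The derivative at \<open>p\<close> of \<open>twist g\<close> in the direction of the homotopy \<open>(0, z)\<close>, minus the
  \<open>\<partial>\<close>-bar derivative of the diagonal translation by \<open>z\<close>. It vanishes for \<open>g\<close> holomorphic.\<close>

definition defect :: "((complex^'n) \<times> (complex^'n) \<Rightarrow> complex) \<Rightarrow> (complex^'n) \<times> (complex^'n) \<Rightarrow> complex^'n \<Rightarrow> complex" where
  "defect g p z = frechet_derivative g (at p) (0, vcnj z)
     - (frechet_derivative g (at p) (z, vcnj z) + \<i> * frechet_derivative g (at p) (\<i> *s z, vcnj (\<i> *s z))) / 2"

lemma twist_has_derivative:
  assumes "g differentiable (at (x, vcnj q))"
  shows "(twist g has_derivative (\<lambda>w. frechet_derivative g (at (x, vcnj q)) (fst w, vcnj (snd w)))) (at (x, q))"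
proof -
  have "((\<lambda>p. (fst p, vcnj (snd p))) has_derivative (\<lambda>w. (fst w, vcnj (snd w)))) (at (x, q))"
    by (intro derivative_intros bounded_linear.has_derivative[OF bounded_linear_vcnj])
  moreover have "(g has_derivative frechet_derivative g (at (x, vcnj q))) (at (x, vcnj q))"
    using assms frechet_derivative_works by blast
  ultimately show ?thesis
    unfolding twist_def[abs_def] by (auto intro: has_derivative_compose)
qed

lemma partial_derivatives:
  fixes g :: "'a::euclidean_space \<times> 'b::euclidean_space \<Rightarrow> complex"
  assumes "g differentiable (at (x, y))"
  shows "(\<lambda>x'. g (x', y)) differentiable (at x)" "(\<lambda>y'. g (x, y')) differentiable (at y)"
    and "frechet_derivative (\<lambda>x'. g (x', y)) (at x) = (\<lambda>w. frechet_derivative g (at (x, y)) (w, 0))"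
    and "frechet_derivative (\<lambda>y'. g (x, y')) (at y) = (\<lambda>w. frechet_derivative g (at (x, y)) (0, w))"
proof -
  have g: "(g has_derivative frechet_derivative g (at (x, y))) (at (x, y))"
    using assms frechet_derivative_works by blast
  have 1: "((\<lambda>x'. g (x', y)) has_derivative (\<lambda>w. frechet_derivative g (at (x, y)) (w, 0))) (at x)"
    by (rule has_derivative_compose[of "\<lambda>x'. (x', y)" "\<lambda>w. (w, 0)", OF _ g]) (intro derivative_intros)
  have 2: "((\<lambda>y'. g (x, y')) has_derivative (\<lambda>w. frechet_derivative g (at (x, y)) (0, w))) (at y)"
    by (rule has_derivative_compose[of "\<lambda>y'. (x, y')" "\<lambda>w. (0, w)", OF _ g]) (intro derivative_intros)
  show "(\<lambda>x'. g (x', y)) differentiable (at x)" "(\<lambda>y'. g (x, y')) differentiable (at y)"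
    using 1 2 by (auto simp: differentiable_def)
  show "frechet_derivative (\<lambda>x'. g (x', y)) (at x) = (\<lambda>w. frechet_derivative g (at (x, y)) (w, 0))"
     "frechet_derivative (\<lambda>y'. g (x, y')) (at y) = (\<lambda>w. frechet_derivative g (at (x, y)) (0, w))"
    using frechet_derivative_at[OF 1] frechet_derivative_at[OF 2] by auto
qed

text \<open>The parts that are complex linear in each slot cancel, which leaves the difference of
  the conjugate-linear parts in the two slots. These are governed by the d-bar derivatives that
  almost holomorphy makes flat.\<close>

lemma defect_decompose:
  assumes "g differentiable (at p)"
  shows "defect g p z = (frechet_derivative g (at p) (0, vcnj z) + \<i> * frechet_derivative g (at p) (0, \<i> *s vcnj z)) / 2
      - (frechet_derivative g (at p) (z, 0) + \<i> * frechet_derivative g (at p) (\<i> *s z, 0)) / 2"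
proof -
  interpret linear "frechet_derivative g (at p)"
    by (rule linear_frechet_derivative[OF assms])
  have e: "frechet_derivative g (at p) (a, b) = frechet_derivative g (at p) (a, 0) + frechet_derivative g (at p) (0, b)" for a b
    by (simp flip: add)
  have m: "frechet_derivative g (at p) (0, - b) = - frechet_derivative g (at p) (0, b)" for b
    using neg[of "(0, b)"] by simp
  show ?thesis
    unfolding defect_def vcnj_imult e[of z "vcnj z"] e[of "\<i> *s z" "- (\<i> *s vcnj z)"] m by (simp add: field_simps)
qed

lemma defect_le:
  fixes g :: "(complex^'n) \<times> (complex^'n) \<Rightarrow> complex"
  assumes g: "g differentiable (at (x, y))"
    and 1: "\<And>j. norm (d_zbar j (\<lambda>x'. g (x', y)) x) \<le> e"
    and 2: "\<And>j. norm (d_zbar j (\<lambda>y'. g (x, y')) y) \<le> e"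
  shows "norm (defect g (x, y) z) \<le> 2 * real CARD('n) * e * norm z"
proof -
  note p = partial_derivatives[OF g]
  note a1 = antilinear_part_bound[OF p(1) 1, of z, unfolded p(3)]
  note a2 = antilinear_part_bound[OF p(2) 2, of "vcnj z", unfolded p(4) norm_vcnj]
  have "norm (defect g (x, y) z) \<le> (2 * real CARD('n) * e * norm z) / 2 + (2 * real CARD('n) * e * norm z) / 2"
    unfolding defect_decompose[OF g]
    by (rule order_trans[OF norm_triangle_ineq4], rule add_mono)
       (use a1 a2 in \<open>simp_all only: norm_divide norm_numeral divide_right_mono zero_le_numeral\<close>)
  then show ?thesis by (simp add: mult_ac)
qed

text \<open>Serves functions without any holomorphy, such as the remainder of a truncated symbol
  expansion. The 3 is 1 from the first term plus half of 2 + 2 from the others, the norm of a pair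
  being bounded by the sum of the norms.\<close>

lemma defect_le_derivative:
  assumes "\<And>w. norm (frechet_derivative g (at p) w) \<le> B * norm w" "B \<ge> 0"
  shows "norm (defect g p z) \<le> 3 * B * norm z"
proof -
  have n: "norm (a, b) \<le> norm a + norm b" for a b :: "complex^'a"
    using norm_Pair_le .
  have 1: "norm (frechet_derivative g (at p) (a, b)) \<le> B * (norm a + norm b)" for a b
    using assms(1)[of "(a, b)"] mult_left_mono[OF n[of a b] assms(2)] by linarith
  have "norm (defect g p z) \<le> norm (frechet_derivative g (at p) (0, vcnj z)) +
      (norm (frechet_derivative g (at p) (z, vcnj z)) + norm (frechet_derivative g (at p) (\<i> *s z, vcnj (\<i> *s z)))) / 2"
  proof -
    have "norm (a - (b + \<i> * c) / 2) \<le> norm a + (norm b + norm c) / 2" for a b c :: complex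
    proof -
      have "norm (a - (b + \<i> * c) / 2) \<le> norm a + norm ((b + \<i> * c) / 2)" by (rule norm_triangle_ineq4)
      also have "norm ((b + \<i> * c) / 2) \<le> (norm b + norm c) / 2"
        using norm_triangle_ineq[of b "\<i> * c"] by (simp add: norm_divide norm_mult)
      finally show ?thesis by simp
    qed
    then show ?thesis unfolding defect_def .
  qed
  also have "\<dots> \<le> 3 * B * norm z"
    using 1[of 0 "vcnj z"] 1[of z "vcnj z"] 1[of "\<i> *s z" "vcnj (\<i> *s z)"]
    unfolding norm_vcnj norm_imult norm_zero by argo
  finally show ?thesis .
qed

section \<open>Flatness of the defect for almost holomorphic functions and for symbols\<close>

lemma flat_antidiagonalD:
  assumes "flat_antidiagonal G (\<lambda>(x, y). F x y)" "compact K" "K \<subseteq> G"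
  shows "\<exists>C. \<forall>x y. (x, y) \<in> K \<longrightarrow> norm (F x y) \<le> C * norm (y - vcnj x) ^ N"
proof -
  obtain C where "\<forall>(x, y)\<in>K. norm ((\<lambda>(x, y). F x y) (x, y)) \<le> C * norm (y - vcnj x) ^ N"
    using assms unfolding flat_antidiagonal_def by meson
  then show ?thesis by (intro exI[of _ C]) auto
qed

lemma almost_holomorphic_defect:
  fixes f :: "(complex^'n) \<times> (complex^'n) \<Rightarrow> complex"
  assumes "almost_holomorphic G f" "compact K" "K \<subseteq> G"
  obtains C where "C \<ge> 0" "\<And>x y z. (x, y) \<in> K \<Longrightarrow> norm (defect f (x, y) z) \<le> C * norm (y - vcnj x) ^ N * norm z"
proof -
  have "\<exists>C. \<forall>x y. (x, y) \<in> K \<longrightarrow> norm (d_zbar j (\<lambda>x'. f (x', y)) x) \<le> C * norm (y - vcnj x) ^ N" for j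
    using assms by (intro flat_antidiagonalD) (auto simp: almost_holomorphic_def)
  then obtain C1 where C1: "\<And>j x y. (x, y) \<in> K \<Longrightarrow> norm (d_zbar j (\<lambda>x'. f (x', y)) x) \<le> C1 j * norm (y - vcnj x) ^ N"
    by metis
  have "\<exists>C. \<forall>x y. (x, y) \<in> K \<longrightarrow> norm (d_zbar j (\<lambda>y'. f (x, y')) y) \<le> C * norm (y - vcnj x) ^ N" for j
    using assms by (intro flat_antidiagonalD) (auto simp: almost_holomorphic_def)
  then obtain C2 where C2: "\<And>j x y. (x, y) \<in> K \<Longrightarrow> norm (d_zbar j (\<lambda>y'. f (x, y')) y) \<le> C2 j * norm (y - vcnj x) ^ N"
    by metis
  define C where "C = (\<Sum>j\<in>UNIV. \<bar>C1 j\<bar> + \<bar>C2 j\<bar>)"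
  have "\<bar>C1 j\<bar> + \<bar>C2 j\<bar> \<le> C" for j
    unfolding C_def by (rule member_le_sum) auto
  then have C: "C1 j \<le> C" "C2 j \<le> C" for j
    by (smt (verit))+
  have "C \<ge> 0" by (auto simp: C_def intro!: sum_nonneg)
  show ?thesis
  proof (rule that)
    show "2 * real CARD('n) * C \<ge> 0" using \<open>C \<ge> 0\<close> by simp
    fix x y z assume xy: "(x, y) \<in> K"
    have "norm (defect f (x, y) z) \<le> 2 * real CARD('n) * (C * norm (y - vcnj x) ^ N) * norm z"
    proof (rule defect_le)
      show "f differentiable (at (x, y))"
        using assms xy smooth_on_differentiable unfolding almost_holomorphic_def by blast
      show "norm (d_zbar j (\<lambda>x'. f (x', y)) x) \<le> C * norm (y - vcnj x) ^ N"
        "norm (d_zbar j (\<lambda>y'. f (x, y')) y) \<le> C * norm (y - vcnj x) ^ N" for j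
        using C1[OF xy, of j] C2[OF xy, of j] mult_right_mono[OF C(1), of "norm (y - vcnj x) ^ N" j]
          mult_right_mono[OF C(2), of "norm (y - vcnj x) ^ N" j] by auto
    qed
    then show "norm (defect f (x, y) z) \<le> 2 * real CARD('n) * C * norm (y - vcnj x) ^ N * norm z"
      by (simp add: mult.assoc)
  qed
qed

lemma defect_add:
  assumes "f differentiable (at p)" "g differentiable (at p)"
  shows "defect (\<lambda>q. f q + g q) p z = defect f p z + defect g p z"
proof -
  have "(\<lambda>w. frechet_derivative f (at p) w + frechet_derivative g (at p) w) = frechet_derivative (\<lambda>q. f q + g q) (at p)"
    using assms frechet_derivative_works by (intro frechet_derivative_at has_derivative_add) blast+
  then have e: "frechet_derivative (\<lambda>q. f q + g q) (at p) w = frechet_derivative f (at p) w + frechet_derivative g (at p) w" for w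
    by (metis (no_types, lifting))
  show ?thesis
    unfolding defect_def e by (simp add: field_simps)
qed

lemma frechet_derivative_cmult:
  fixes f :: "'a::real_normed_vector \<Rightarrow> complex"
  assumes "f differentiable (at p)"
  shows "frechet_derivative (\<lambda>q. c * f q) (at p) = (\<lambda>w. c * frechet_derivative f (at p) w)"
  using assms frechet_derivative_works
  by (intro frechet_derivative_at[symmetric] has_derivative_mult_right) blast

lemma defect_cmult:
  assumes "f differentiable (at p)"
  shows "defect (\<lambda>q. c * f q) p z = c * defect f p z"
  unfolding defect_def frechet_derivative_cmult[OF assms] by (simp add: field_simps)

lemma defect_sum:
  assumes "finite A" "\<And>j. j \<in> A \<Longrightarrow> f j differentiable (at p)"
  shows "defect (\<lambda>q. \<Sum>j\<in>A. f j q) p z = (\<Sum>j\<in>A. defect (f j) p z)"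
  using assms
proof (induction A rule: finite_induct)
  case empty
  show ?case by (simp add: defect_def)
next
  case (insert a A)
  then show ?case by (simp add: defect_add)
qed

text \<open>Only the coefficients of the symbol are almost holomorphic. Truncation after
  \<open>N\<close> terms leaves a remainder with first derivatives of size \<open>h ^ N\<close>, to
  which the crude derivative bound applies, while the truncated sum inherits the flatness of its
  coefficients. The same \<open>N\<close> serves as truncation order and as flatness order.\<close>

lemma classical_symbol_defect:
  fixes a :: "real \<Rightarrow> (complex^'n) \<times> (complex^'n) \<Rightarrow> complex"
  assumes sym: "classical_symbol G a as" and ah: "\<And>j. almost_holomorphic G (as j)"
    and K: "compact K" "K \<subseteq> G"
  obtains C where "C \<ge> 0" "\<forall>\<^sub>F h in at_right 0. \<forall>x y z. (x, y) \<in> K \<longrightarrow>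
      norm (defect (a h) (x, y) z) \<le> C * (h ^ N + norm (y - vcnj x) ^ N) * norm z"
proof -
  define r where "r h q = a h q - (\<Sum>j<N. complex_of_real h ^ j * as j q)" for h q
  have "\<forall>b. \<exists>C. \<forall>\<^sub>F h in at_right 0. \<forall>p\<in>K. norm (iter_deriv [b] (r h) p) \<le> C * h ^ N"
    using sym K unfolding classical_symbol_def r_def by blast
  from choice[OF this] obtain Cb where
    Cb: "\<forall>b. \<forall>\<^sub>F h in at_right 0. \<forall>p\<in>K. norm (iter_deriv [b] (r h) p) \<le> Cb b * h ^ N"
    by blast
  define E where "E = (\<Sum>b\<in>Basis. \<bar>Cb b\<bar>)"
  have E: "Cb b \<le> E" if "b \<in> Basis" for b
  proof -
    have "\<bar>Cb b\<bar> \<le> E" unfolding E_def by (rule member_le_sum) (use that in auto)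
    then show ?thesis by simp
  qed
  have "E \<ge> 0" by (simp add: E_def sum_nonneg)
  have "\<exists>C\<ge>0. \<forall>x y z. (x, y) \<in> K \<longrightarrow> norm (defect (as j) (x, y) z) \<le> C * norm (y - vcnj x) ^ N * norm z" for j
    using almost_holomorphic_defect[OF ah K, of j N] by metis
  then obtain Cj where Cj: "\<And>j. Cj j \<ge> 0"
      "\<And>j x y z. (x, y) \<in> K \<Longrightarrow> norm (defect (as j) (x, y) z) \<le> Cj j * norm (y - vcnj x) ^ N * norm z"
    by metis
  define F where "F = (\<Sum>j<N. Cj j)"
  have "F \<ge> 0" using Cj by (simp add: F_def sum_nonneg)
  define C where "C = 3 * (DIM((complex^'n) \<times> (complex^'n)) * E) + F"
  have "\<forall>\<^sub>F h in at_right 0. \<forall>b\<in>Basis. \<forall>p\<in>K. norm (iter_deriv [b] (r h) p) \<le> Cb b * h ^ N"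
  proof (rule eventually_ball_finite, rule finite_Basis, rule ballI)
    fix b show "\<forall>\<^sub>F h in at_right 0. \<forall>p\<in>K. norm (iter_deriv [b] (r h) p) \<le> Cb b * h ^ N"
      using Cb by (rule spec)
  qed
  moreover have "\<forall>\<^sub>F h in at_right 0. smooth_on G (a h)"
    using sym by (simp add: classical_symbol_def)
  moreover have "\<forall>\<^sub>F h::real in at_right 0. 0 < h \<and> h < 1"
    by (simp add: eventually_at_right[of 0 1]) (metis zero_less_one)
  ultimately have ev: "\<forall>\<^sub>F h in at_right 0. \<forall>x y z. (x, y) \<in> K \<longrightarrow>
      norm (defect (a h) (x, y) z) \<le> C * (h ^ N + norm (y - vcnj x) ^ N) * norm z"
  proof eventually_elim
    case (elim h)
    show ?case
    proof (intro allI impI)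
      fix x y z assume xy: "(x, y) \<in> K"
      let ?p = "(x, y)" and ?s = "\<lambda>q. \<Sum>j<N. complex_of_real h ^ j * as j q"
      have das: "as j differentiable (at ?p)" for j
        using ah[of j] xy K smooth_on_differentiable unfolding almost_holomorphic_def by blast
      have dsj: "(\<lambda>q. complex_of_real h ^ j * as j q) differentiable (at ?p)" for j
        by (intro differentiable_mult das differentiable_const)
      have ds: "?s differentiable (at ?p)"
        by (intro differentiable_sum dsj ballI finite_lessThan)
      have da: "a h differentiable (at ?p)"
        using elim xy K smooth_on_differentiable by blast
      have dr: "r h differentiable (at ?p)"
        unfolding r_def using ds da by (intro differentiable_diff)
      have "norm (frechet_derivative (r h) (at ?p) w) \<le> (DIM((complex^'n) \<times> (complex^'n)) * (E * h ^ N)) * norm w" for w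
      proof (rule frechet_derivative_bound[OF dr])
        fix b :: "(complex^'n) \<times> (complex^'n)" assume b: "b \<in> Basis"
        have "norm (iter_deriv [b] (r h) (x, y)) \<le> Cb b * h ^ N" using elim b xy by blast
        also have "\<dots> \<le> E * h ^ N" using E[OF b] elim by (intro mult_right_mono) auto
        finally show "norm (iter_deriv [b] (r h) (x, y)) \<le> E * h ^ N" .
      qed
      then have 1: "norm (defect (r h) ?p z) \<le> 3 * (DIM((complex^'n) \<times> (complex^'n)) * (E * h ^ N)) * norm z"
        using elim \<open>E \<ge> 0\<close> by (intro defect_le_derivative) auto
      have "defect ?s ?p z = (\<Sum>j<N. complex_of_real h ^ j * defect (as j) ?p z)"
        using dsj by (simp add: defect_sum defect_cmult[OF das])
      also have "norm \<dots> \<le> (\<Sum>j<N. Cj j * norm (y - vcnj x) ^ N * norm z)"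
      proof (rule sum_norm_le)
        fix j
        have "norm (complex_of_real h ^ j * defect (as j) ?p z) \<le> 1 * (Cj j * norm (y - vcnj x) ^ N * norm z)"
          unfolding norm_mult using elim Cj(2)[OF xy, of j z]
          by (intro mult_mono) (auto simp: norm_power power_le_one)
        then show "norm (complex_of_real h ^ j * defect (as j) ?p z) \<le> Cj j * norm (y - vcnj x) ^ N * norm z" by simp
      qed
      also have "\<dots> = F * norm (y - vcnj x) ^ N * norm z"
        by (simp add: F_def sum_distrib_right)
      finally have 2: "norm (defect ?s ?p z) \<le> F * norm (y - vcnj x) ^ N * norm z" .
      have "a h = (\<lambda>q. r h q + ?s q)" by (simp add: r_def)
      then have "defect (a h) ?p z = defect (r h) ?p z + defect ?s ?p z"
        using defect_add[OF dr ds, of z] by simp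
      then have "norm (defect (a h) ?p z) \<le> norm (defect (r h) ?p z) + norm (defect ?s ?p z)"
        by (simp add: norm_triangle_ineq)
      also have "\<dots> \<le> (3 * (DIM((complex^'n) \<times> (complex^'n)) * E)) * (h ^ N * norm z) + F * (norm (y - vcnj x) ^ N * norm z)"
        using 1 2 by (simp add: mult_ac)
      also have "\<dots> \<le> C * (h ^ N * norm z) + C * (norm (y - vcnj x) ^ N * norm z)"
        unfolding C_def using elim \<open>E \<ge> 0\<close> \<open>F \<ge> 0\<close> by (intro add_mono mult_right_mono) auto
      also have "\<dots> = C * (h ^ N + norm (y - vcnj x) ^ N) * norm z" by (simp add: algebra_simps)
      finally show "norm (defect (a h) ?p z) \<le> \<dots>" .
    qed
  qed
  have "C \<ge> 0" using \<open>E \<ge> 0\<close> \<open>F \<ge> 0\<close> by (simp add: C_def)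
  then show ?thesis using ev by (rule that)
qed

text \<open>Calabi's diastasis of the potential \<Phi>, with twice the real part of one value of
  \<Psi> in place of the sum of the values at (p, cnj q) and (q, cnj p), as no Hermitian symmetry of
  \<Psi> is assumed. The sizes of the exponentials inside the homotopy are expressed through
  it.\<close>

definition diastasis :: "(complex^'n \<Rightarrow> real) \<Rightarrow> ((complex^'n) \<times> (complex^'n) \<Rightarrow> complex) \<Rightarrow> complex^'n \<Rightarrow> complex^'n \<Rightarrow> real" where
  "diastasis \<Phi> \<Psi> p q = \<Phi> p + \<Phi> q - 2 * Re (\<Psi> (p, vcnj q))"

lemma open_twist_ball:
  assumes "open G" "(x\<^sub>0, vcnj x\<^sub>0) \<in> G"
  obtains d where "d > 0" "\<And>p q. p \<in> ball x\<^sub>0 d \<Longrightarrow> q \<in> ball x\<^sub>0 d \<Longrightarrow> (p, vcnj q) \<in> G"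
proof -
  obtain A B where "open A" "open B" "x\<^sub>0 \<in> A" "vcnj x\<^sub>0 \<in> B" "A \<times> B \<subseteq> G"
    by (rule open_prod_elim[OF assms]) auto
  moreover then obtain d1 d2 where "d1 > 0" "ball x\<^sub>0 d1 \<subseteq> A" "d2 > 0" "ball (vcnj x\<^sub>0) d2 \<subseteq> B"
    by (meson openE)
  ultimately show ?thesis
    by (intro that[of "min d1 d2"]) (auto simp: subset_iff)
qed

lemma antiholomorphic_diagonal:
  fixes \<Psi> :: "(complex^'n) \<times> (complex^'n) \<Rightarrow> complex"
  assumes ah: "almost_holomorphic G \<Psi>" and q: "(q, vcnj q) \<in> G"
  shows "frechet_derivative \<Psi> (at (q, vcnj q)) (\<i> *s w, 0) = \<i> * frechet_derivative \<Psi> (at (q, vcnj q)) (w, 0)"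
    and "frechet_derivative \<Psi> (at (q, vcnj q)) (0, \<i> *s w) = \<i> * frechet_derivative \<Psi> (at (q, vcnj q)) (0, w)"
proof -
  have d: "\<Psi> differentiable (at (q, vcnj q))"
    using ah q smooth_on_differentiable unfolding almost_holomorphic_def by blast
  \<comment> \<open>On the one-point compact set the right side vanishes because the exponent is 1;
    exponent 0 would give nothing, as 0 ^ 0 = 1.\<close>
  have "\<exists>C. \<forall>x y. (x, y) \<in> {(q, vcnj q)} \<longrightarrow> norm (d_zbar j (\<lambda>x'. \<Psi> (x', y)) x) \<le> C * norm (y - vcnj x) ^ 1"
    "\<exists>C. \<forall>x y. (x, y) \<in> {(q, vcnj q)} \<longrightarrow> norm (d_zbar j (\<lambda>y'. \<Psi> (x, y')) y) \<le> C * norm (y - vcnj x) ^ 1" for j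
    by (rule flat_antidiagonalD; use ah q in \<open>simp add: almost_holomorphic_def\<close>)+
  then have z: "norm (d_zbar j (\<lambda>x'. \<Psi> (x', vcnj q)) q) \<le> 0" "norm (d_zbar j (\<lambda>y'. \<Psi> (q, y')) (vcnj q)) \<le> 0" for j
    by auto
  note p = partial_derivatives[OF d]
  have s: "b = \<i> * a" if "norm (a + \<i> * b) \<le> 2 * real CARD('n) * 0 * norm w" for a b :: complex
  proof -
    have "\<i> * (a + \<i> * b) = 0" using that by simp
    then show ?thesis by (simp add: algebra_simps)
  qed
  show "frechet_derivative \<Psi> (at (q, vcnj q)) (\<i> *s w, 0) = \<i> * frechet_derivative \<Psi> (at (q, vcnj q)) (w, 0)"
    by (rule s) (rule antilinear_part_bound[OF p(1) z(1), of w, unfolded p(3)])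
  show "frechet_derivative \<Psi> (at (q, vcnj q)) (0, \<i> *s w) = \<i> * frechet_derivative \<Psi> (at (q, vcnj q)) (0, w)"
    by (rule s) (rule antilinear_part_bound[OF p(2) z(2), of w, unfolded p(4)])
qed

text \<open>On the diagonal \<open>\<Psi>\<close> is real, and its derivative is complex linear in \<open>x\<close> and in \<open>y\<close>; comparing
  the imaginary parts in the directions \<open>w\<close> and \<open>\<i>w\<close> shows that both halves have the same real part.\<close>

lemma polarization_derivative:
  fixes \<Psi> :: "(complex^'n) \<times> (complex^'n) \<Rightarrow> complex"
  assumes ah: "almost_holomorphic G \<Psi>" and "open U" "q \<in> U" and \<Phi>: "\<Phi> differentiable (at q)"
    and G: "(q, vcnj q) \<in> G" and eq: "\<And>x. x \<in> U \<Longrightarrow> \<Psi> (x, vcnj x) = complex_of_real (\<Phi> x)"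
  shows "frechet_derivative \<Phi> (at q) w = 2 * Re (frechet_derivative \<Psi> (at (q, vcnj q)) (w, 0))"
proof -
  let ?P = "frechet_derivative \<Psi> (at (q, vcnj q))"
  have d: "\<Psi> differentiable (at (q, vcnj q))"
    using ah G smooth_on_differentiable unfolding almost_holomorphic_def by blast
  interpret linear ?P by (rule linear_frechet_derivative[OF d])
  have "((\<lambda>x. (x, vcnj x)) has_derivative (\<lambda>w. (w, vcnj w))) (at q)"
    by (intro derivative_intros bounded_linear.has_derivative[OF bounded_linear_vcnj])
  then have "((\<lambda>x. \<Psi> (x, vcnj x)) has_derivative (\<lambda>w. ?P (w, vcnj w))) (at q)"
    by (rule has_derivative_compose) (use d frechet_derivative_works in blast)
  then have "((\<lambda>x. complex_of_real (\<Phi> x)) has_derivative (\<lambda>w. ?P (w, vcnj w))) (at q)"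
    by (rule has_derivative_transform_within_open[OF _ assms(2,3)]) (simp add: eq)
  moreover have "((\<lambda>x. complex_of_real (\<Phi> x)) has_derivative (\<lambda>w. complex_of_real (frechet_derivative \<Phi> (at q) w))) (at q)"
    using \<Phi> frechet_derivative_works by (intro has_derivative_of_real) blast
  ultimately have "(\<lambda>w. ?P (w, vcnj w)) = (\<lambda>w. complex_of_real (frechet_derivative \<Phi> (at q) w))"
    by (rule has_derivative_unique)
  then have e: "?P (w, vcnj w) = complex_of_real (frechet_derivative \<Phi> (at q) w)" for w
    by (rule fun_cong)
  have sp: "?P (w, k) = ?P (w, 0) + ?P (0, k)" for w k by (simp flip: add)
  have "?P (\<i> *s w, vcnj (\<i> *s w)) = \<i> * ?P (w, 0) - \<i> * ?P (0, vcnj w)"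
    using antiholomorphic_diagonal[OF ah G] neg[of "(0, \<i> *s vcnj w)"] by (simp add: sp[of "\<i> *s w"] vcnj_imult)
  then have "Re (?P (w, 0)) = Re (?P (0, vcnj w))"
    using e[of "\<i> *s w"] by (simp add: complex_eq_iff)
  moreover have "Re (?P (w, 0)) + Re (?P (0, vcnj w)) = frechet_derivative \<Phi> (at q) w"
    using e[of w] sp[of w "vcnj w"] by (metis Re_complex_of_real plus_complex.simps(1))
  ultimately show ?thesis by simp
qed

text \<open>Expanding at (q, cnj q), the values cancel because \<Psi> restricts to \<Phi> on the
  diagonal, and the linear terms cancel by \<open>polarization_derivative\<close>. What remains is
  the difference of the quadratic terms, frozen at the base point. Homogeneity of degree two is the
  only property of this form that is passed on.\<close>

lemma diastasis_taylor:
  fixes \<Psi> :: "(complex^'n) \<times> (complex^'n) \<Rightarrow> complex"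
  assumes "open \<Omega>" "smooth_on \<Omega> \<Phi>" "x\<^sub>0 \<in> \<Omega>" "open G" "(x\<^sub>0, vcnj x\<^sub>0) \<in> G"
    and pol: "almost_holomorphic_polarization x\<^sub>0 \<Phi> G \<Psi>"
  obtains L where "\<And>c w. L (c *\<^sub>R w) = c\<^sup>2 * L w"
    "\<And>e. e > 0 \<Longrightarrow> \<exists>d>0. ball x\<^sub>0 d \<subseteq> \<Omega> \<and> (\<forall>x\<in>ball x\<^sub>0 d. \<Psi> (x, vcnj x) = complex_of_real (\<Phi> x)) \<and>
      (\<forall>p\<in>ball x\<^sub>0 d. \<forall>q\<in>ball x\<^sub>0 d. (p, vcnj q) \<in> G \<and> \<bar>diastasis \<Phi> \<Psi> p q - L (p - q)\<bar> \<le> e * (norm (p - q))\<^sup>2)"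
proof -
  have ah: "almost_holomorphic G \<Psi>" and sm: "smooth_on G \<Psi>"
    using pol by (auto simp: almost_holomorphic_polarization_def almost_holomorphic_def)
  obtain d0 where d0: "d0 > 0" "\<And>x. x \<in> ball x\<^sub>0 d0 \<Longrightarrow> \<Psi> (x, vcnj x) = complex_of_real (\<Phi> x)"
    using pol unfolding almost_holomorphic_polarization_def eventually_nhds_metric
    by (auto simp: dist_commute)
  define H1 where "H1 w = (\<Sum>b\<in>Basis. \<Sum>c\<in>Basis. ((w \<bullet> b) * (w \<bullet> c)) *\<^sub>R iter_deriv [c, b] \<Phi> x\<^sub>0)" for w
  define H2 where "H2 w = (\<Sum>b\<in>Basis. \<Sum>c\<in>Basis. ((w \<bullet> b) * (w \<bullet> c)) *\<^sub>R iter_deriv [c, b] \<Psi> (x\<^sub>0, vcnj x\<^sub>0))" for w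
  define L where "L w = (1/2) * (H1 w - 2 * Re (H2 (w, 0)))" for w
  have H1c: "H1 (c *\<^sub>R w) = c\<^sup>2 * H1 w" for c w
    by (simp add: H1_def sum_distrib_left power2_eq_square mult_ac)
  have H2c: "H2 (c *\<^sub>R w) = c\<^sup>2 *\<^sub>R H2 w" for c w
    by (simp add: H2_def scaleR_sum_right power2_eq_square mult_ac)
  show ?thesis
  proof (rule that[of L])
    show "L (c *\<^sub>R w) = c\<^sup>2 * L w" for c w
      using H2c[of c "(w, 0)"] by (simp add: L_def H1c algebra_simps)
    fix e :: real assume "e > 0"
    \<comment> \<open>One third each: the Taylor error of \<Phi> enters once, that of \<Psi>
      twice.\<close>
    then have e: "e / 3 > 0" by simp
    obtain d1 where d1: "d1 > 0" "ball x\<^sub>0 d1 \<subseteq> \<Omega>" "\<And>p w. p \<in> ball x\<^sub>0 d1 \<Longrightarrow> p + w \<in> ball x\<^sub>0 d1 \<Longrightarrow>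
        norm (\<Phi> (p + w) - \<Phi> p - frechet_derivative \<Phi> (at p) w - (1/2) *\<^sub>R H1 w) \<le> e / 3 * (norm w)\<^sup>2"
      using smooth_on_taylor2[OF assms(1-3) e, folded H1_def] by blast
    obtain d2 where d2: "d2 > 0" "ball (x\<^sub>0, vcnj x\<^sub>0) d2 \<subseteq> G" "\<And>p w. p \<in> ball (x\<^sub>0, vcnj x\<^sub>0) d2 \<Longrightarrow> p + w \<in> ball (x\<^sub>0, vcnj x\<^sub>0) d2 \<Longrightarrow>
        norm (\<Psi> (p + w) - \<Psi> p - frechet_derivative \<Psi> (at p) w - (1/2) *\<^sub>R H2 w) \<le> e / 3 * (norm w)\<^sup>2"
      using smooth_on_taylor2[OF assms(4) sm assms(5) e, folded H2_def] by blast
    obtain d3 where d3: "d3 > 0" "\<And>p q. p \<in> ball x\<^sub>0 d3 \<Longrightarrow> q \<in> ball x\<^sub>0 d3 \<Longrightarrow> (p, vcnj q) \<in> ball (x\<^sub>0, vcnj x\<^sub>0) d2"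
      using open_twist_ball[OF open_ball, of x\<^sub>0 "(x\<^sub>0, vcnj x\<^sub>0)" d2] d2(1) by auto
    define d where "d = min (min d0 d1) d3"
    show "\<exists>d>0. ball x\<^sub>0 d \<subseteq> \<Omega> \<and> (\<forall>x\<in>ball x\<^sub>0 d. \<Psi> (x, vcnj x) = complex_of_real (\<Phi> x)) \<and>
      (\<forall>p\<in>ball x\<^sub>0 d. \<forall>q\<in>ball x\<^sub>0 d. (p, vcnj q) \<in> G \<and> \<bar>diastasis \<Phi> \<Psi> p q - L (p - q)\<bar> \<le> e * (norm (p - q))\<^sup>2)"
    proof (intro exI[of _ d] conjI ballI)
      show "d > 0" using d0 d1 d3 by (simp add: d_def)
      show "ball x\<^sub>0 d \<subseteq> \<Omega>" using d1 by (auto simp: d_def)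
      show "\<Psi> (x, vcnj x) = complex_of_real (\<Phi> x)" if "x \<in> ball x\<^sub>0 d" for x
        using d0 that by (auto simp: d_def)
      fix p q assume pq: "p \<in> ball x\<^sub>0 d" "q \<in> ball x\<^sub>0 d"
      then have B: "(p, vcnj q) \<in> ball (x\<^sub>0, vcnj x\<^sub>0) d2" "(q, vcnj q) \<in> ball (x\<^sub>0, vcnj x\<^sub>0) d2"
        using d3 by (auto simp: d_def)
      then show "(p, vcnj q) \<in> G" using d2 by blast
      define w where "w = p - q"
      have p: "p = q + w" by (simp add: w_def)
      have 1: "norm (\<Phi> p - \<Phi> q - frechet_derivative \<Phi> (at q) w - (1/2) *\<^sub>R H1 w) \<le> e / 3 * (norm w)\<^sup>2"
        using d1(3)[of q w] pq unfolding p d_def by auto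
      have 2: "norm (\<Psi> (p, vcnj q) - \<Psi> (q, vcnj q) - frechet_derivative \<Psi> (at (q, vcnj q)) (w, 0) - (1/2) *\<^sub>R H2 (w, 0)) \<le> e / 3 * (norm w)\<^sup>2"
        using d2(3)[of "(q, vcnj q)" "(w, 0)"] B unfolding p by auto
      have 3: "frechet_derivative \<Phi> (at q) w = 2 * Re (frechet_derivative \<Psi> (at (q, vcnj q)) (w, 0))"
      proof (rule polarization_derivative[OF ah])
        show "open (ball x\<^sub>0 d)" "q \<in> ball x\<^sub>0 d" using pq by auto
        show "(q, vcnj q) \<in> G" using B d2 by blast
        show "\<Phi> differentiable (at q)"
          by (rule smooth_on_differentiable[OF assms(2)]) (use pq d1(2) in \<open>auto simp: d_def\<close>)
        show "\<Psi> (x, vcnj x) = complex_of_real (\<Phi> x)" if "x \<in> ball x\<^sub>0 d" for x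
          using d0 that by (auto simp: d_def)
      qed
      have 4: "\<Psi> (q, vcnj q) = complex_of_real (\<Phi> q)"
        using d0 pq by (auto simp: d_def)
      have 5: "\<bar>Re (\<Psi> (p, vcnj q) - \<Psi> (q, vcnj q) - frechet_derivative \<Psi> (at (q, vcnj q)) (w, 0) - (1/2) *\<^sub>R H2 (w, 0))\<bar> \<le> e / 3 * (norm w)\<^sup>2"
        using abs_Re_le_cmod 2 order_trans by blast
      have "diastasis \<Phi> \<Psi> p q - L w = (\<Phi> p - \<Phi> q - frechet_derivative \<Phi> (at q) w - (1/2) *\<^sub>R H1 w)
         - 2 * Re (\<Psi> (p, vcnj q) - \<Psi> (q, vcnj q) - frechet_derivative \<Psi> (at (q, vcnj q)) (w, 0) - (1/2) *\<^sub>R H2 (w, 0))"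
        using 3 4 by (simp add: diastasis_def L_def algebra_simps)
      then show "\<bar>diastasis \<Phi> \<Psi> p q - L (p - q)\<bar> \<le> e * (norm (p - q))\<^sup>2"
        using 1 5 unfolding w_def[symmetric] real_norm_def by linarith
    qed
  qed
qed

text \<open>The lower bound on the diastasis comes from the goodness of the affine contour, so that the Levi
  form never has to be computed. In the last inequality the diastasis is close to a quadratic form \<open>L\<close>, and
  the left-hand side to \<open>(- (2 - t)\<^sup>2 + 2 (1 - t)\<^sup>2) L(z) = (t\<^sup>2 - 2) L(z)\<close>.\<close>

lemma diastasis_bounds:
  fixes \<Psi> :: "(complex^'n) \<times> (complex^'n) \<Rightarrow> complex"
  assumes "open \<Omega>" "smooth_on \<Omega> \<Phi>" "x\<^sub>0 \<in> \<Omega>" "open G" "(x\<^sub>0, vcnj x\<^sub>0) \<in> G"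
    and pol: "almost_holomorphic_polarization x\<^sub>0 \<Phi> G \<Psi>"
    and "r > 0" "C\<^sub>0 > 0"
    and good: "\<And>z. z \<in> ball 0 r \<Longrightarrow> Re (phase \<Psi> x\<^sub>0 (vcnj x\<^sub>0) (x\<^sub>0 + z) (vcnj x\<^sub>0 - vcnj z))
           \<le> - (dist (x\<^sub>0 + z, vcnj x\<^sub>0 - vcnj z) (x\<^sub>0, vcnj x\<^sub>0))\<^sup>2 / C\<^sub>0"
  obtains c d where "c > 0" "d > 0" "ball x\<^sub>0 d \<subseteq> \<Omega>"
    "\<And>x. x \<in> ball x\<^sub>0 d \<Longrightarrow> \<Psi> (x, vcnj x) = complex_of_real (\<Phi> x)"
    "\<And>p q. p \<in> ball x\<^sub>0 d \<Longrightarrow> q \<in> ball x\<^sub>0 d \<Longrightarrow> (p, vcnj q) \<in> G"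
    "\<And>p q. p \<in> ball x\<^sub>0 d \<Longrightarrow> q \<in> ball x\<^sub>0 d \<Longrightarrow> c * (norm (p - q))\<^sup>2 \<le> diastasis \<Phi> \<Psi> p q"
    "\<And>y z t. t \<in> {0..1} \<Longrightarrow> y \<in> ball x\<^sub>0 d \<Longrightarrow> y + z \<in> ball x\<^sub>0 d \<Longrightarrow> y - (1 - t) *\<^sub>R z \<in> ball x\<^sub>0 d \<Longrightarrow> y + t *\<^sub>R z \<in> ball x\<^sub>0 d \<Longrightarrow>
        - diastasis \<Phi> \<Psi> (y + z) (y - (1 - t) *\<^sub>R z) + diastasis \<Phi> \<Psi> (y + z) (y + t *\<^sub>R z)
        + diastasis \<Phi> \<Psi> y (y - (1 - t) *\<^sub>R z) \<le> - c * (norm z)\<^sup>2"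
proof -
  obtain L where Lh: "\<And>c w. L (c *\<^sub>R w) = c\<^sup>2 * L w"
    and L: "\<And>e. e > 0 \<Longrightarrow> \<exists>d>0. ball x\<^sub>0 d \<subseteq> \<Omega> \<and> (\<forall>x\<in>ball x\<^sub>0 d. \<Psi> (x, vcnj x) = complex_of_real (\<Phi> x)) \<and>
      (\<forall>p\<in>ball x\<^sub>0 d. \<forall>q\<in>ball x\<^sub>0 d. (p, vcnj q) \<in> G \<and> \<bar>diastasis \<Phi> \<Psi> p q - L (p - q)\<bar> \<le> e * (norm (p - q))\<^sup>2)"
    using diastasis_taylor[OF assms(1-6)] by blast
  let ?D = "diastasis \<Phi> \<Psi>"
  define k where "k = 1 / C\<^sub>0"
  have k: "k > 0" using assms by (simp add: k_def)
  have Llow: "k * (norm z)\<^sup>2 \<le> L z" for z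
  proof -
    \<comment> \<open>At \<open>x\<^sub>0\<close> twice the real part of the phase is - 4 L + L + L
      = - 2 L up to 4 + 1 + 1 errors of this size, that is 2 k |z|^2 in total. Goodness of the
      contour bounds it by - 4 k |z|^2, since both slots move by |z|. Hence L \<ge> k |z|^2.\<close>
    have "k / 3 > 0" using k by simp
    from L[OF this] obtain d1 where d1: "d1 > 0" "\<And>x. x \<in> ball x\<^sub>0 d1 \<Longrightarrow> \<Psi> (x, vcnj x) = complex_of_real (\<Phi> x)"
       "\<And>p q. p \<in> ball x\<^sub>0 d1 \<Longrightarrow> q \<in> ball x\<^sub>0 d1 \<Longrightarrow> \<bar>?D p q - L (p - q)\<bar> \<le> k / 3 * (norm (p - q))\<^sup>2"
      by blast
    define m where "m = min d1 r"
    have m: "m > 0" using d1 assms by (simp add: m_def)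
    have small: "k * (norm z)\<^sup>2 \<le> L z" if z: "norm z < m" for z
    proof -
      have B: "x\<^sub>0 \<in> ball x\<^sub>0 d1" "x\<^sub>0 + z \<in> ball x\<^sub>0 d1" "x\<^sub>0 - z \<in> ball x\<^sub>0 d1"
        using z d1(1) by (auto simp: m_def dist_norm)
      have "z \<in> ball 0 r" using z by (simp add: m_def)
      from good[OF this] have "Re (phase \<Psi> x\<^sub>0 (vcnj x\<^sub>0) (x\<^sub>0 + z) (vcnj x\<^sub>0 - vcnj z)) \<le> - (2 * k * (norm z)\<^sup>2)"
        by (simp add: dist_norm norm_Pair k_def)
      moreover have "2 * Re (phase \<Psi> x\<^sub>0 (vcnj x\<^sub>0) (x\<^sub>0 + z) (vcnj x\<^sub>0 - vcnj z))
          = - ?D (x\<^sub>0 + z) (x\<^sub>0 - z) + ?D (x\<^sub>0 + z) x\<^sub>0 + ?D x\<^sub>0 (x\<^sub>0 - z)"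
        by (simp add: phase_def diastasis_def d1(2)[OF B(1)] flip: vcnj_diff)
      moreover have "\<bar>?D (x\<^sub>0 + z) (x\<^sub>0 - z) - 4 * L z\<bar> \<le> k / 3 * (4 * (norm z)\<^sup>2)"
      proof -
        have e: "(x\<^sub>0 + z) - (x\<^sub>0 - z) = 2 *\<^sub>R z" by (simp add: scaleR_2)
        show ?thesis using d1(3)[OF B(2) B(3)] unfolding e Lh by (simp add: power_mult_distrib)
      qed
      moreover have "\<bar>?D (x\<^sub>0 + z) x\<^sub>0 - L z\<bar> \<le> k / 3 * (norm z)\<^sup>2" "\<bar>?D x\<^sub>0 (x\<^sub>0 - z) - L z\<bar> \<le> k / 3 * (norm z)\<^sup>2"
        using d1(3)[OF B(2) B(1)] d1(3)[OF B(1) B(3)] by auto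
      ultimately show ?thesis unfolding abs_le_iff by argo
    qed
    show ?thesis
    proof (cases "z = 0")
      case True
      then show ?thesis using Lh[of 0 0] by simp
    next
      case False
      \<comment> \<open>Goodness is known for short z only; homogeneity carries the bound to every
        z.\<close>
      define s where "s = m / (2 * norm z)"
      have s: "s > 0" using m False by (simp add: s_def)
      have "norm (s *\<^sub>R z) < m" using False m by (simp add: s_def)
      from small[OF this] have "s\<^sup>2 * (k * (norm z)\<^sup>2) \<le> s\<^sup>2 * L z"
        by (simp add: Lh power_mult_distrib mult_ac)
      then show ?thesis using s by simp
    qed
  qed
  \<comment> \<open>The three diastases occur with squared factors at most 4, 1 and 1, so this
    tolerance costs 6/12 of k |z|^2, half of the gain L \<ge> k |z|^2. This explains the constant k
    / 2 below.\<close>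
  have "k / 12 > 0" using k by simp
  from L[OF this] obtain d where d: "d > 0" "ball x\<^sub>0 d \<subseteq> \<Omega>" "\<And>x. x \<in> ball x\<^sub>0 d \<Longrightarrow> \<Psi> (x, vcnj x) = complex_of_real (\<Phi> x)"
       "\<And>p q. p \<in> ball x\<^sub>0 d \<Longrightarrow> q \<in> ball x\<^sub>0 d \<Longrightarrow> (p, vcnj q) \<in> G"
       "\<And>p q. p \<in> ball x\<^sub>0 d \<Longrightarrow> q \<in> ball x\<^sub>0 d \<Longrightarrow> \<bar>?D p q - L (p - q)\<bar> \<le> k / 12 * (norm (p - q))\<^sup>2"
    by blast
  show ?thesis
  proof (rule that[of "k / 2" d])
    show "k / 2 * (norm (p - q))\<^sup>2 \<le> ?D p q" if "p \<in> ball x\<^sub>0 d" "q \<in> ball x\<^sub>0 d" for p q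
    proof -
      have "0 \<le> k * (norm (p - q))\<^sup>2" using k by simp
      then show ?thesis using d(5)[OF that] Llow[of "p - q"] unfolding abs_le_iff by argo
    qed
    fix y z t assume t: "t \<in> {0..1::real}"
      and B: "y \<in> ball x\<^sub>0 d" "y + z \<in> ball x\<^sub>0 d" "y - (1 - t) *\<^sub>R z \<in> ball x\<^sub>0 d" "y + t *\<^sub>R z \<in> ball x\<^sub>0 d"
    let ?n = "k * (norm z)\<^sup>2"
    have n: "?n \<ge> 0" using k by simp
    have e: "(y + z) - (y - (1 - t) *\<^sub>R z) = (2 - t) *\<^sub>R z" "(y + z) - (y + t *\<^sub>R z) = (1 - t) *\<^sub>R z"
       "y - (y - (1 - t) *\<^sub>R z) = (1 - t) *\<^sub>R z"
      by (simp_all add: algebra_simps scaleR_2)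
    have "\<bar>?D (y + z) (y - (1 - t) *\<^sub>R z) - (2 - t)\<^sup>2 * L z\<bar> \<le> (2 - t)\<^sup>2 * (?n / 12)"
      using d(5)[OF B(2,3)] unfolding e Lh by (simp add: power_mult_distrib mult_ac)
    moreover have "\<bar>?D (y + z) (y + t *\<^sub>R z) - (1 - t)\<^sup>2 * L z\<bar> \<le> (1 - t)\<^sup>2 * (?n / 12)"
      using d(5)[OF B(2,4)] unfolding e Lh by (simp add: power_mult_distrib mult_ac)
    moreover have "\<bar>?D y (y - (1 - t) *\<^sub>R z) - (1 - t)\<^sup>2 * L z\<bar> \<le> (1 - t)\<^sup>2 * (?n / 12)"
      using d(5)[OF B(1,3)] unfolding e Lh by (simp add: power_mult_distrib mult_ac)
    moreover have "(2 - t)\<^sup>2 * (?n / 12) \<le> 4 * (?n / 12)" "(1 - t)\<^sup>2 * (?n / 12) \<le> 1 * (?n / 12)"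
      using t n power_mono[of "2 - t" 2 2] power_mono[of "1 - t" 1 2] by (intro mult_right_mono; simp)+
    moreover have "(2 - t)\<^sup>2 * L z = 2 * ((1 - t)\<^sup>2 * L z) + (2 - t\<^sup>2) * L z"
      by (simp add: power2_eq_square algebra_simps)
    moreover have "(2 - t\<^sup>2) * L z \<ge> 1 * L z"
      using t Llow[of z] n power_le_one[of t 2] by (intro mult_right_mono) auto
    ultimately show "- ?D (y + z) (y - (1 - t) *\<^sub>R z) + ?D (y + z) (y + t *\<^sub>R z)
        + ?D y (y - (1 - t) *\<^sub>R z) \<le> - (k / 2) * (norm z)\<^sup>2"
      using Llow[of z] n unfolding abs_le_iff by argo
  qed (use d k in auto)
qed

section \<open>Integrals depending on a parameter\<close>

lemma hol_on_derivative_cmult: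
  assumes "hol_on V u" "x \<in> V"
  shows "frechet_derivative u (at x) (k *s z) = k * frechet_derivative u (at x) z"
proof -
  have "u differentiable (at x)" using assms by (auto simp: hol_on_def)
  then interpret linear "frechet_derivative u (at x)" by (rule linear_frechet_derivative)
  have e: "k *s z = Re k *\<^sub>R z + Im k *\<^sub>R (\<i> *s z)"
    by (simp add: vec_eq_iff complex_eq_iff)
  show ?thesis
    unfolding e add scale hol_on_derivative_imult[OF assms]
    by (simp add: complex_eq_iff)
qed

lemma hol_on_continuous: "hol_on V u \<Longrightarrow> continuous_on V u"
  by (meson continuous_at_imp_continuous_on differentiable_imp_continuous_within hol_on_def)

text \<open>\<open>hol_on\<close> provides differentiability but no continuity of the derivative.
  Restriction to a complex line through y in a unit direction gives a one-variable holomorphic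
  function on a disc of radius R' - R, and the Cauchy inequality bounds its derivative by the
  maximum of |u| on the larger ball.\<close>

lemma hol_on_derivative_bound:
  fixes u :: "complex^'n \<Rightarrow> complex"
  assumes u: "hol_on V u" and V: "cball x\<^sub>0 R' \<subseteq> V" and R: "R < R'"
  obtains B where "B \<ge> 0" "\<And>y w. y \<in> cball x\<^sub>0 R \<Longrightarrow> norm (frechet_derivative u (at y) w) \<le> B * norm w"
proof -
  have "compact (u ` cball x\<^sub>0 R')"
    using hol_on_continuous[OF u] V by (meson compact_cball compact_continuous_image continuous_on_subset)
  then obtain M where M: "M > 0" "\<And>y. y \<in> cball x\<^sub>0 R' \<Longrightarrow> norm (u y) \<le> M"
    by (auto dest!: compact_imp_bounded simp: bounded_pos)
  define r where "r = R' - R"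
  have r: "r > 0" using R by (simp add: r_def)
  have unit: "norm (frechet_derivative u (at y) w) \<le> M / r" if y: "y \<in> cball x\<^sub>0 R" and w: "norm w = 1" for y w
  proof -
    let ?f = "\<lambda>\<zeta>::complex. u (y + \<zeta> *s w)"
    have nw: "norm (\<zeta> *s w) = norm \<zeta>" for \<zeta>
    proof -
      have "norm (\<zeta> *s w) = norm \<zeta> * norm w"
        by (simp add: norm_vec_def norm_mult L2_set_right_distrib)
      then show ?thesis using w by simp
    qed
    have in1: "y + \<zeta> *s w \<in> cball x\<^sub>0 R'" if "\<zeta> \<in> cball 0 r" for \<zeta>
    proof -
      have "dist x\<^sub>0 (y + \<zeta> *s w) \<le> dist x\<^sub>0 y + norm (\<zeta> *s w)"
        using dist_triangle[of x\<^sub>0 "y + \<zeta> *s w" y] by (simp add: dist_norm)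
      then show ?thesis using y that nw[of \<zeta>] by (simp add: r_def)
    qed
    have d: "(?f has_field_derivative frechet_derivative u (at (y + \<zeta> *s w)) w) (at \<zeta>)" if "\<zeta> \<in> cball 0 r" for \<zeta>
    proof -
      have p: "y + \<zeta> *s w \<in> V" using in1[OF that] V by blast
      have du: "(u has_derivative frechet_derivative u (at (y + \<zeta> *s w))) (at (y + \<zeta> *s w))"
        using u p frechet_derivative_works unfolding hol_on_def by blast
      have "bounded_linear (\<lambda>\<zeta>. \<zeta> *s w)"
        by (rule bounded_linear_intro[where K = "1"]) (simp_all add: nw vec_eq_iff algebra_simps)
      then have "((\<lambda>\<zeta>. y + \<zeta> *s w) has_derivative (\<lambda>k. k *s w)) (at \<zeta>)"
        by (rule has_derivative_eq_rhs[OF has_derivative_add[OF has_derivative_const bounded_linear_imp_has_derivative]]) simp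
      then have "(?f has_derivative (\<lambda>k. frechet_derivative u (at (y + \<zeta> *s w)) (k *s w))) (at \<zeta>)"
        by (rule has_derivative_compose[where g = u and f = "\<lambda>\<zeta>. y + \<zeta> *s w"]) (rule du)
      then show ?thesis
        unfolding has_field_derivative_def hol_on_derivative_cmult[OF u p] by (simp only: mult_commute_abs)
    qed
    have "norm ((deriv ^^ 1) ?f 0) \<le> fact 1 * M / r ^ 1"
    proof (rule Cauchy_inequality)
      show "?f holomorphic_on ball 0 r"
        unfolding holomorphic_on_open[OF open_ball]
        by (intro ballI exI, rule d) auto
      show "continuous_on (cball 0 r) ?f"
        by (intro continuous_at_imp_continuous_on ballI) (rule DERIV_isCont[OF d])
      show "norm (?f x) \<le> M" if "norm (0 - x) = r" for x
        using that by (intro M in1) auto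
    qed (fact r)
    moreover have "deriv ?f 0 = frechet_derivative u (at y) w"
      using DERIV_imp_deriv[OF d[of 0]] r by simp
    ultimately show ?thesis by simp
  qed
  show ?thesis
  proof (rule that[of "M / r"])
    show "M / r \<ge> 0" using M r by simp
    fix y w assume y: "y \<in> cball x\<^sub>0 R"
    then have yV: "y \<in> V" using V R by auto
    then have "u differentiable (at y)" using u by (auto simp: hol_on_def)
    then interpret linear "frechet_derivative u (at y)" by (rule linear_frechet_derivative)
    show "norm (frechet_derivative u (at y) w) \<le> M / r * norm w"
    proof (cases "w = 0")
      case False
      have "w = norm w *\<^sub>R (w /\<^sub>R norm w)" using False by simp
      then have "norm (frechet_derivative u (at y) w) = norm w * norm (frechet_derivative u (at y) (w /\<^sub>R norm w))"
        by (metis abs_norm_cancel norm_scaleR scale)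
      also have "\<dots> \<le> norm w * (M / r)"
        using unit[OF y, of "w /\<^sub>R norm w"] False by (intro mult_left_mono) auto
      finally show ?thesis by (simp add: mult.commute)
    qed (simp add: zero)
  qed
qed

section \<open>Translation invariance and differentiation under the integral sign\<close>

lemma integral_lborel_translation:
  fixes f :: "'a::euclidean_space \<Rightarrow> 'b::{banach, second_countable_topology}"
  assumes "f \<in> borel_measurable borel"
  shows "(\<integral>y. f (y + w) \<partial>lborel) = (\<integral>y. f y \<partial>lborel)"
proof -
  have "(\<integral>y. f y \<partial>lborel) = (\<integral>y. f y \<partial>distr lborel borel ((+) w))"
    by (simp only: lborel_distr_plus)
  also have "\<dots> = (\<integral>y. f (w + y) \<partial>lborel)"
    by (rule integral_distr) (use assms in auto)
  finally show ?thesis by (simp add: add.commute)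
qed

lemma integrable_lborel_translation:
  fixes f :: "'a::euclidean_space \<Rightarrow> 'b::{banach, second_countable_topology}"
  assumes "integrable lborel f"
  shows "integrable lborel (\<lambda>y. f (y + w))"
proof -
  have "integrable (distr lborel borel ((+) w)) f"
    using assms by (simp only: lborel_distr_plus)
  then have "integrable lborel (\<lambda>y. f (w + y))"
    by (rule integrable_distr[rotated]) auto
  then show ?thesis by (simp add: add.commute)
qed

text \<open>Dominated convergence for difference quotients: the Lipschitz bound at e = 0 dominates
  them by a multiple of the indicator of a bounded set. Differentiability is asked at the single
  parameter 0, so no regularity of the derivative in e is required.\<close>

lemma parametric_integral_derivative:
  fixes k :: "real \<Rightarrow> 'a::euclidean_space \<Rightarrow> 'b::euclidean_space"
  assumes "d > 0"
    and meas: "\<And>e. \<bar>e\<bar> < d \<Longrightarrow> k e \<in> borel_measurable borel"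
    and int: "integrable lborel (k 0)"
    and lip: "\<And>e y. \<bar>e\<bar> < d \<Longrightarrow> norm (k e y - k 0 y) \<le> B * \<bar>e\<bar> * indicator K y"
    and K: "bounded K" "K \<in> sets borel"
    and der: "\<And>y. ((\<lambda>e. k e y) has_vector_derivative k' y) (at 0)"
  shows "integrable lborel k'"
    and "((\<lambda>e. \<integral>y. k e y \<partial>lborel) has_vector_derivative (\<integral>y. k' y \<partial>lborel)) (at 0)"
proof -
  have der': "((\<lambda>h. norm (k h y - k 0 y - h *\<^sub>R k' y) / \<bar>h\<bar>) \<longlongrightarrow> 0) (at 0)" for y
    using der[of y] unfolding has_vector_derivative_def has_derivative_at by simp
  have quot: "((\<lambda>h. (k h y - k 0 y) /\<^sub>R h) \<longlongrightarrow> k' y) (at 0)" for y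
  proof -
    have "((\<lambda>h. norm ((k h y - k 0 y) /\<^sub>R h - k' y)) \<longlongrightarrow> 0) (at 0)"
    proof (rule Lim_transform_eventually[OF der'[of y]])
      show "\<forall>\<^sub>F h in at 0. norm (k h y - k 0 y - h *\<^sub>R k' y) / \<bar>h\<bar> = norm ((k h y - k 0 y) /\<^sub>R h - k' y)"
      proof (rule eventually_mono)
        show "\<forall>\<^sub>F h in at 0. h \<noteq> (0::real)" by (simp add: eventually_at_filter)
        fix h :: real assume "h \<noteq> 0"
        then have "(k h y - k 0 y) /\<^sub>R h - k' y = (k h y - k 0 y - h *\<^sub>R k' y) /\<^sub>R h"
          by (simp add: scaleR_diff_right)
        then show "norm (k h y - k 0 y - h *\<^sub>R k' y) / \<bar>h\<bar> = norm ((k h y - k 0 y) /\<^sub>R h - k' y)"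
          by (simp add: divide_inverse_commute)
      qed
    qed
    then show ?thesis
      by (simp add: tendsto_norm_zero_iff LIM_zero_iff)
  qed
  \<comment> \<open>One fixed null sequence of quotients exhibits \<open>k'\<close> as a pointwise
    limit of measurable functions and hands the dominating bound on to it.\<close>
  define s where "s n = (d / 2) / real (Suc n)" for n
  have s: "s n \<noteq> 0" "\<bar>s n\<bar> < d" for n
  proof -
    show "s n \<noteq> 0" using \<open>d > 0\<close> by (simp add: s_def)
    have "s n \<le> (d / 2) / 1"
      unfolding s_def using \<open>d > 0\<close> by (intro divide_left_mono) auto
    moreover have "s n \<ge> 0" using \<open>d > 0\<close> by (simp add: s_def)
    ultimately show "\<bar>s n\<bar> < d" using \<open>d > 0\<close> by linarith
  qed
  have s0: "s \<longlonglongrightarrow> 0"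
    unfolding s_def[abs_def] by (rule LIMSEQ_Suc[OF lim_const_over_n])
  have sq: "(\<lambda>n. (k (s n) y - k 0 y) /\<^sub>R s n) \<longlonglongrightarrow> k' y" for y
    using quot[of y] s s0 unfolding tendsto_at_iff_sequentially by (auto simp: o_def)
  have k0m: "k 0 \<in> borel_measurable borel" using meas[of 0] \<open>d > 0\<close> by simp
  have k'm: "k' \<in> borel_measurable borel"
    by (rule borel_measurable_LIMSEQ_metric[OF _ sq]) (use meas[OF s(2)] k0m in auto)
  have Kint: "integrable lborel (\<lambda>y. B * indicator K y :: real)"
    using K by (intro integrable_mult_right) (auto intro!: integrable_real_indicator emeasure_bounded_finite)
  have qb: "norm ((k h y - k 0 y) /\<^sub>R h) \<le> B * indicator K y" if "h \<noteq> 0" "\<bar>h\<bar> < d" for h y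
  proof -
    have "norm ((k h y - k 0 y) /\<^sub>R h) = norm (k h y - k 0 y) / \<bar>h\<bar>"
      by (simp add: divide_inverse_commute)
    also have "\<dots> \<le> (B * \<bar>h\<bar> * indicator K y) / \<bar>h\<bar>"
      by (rule divide_right_mono[OF lip[OF that(2)]]) simp
    finally show ?thesis using that by simp
  qed
  have k'b: "norm (k' y) \<le> B * indicator K y" for y
    by (rule tendsto_upperbound[OF tendsto_norm[OF sq]]) (use qb s in auto)
  show k'i: "integrable lborel k'"
    by (rule Bochner_Integration.integrable_bound[OF Kint])
       (use k'm k'b in \<open>auto intro: order_trans[OF k'b abs_ge_self]\<close>)
  have ki: "integrable lborel (k e)" if "\<bar>e\<bar> < d" for e
  proof -
    have "integrable lborel (\<lambda>y. k e y - k 0 y)"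
    proof (rule Bochner_Integration.integrable_bound)
      show "integrable lborel (\<lambda>y. (B * indicator K y) * \<bar>e\<bar>)" using Kint by (intro integrable_mult_left)
      show "(\<lambda>y. k e y - k 0 y) \<in> borel_measurable lborel" using meas[OF that] k0m by simp
      show "AE y in lborel. norm (k e y - k 0 y) \<le> norm ((B * indicator K y) * \<bar>e\<bar>)"
        using order_trans[OF lip[OF that] abs_ge_self] by (simp add: mult_ac)
    qed
    from Bochner_Integration.integrable_add[OF this int] show ?thesis by simp
  qed
  have "((\<lambda>h. norm ((\<integral>y. k h y \<partial>lborel) - (\<integral>y. k 0 y \<partial>lborel) - h *\<^sub>R (\<integral>y. k' y \<partial>lborel)) / \<bar>h\<bar>) \<longlongrightarrow> 0) (at 0)"
    unfolding tendsto_at_iff_sequentially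
  proof (intro allI impI)
    fix X :: "nat \<Rightarrow> real" assume X: "\<forall>i. X i \<in> UNIV - {0}" "X \<longlonglongrightarrow> 0"
    then have "\<exists>n0. \<forall>n\<ge>n0. dist (X n) 0 < d"
      using \<open>d > 0\<close> unfolding LIMSEQ_def by blast
    then obtain n0 where n0: "\<And>n. n \<ge> n0 \<Longrightarrow> \<bar>X n\<bar> < d"
      by auto
    \<comment> \<open>Dropping an initial segment keeps all parameters in the range where the
      quotients are dominated.\<close>
    let ?Y = "\<lambda>n. X (n + n0)"
    have Y: "?Y n \<noteq> 0" "\<bar>?Y n\<bar> < d" for n using X n0 by auto
    have Y0: "?Y \<longlonglongrightarrow> 0" using X(2) by (rule LIMSEQ_ignore_initial_segment)
    have lim: "(\<lambda>n. (\<integral>y. (k (?Y n) y - k 0 y) /\<^sub>R ?Y n - k' y \<partial>lborel)) \<longlonglongrightarrow> (\<integral>y. (0::'b) \<partial>(lborel :: 'a measure))"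
    proof (rule integral_dominated_convergence[where w = "\<lambda>y. 2 * (B * indicator K y)"])
      show "integrable lborel (\<lambda>y. 2 * (B * indicator K y))" using Kint by (rule integrable_mult_right)
      show "(\<lambda>y. (k (?Y n) y - k 0 y) /\<^sub>R ?Y n - k' y) \<in> borel_measurable lborel" for n
        using meas[OF Y(2)] k0m k'm by simp
      show "AE y in lborel. (\<lambda>n. (k (?Y n) y - k 0 y) /\<^sub>R ?Y n - k' y) \<longlonglongrightarrow> 0"
      proof (rule AE_I2)
        fix y
        have "(\<lambda>n. (k (?Y n) y - k 0 y) /\<^sub>R ?Y n) \<longlonglongrightarrow> k' y"
          using quot[of y] Y(1) Y0 unfolding tendsto_at_iff_sequentially by (auto simp: o_def)
        then show "(\<lambda>n. (k (?Y n) y - k 0 y) /\<^sub>R ?Y n - k' y) \<longlonglongrightarrow> 0"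
          by (rule LIM_zero)
      qed
      show "AE y in lborel. norm ((k (?Y n) y - k 0 y) /\<^sub>R ?Y n - k' y) \<le> 2 * (B * indicator K y)" for n
      proof (rule AE_I2)
        fix y
        show "norm ((k (?Y n) y - k 0 y) /\<^sub>R ?Y n - k' y) \<le> 2 * (B * indicator K y)"
          using norm_triangle_ineq4[of "(k (?Y n) y - k 0 y) /\<^sub>R ?Y n" "k' y"] qb[OF Y, of n y] k'b[of y] by linarith
      qed
    qed simp
    have "(\<integral>y. (k (?Y n) y - k 0 y) /\<^sub>R ?Y n - k' y \<partial>lborel)
       = ((\<integral>y. k (?Y n) y \<partial>lborel) - (\<integral>y. k 0 y \<partial>lborel) - ?Y n *\<^sub>R (\<integral>y. k' y \<partial>lborel)) /\<^sub>R ?Y n" for n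
    proof -
      have "(\<integral>y. (k (?Y n) y - k 0 y) /\<^sub>R ?Y n - k' y \<partial>lborel)
        = (\<integral>y. k (?Y n) y \<partial>lborel) /\<^sub>R ?Y n - (\<integral>y. k 0 y \<partial>lborel) /\<^sub>R ?Y n - (\<integral>y. k' y \<partial>lborel)"
        using ki[OF Y(2), of n] int k'i by (simp add: scaleR_diff_right)
      then show ?thesis using Y(1)[of n] by (simp add: scaleR_diff_right)
    qed
    with lim have "(\<lambda>n. norm (((\<integral>y. k (?Y n) y \<partial>lborel) - (\<integral>y. k 0 y \<partial>lborel) - ?Y n *\<^sub>R (\<integral>y. k' y \<partial>lborel)) /\<^sub>R ?Y n)) \<longlonglongrightarrow> 0"
      using tendsto_norm_zero by force
    then have "(\<lambda>n. norm ((\<integral>y. k (?Y n) y \<partial>lborel) - (\<integral>y. k 0 y \<partial>lborel) - ?Y n *\<^sub>R (\<integral>y. k' y \<partial>lborel)) / \<bar>?Y n\<bar>) \<longlonglongrightarrow> 0"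
      by (simp add: divide_inverse_commute)
    then show "((\<lambda>h. norm ((\<integral>y. k h y \<partial>lborel) - (\<integral>y. k 0 y \<partial>lborel) - h *\<^sub>R (\<integral>y. k' y \<partial>lborel)) / \<bar>h\<bar>) \<circ> X) \<longlonglongrightarrow> 0"
      unfolding o_def by (rule LIMSEQ_offset)
  qed
  then show "((\<lambda>e. \<integral>y. k e y \<partial>lborel) has_vector_derivative (\<integral>y. k' y \<partial>lborel)) (at 0)"
    unfolding has_vector_derivative_def has_derivative_at by (simp add: bounded_linear_scaleR_left)
qed

text \<open>The variable of integration is moved along with the parameter, y to y + e w. This does
  not change the integral, but it adds the spatial derivative along w to the differentiated
  integrand. So one statement contains both uses: \<tau> = 1, w = 0 differentiates in t, and \<tau>
  = 0 shows that spatial derivatives integrate to zero.\<close>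

lemma directional_integral_derivative:
  fixes g :: "real \<times> 'a::euclidean_space \<Rightarrow> complex"
  assumes lip: "L-lipschitz_on ({-1..2} \<times> cball x\<^sub>0 R') g" and R: "R < R'"
    and zero: "\<And>t y. y \<notin> cball x\<^sub>0 R \<Longrightarrow> g (t, y) = 0"
    and der: "\<And>y. (g has_derivative g' y) (at (t, y))" and t: "t \<in> {0..1}"
  shows "integrable lborel (\<lambda>y. g' y (\<tau>, w))"
    and "((\<lambda>e. \<integral>y. g (t + e * \<tau>, y) \<partial>lborel) has_vector_derivative (\<integral>y. g' y (\<tau>, w) \<partial>lborel)) (at 0)"
proof -
  \<comment> \<open>The first entry keeps t + e \<tau> within [-1, 2], where the Lipschitz bound
    holds; the second keeps the displacement e w below the gap R' - R.\<close>
  define d where "d = min (1 / (\<bar>\<tau>\<bar> + 1)) ((R' - R) / (norm w + 1))"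
  have d: "d > 0" using R by (simp add: d_def add_nonneg_pos)
  have small: "\<bar>e * \<tau>\<bar> < 1" "norm (e *\<^sub>R w) < R' - R" if "\<bar>e\<bar> < d" for e
  proof -
    have "\<bar>e\<bar> * (\<bar>\<tau>\<bar> + 1) < 1" "\<bar>e\<bar> * (norm w + 1) < R' - R"
      using that by (auto simp: d_def add_nonneg_pos pos_less_divide_eq)
    then show "\<bar>e * \<tau>\<bar> < 1" "norm (e *\<^sub>R w) < R' - R"
      by (auto simp: abs_mult algebra_simps)
  qed
  have inT: "t + e * \<tau> \<in> {-1..2}" if "\<bar>e\<bar> < d" for e
    using small(1)[OF that] t by (auto simp: abs_less_iff)
  have cont: "continuous_on ({-1..2} \<times> cball x\<^sub>0 R') g"
    using lip by (rule lipschitz_on_continuous_on)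
  have meas: "(\<lambda>y. g (s, y)) \<in> borel_measurable borel" if "s \<in> {-1..2}" for s
  proof -
    have "continuous_on (cball x\<^sub>0 R') (\<lambda>y. g (s, y))"
      by (rule continuous_on_compose2[OF cont]) (use that in \<open>auto intro!: continuous_intros\<close>)
    then have "(\<lambda>y. indicator (cball x\<^sub>0 R') y *\<^sub>R g (s, y)) \<in> borel_measurable borel"
      by (intro borel_measurable_continuous_on_indicator) auto
    moreover have "indicator (cball x\<^sub>0 R') y *\<^sub>R g (s, y) = g (s, y)" for y
      using zero[of y s] R by (auto simp: indicator_def)
    ultimately show ?thesis by simp
  qed
  define k where "k e y = g (t + e * \<tau>, y + e *\<^sub>R w)" for e y
  have km: "k e \<in> borel_measurable borel" if "\<bar>e\<bar> < d" for e
  proof -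
    have "(\<lambda>y. g (t + e * \<tau>, y)) \<in> borel_measurable borel" using meas[OF inT[OF that]] .
    then have "(\<lambda>y. g (t + e * \<tau>, y + e *\<^sub>R w)) \<in> borel_measurable borel"
      by (rule measurable_compose[rotated]) simp
    then show ?thesis unfolding k_def .
  qed
  have bdd: "bounded (g ` ({-1..2} \<times> cball x\<^sub>0 R'))"
    by (intro compact_imp_bounded compact_continuous_image cont compact_Times) auto
  then obtain M where M: "\<And>p. p \<in> {-1..2} \<times> cball x\<^sub>0 R' \<Longrightarrow> norm (g p) \<le> M"
    unfolding bounded_iff by blast
  have k0: "integrable lborel (k 0)"
  proof (rule Bochner_Integration.integrable_bound)
    show "integrable lborel (\<lambda>y. M * indicator (cball x\<^sub>0 R') y :: real)"
      by (intro integrable_mult_right) (auto intro!: integrable_real_indicator emeasure_bounded_finite)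
    show "k 0 \<in> borel_measurable lborel" using km[of 0] d by simp
    show "AE y in lborel. norm (k 0 y) \<le> norm (M * indicator (cball x\<^sub>0 R') y :: real)"
    proof (rule AE_I2)
      fix y
      show "norm (k 0 y) \<le> norm (M * indicator (cball x\<^sub>0 R') y :: real)"
        using M[of "(t, y)"] zero[of y t] R t by (cases "y \<in> cball x\<^sub>0 R'") (auto simp: k_def)
    qed
  qed
  have kl: "norm (k e y - k 0 y) \<le> (L * norm (\<tau>, w)) * \<bar>e\<bar> * indicator (cball x\<^sub>0 R') y" if e: "\<bar>e\<bar> < d" for e y
  proof (cases "y \<in> cball x\<^sub>0 R' \<and> y + e *\<^sub>R w \<in> cball x\<^sub>0 R'")
    case True
    have "dist (g (t + e * \<tau>, y + e *\<^sub>R w)) (g (t, y)) \<le> L * dist (t + e * \<tau>, y + e *\<^sub>R w) (t, y)"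
      by (rule lipschitz_onD[OF lip]) (use True inT[OF e] t in auto)
    also have "dist (t + e * \<tau>, y + e *\<^sub>R w) (t, y) = norm (e *\<^sub>R (\<tau>, w))"
      by (simp add: dist_norm)
    also have "\<dots> = \<bar>e\<bar> * norm (\<tau>, w)" by (rule norm_scaleR)
    finally show ?thesis using True by (simp add: k_def dist_norm mult_ac)
  next
    case False
    \<comment> \<open>If one of y and y + e w leaves the larger ball, then neither lies in the
      support ball, and the difference is zero.\<close>
    have "y \<notin> cball x\<^sub>0 R"
    proof
      assume y: "y \<in> cball x\<^sub>0 R"
      have "dist x\<^sub>0 (y + e *\<^sub>R w) \<le> dist x\<^sub>0 y + norm (e *\<^sub>R w)"
        using dist_triangle[of x\<^sub>0 "y + e *\<^sub>R w" y] by (simp add: dist_norm)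
      with y small(2)[OF e] False R show False by auto
    qed
    moreover have "y + e *\<^sub>R w \<notin> cball x\<^sub>0 R"
    proof
      assume y: "y + e *\<^sub>R w \<in> cball x\<^sub>0 R"
      have "dist x\<^sub>0 y \<le> dist x\<^sub>0 (y + e *\<^sub>R w) + norm (e *\<^sub>R w)"
        using dist_triangle[of x\<^sub>0 y "y + e *\<^sub>R w"] by (simp add: dist_norm)
      with y small(2)[OF e] False R show False by auto
    qed
    ultimately have "k e y - k 0 y = 0" using zero by (simp add: k_def)
    moreover have "L \<ge> 0" by (rule lipschitz_on_nonneg[OF lip])
    ultimately show ?thesis by simp
  qed
  have kd: "((\<lambda>e. k e y) has_vector_derivative g' y (\<tau>, w)) (at 0)" for y
  proof -
    have "((\<lambda>e. (t + e * \<tau>, y + e *\<^sub>R w)) has_derivative (\<lambda>e. e *\<^sub>R (\<tau>, w))) (at (0::real))"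
      by (auto intro!: derivative_eq_intros)
    then have "((\<lambda>e. k e y) has_derivative (\<lambda>e. g' y (e *\<^sub>R (\<tau>, w)))) (at 0)"
      unfolding k_def by (rule has_derivative_compose) (use der in simp)
    then show ?thesis
      unfolding has_vector_derivative_def by (simp only: linear_scale[OF has_derivative_linear[OF der[of y]]])
  qed
  note P = parametric_integral_derivative[of d k "L * norm (\<tau>, w)" "cball x\<^sub>0 R'" "\<lambda>y. g' y (\<tau>, w)",
      OF d km k0 kl bounded_cball _ kd]
  show "integrable lborel (\<lambda>y. g' y (\<tau>, w))" by (rule P(1)) auto
  have "((\<lambda>e. \<integral>y. k e y \<partial>lborel) has_vector_derivative (\<integral>y. g' y (\<tau>, w) \<partial>lborel)) (at 0)"
    by (rule P(2)) auto
  moreover have "(\<integral>y. k e y \<partial>lborel) = (\<integral>y. g (t + e * \<tau>, y) \<partial>lborel)" if "\<bar>e\<bar> < d" for e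
    unfolding k_def by (rule integral_lborel_translation[OF meas[OF inT[OF that]]])
  ultimately show "((\<lambda>e. \<integral>y. g (t + e * \<tau>, y) \<partial>lborel) has_vector_derivative (\<integral>y. g' y (\<tau>, w) \<partial>lborel)) (at 0)"
    using d by (elim has_vector_derivative_transform_within_open[of _ _ _ "ball 0 d"]) (auto simp: dist_norm)
qed

text \<open>The integrals over \<open>y\<close> of the spatial derivatives vanish, so that any combination of them may
  be subtracted from the integral of the \<open>t\<close>-derivative.\<close>

lemma homotopy_integral_bound:
  fixes g :: "real \<times> (complex^'n) \<Rightarrow> complex"
  assumes lip: "L-lipschitz_on ({-1..2} \<times> cball x\<^sub>0 R') g" and R: "R < R'"
    and zero: "\<And>t y. y \<notin> cball x\<^sub>0 R \<Longrightarrow> g (t, y) = 0"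
    and der: "\<And>t y. t \<in> {0..1} \<Longrightarrow> (g has_derivative g' t y) (at (t, y))"
    and bi: "\<And>t. t \<in> {0..1} \<Longrightarrow> integrable lborel (b t)"
    and b\<beta>: "\<And>t. t \<in> {0..1} \<Longrightarrow> (\<integral>y. b t y \<partial>lborel) \<le> \<beta>"
    and gb: "\<And>t y. t \<in> {0..1} \<Longrightarrow> norm (g' t y (1, 0) - (g' t y (0, z) + \<i> * g' t y (0, \<i> *s z)) / 2) \<le> b t y"
  shows "norm ((\<integral>y. g (1, y) \<partial>lborel) - (\<integral>y. g (0, y) \<partial>lborel)) \<le> \<beta>"
proof -
  let ?I = "\<lambda>t. \<integral>y. g (t, y) \<partial>lborel" and ?J = "\<lambda>t. \<integral>y. g' t y (1, 0) \<partial>lborel"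
  have i0: "integrable lborel (\<lambda>y. g' t y (0, w))" and v0: "(\<integral>y. g' t y (0, w) \<partial>lborel) = 0" if t: "t \<in> {0..1}" for t w
  proof -
    note d = directional_integral_derivative[OF lip R zero der[OF t] t, of 0 w]
    show "integrable lborel (\<lambda>y. g' t y (0, w))" by (rule d(1))
    \<comment> \<open>With \<tau> = 0 the integral is constant in e; uniqueness of derivatives then
      makes the integral of the spatial derivative zero.\<close>
    have "((\<lambda>e::real. \<integral>y. g (t + e * 0, y) \<partial>lborel) has_vector_derivative 0) (at 0)" by simp
    then show "(\<integral>y. g' t y (0, w) \<partial>lborel) = 0"
      using d(2) vector_derivative_unique_at by blast
  qed
  have J: "norm (?J t) \<le> \<beta>" if t: "t \<in> {0..1}" for t
  proof -
    note d = directional_integral_derivative(1)[OF lip R zero der[OF t] t]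
    have i: "integrable lborel (\<lambda>y. (g' t y (0, z) + \<i> * g' t y (0, \<i> *s z)) / 2)"
      using d by simp
    have "(\<integral>y. (g' t y (0, z) + \<i> * g' t y (0, \<i> *s z)) / 2 \<partial>lborel) = 0"
      using i0[OF t] v0[OF t] by simp
    then have "?J t = (\<integral>y. g' t y (1, 0) - (g' t y (0, z) + \<i> * g' t y (0, \<i> *s z)) / 2 \<partial>lborel)"
      using d i by simp
    also have "norm \<dots> \<le> (\<integral>y. b t y \<partial>lborel)"
      by (rule order_trans[OF integral_norm_bound integral_mono]) (use d i bi[OF t] gb[OF t] in auto)
    finally show ?thesis using b\<beta>[OF t] by simp
  qed
  have D: "(?I has_derivative (\<lambda>h. h *\<^sub>R ?J t)) (at t within {0..1})" if t: "t \<in> {0..1}" for t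
  proof -
    have "((\<lambda>e. \<integral>y. g (t + e * 1, y) \<partial>lborel) has_vector_derivative ?J t) (at (t - t))"
      using directional_integral_derivative(2)[OF lip R zero der[OF t] t, of 1 0] by simp
    then have "((\<lambda>e. \<integral>y. g (t + e, y) \<partial>lborel) has_derivative (\<lambda>h. h *\<^sub>R ?J t)) (at (t - t))"
      by (simp add: has_vector_derivative_def)
    moreover have "((\<lambda>s. s - t) has_derivative (\<lambda>h. h)) (at t)"
      by (auto intro!: derivative_eq_intros)
    ultimately have "((\<lambda>s. \<integral>y. g (t + (s - t), y) \<partial>lborel) has_derivative (\<lambda>h. h *\<^sub>R ?J t)) (at t)"
      by (rule has_derivative_compose[where f = "\<lambda>s. s - t" and g = "\<lambda>e. \<integral>y. g (t + e, y) \<partial>lborel", rotated])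
    then show ?thesis by (simp add: has_derivative_at_withinI)
  qed
  have "norm (?I 1 - ?I 0) \<le> \<beta> * norm (1 - 0 :: real)"
  proof (rule differentiable_bound[OF _ D])
    show "onorm (\<lambda>h. h *\<^sub>R ?J t) \<le> \<beta>" if "t \<in> {0..1}" for t
      by (rule onorm_le) (use J[OF that] in \<open>simp add: mult_left_mono mult.commute[of _ "\<bar>_\<bar>"]\<close>)
  qed auto
  then show ?thesis by simp
qed

text \<open>Stated for upper bounds \<open>A\<close>, \<open>B\<close> of the norms, since later the
  bound for v comes from a different weight. Young's inequality with a free parameter l gives 2
  \<integral> U M \<le> l A^2 + B^2 / l, and l is then optimized.\<close>

lemma Cauchy_Schwarz_integral:
  fixes U M :: "'a \<Rightarrow> real"
  assumes "U \<in> borel_measurable \<mu>" "M \<in> borel_measurable \<mu>"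
    and U: "integrable \<mu> (\<lambda>x. (U x)\<^sup>2)" and M: "integrable \<mu> (\<lambda>x. (M x)\<^sup>2)"
    and Ub: "(\<integral>x. (U x)\<^sup>2 \<partial>\<mu>) \<le> A\<^sup>2" and Mb: "(\<integral>x. (M x)\<^sup>2 \<partial>\<mu>) \<le> B\<^sup>2" and "A \<ge> 0" "B \<ge> 0"
  shows "integrable \<mu> (\<lambda>x. U x * M x)" "(\<integral>x. U x * M x \<partial>\<mu>) \<le> A * B"
proof -
  have young: "\<bar>u * m\<bar> \<le> (l * u\<^sup>2 + m\<^sup>2 / l) / 2" if "l > 0" for u m l :: real
  proof -
    have "0 \<le> (l * \<bar>u\<bar> - \<bar>m\<bar>)\<^sup>2 / l" using that by simp
    also have "\<dots> = l * u\<^sup>2 + m\<^sup>2 / l - 2 * \<bar>u * m\<bar>"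
      using that by (simp add: power2_eq_square field_simps abs_mult)
    finally show ?thesis by simp
  qed
  show i: "integrable \<mu> (\<lambda>x. U x * M x)"
  proof (rule Bochner_Integration.integrable_bound)
    show "integrable \<mu> (\<lambda>x. ((U x)\<^sup>2 + (M x)\<^sup>2) / 2)" using U M by simp
    show "AE x in \<mu>. norm (U x * M x) \<le> norm (((U x)\<^sup>2 + (M x)\<^sup>2) / 2)"
      using young[of 1] by (intro AE_I2) (simp del: abs_divide)
  qed (use assms in simp)
  have key: "2 * (\<integral>x. U x * M x \<partial>\<mu>) \<le> l * A\<^sup>2 + B\<^sup>2 / l" if l: "l > 0" for l
  proof -
    have "(\<integral>x. U x * M x \<partial>\<mu>) \<le> (\<integral>x. (l * (U x)\<^sup>2 + (M x)\<^sup>2 / l) / 2 \<partial>\<mu>)"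
    proof (rule integral_mono)
      show "integrable \<mu> (\<lambda>x. (l * (U x)\<^sup>2 + (M x)\<^sup>2 / l) / 2)" using U M by simp
      show "U x * M x \<le> (l * (U x)\<^sup>2 + (M x)\<^sup>2 / l) / 2" for x
        using young[OF l, of "U x" "M x"] by linarith
    qed (rule i)
    also have "\<dots> = (l * (\<integral>x. (U x)\<^sup>2 \<partial>\<mu>) + (\<integral>x. (M x)\<^sup>2 \<partial>\<mu>) / l) / 2"
      using U M by simp
    also have "\<dots> \<le> (l * A\<^sup>2 + B\<^sup>2 / l) / 2"
      using Ub Mb l by (intro divide_right_mono add_mono mult_left_mono) auto
    finally show ?thesis by simp
  qed
  have "(\<integral>x. U x * M x \<partial>\<mu>) \<le> A * B + e" if "e > 0" for e
  proof -
    \<comment> \<open>The optimal parameter would be B / A, which fails if one of them is zero. The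
      perturbed ratio (B + s) / (A + s) is positive and loses at most s (A + B) \<le> e.\<close>
    define s where "s = e / (A + B + 1)"
    have s: "s > 0" using that assms by (simp add: s_def add_nonneg_pos)
    have "(B + s) / (A + s) * A\<^sup>2 \<le> (B + s) * A"
      using s assms by (simp add: power2_eq_square field_simps)
    moreover have "B\<^sup>2 / ((B + s) / (A + s)) \<le> B * (A + s)"
      using s assms by (simp add: power2_eq_square field_simps)
    moreover have "(B + s) / (A + s) > 0" using s assms by simp
    moreover have "s * (A + B) \<le> e"
      unfolding s_def using that assms by (simp add: field_simps)
    ultimately show ?thesis using key[of "(B + s) / (A + s)"] that by (simp add: algebra_simps)
  qed
  then show "(\<integral>x. U x * M x \<partial>\<mu>) \<le> A * B" by (rule field_le_epsilon)
qed

section \<open>A cutoff function of class C^1\<close>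

lemma has_real_derivative_pos_part_square:
  "((\<lambda>s::real. (max 0 s)\<^sup>2) has_real_derivative 2 * max 0 s) (at s)"
proof -
  consider "s > 0" | "s < 0" | "s = 0" by linarith
  then show ?thesis
  proof cases
    case 1
    have "((\<lambda>s::real. s\<^sup>2) has_real_derivative 2 * max 0 s) (at s)"
      using 1 by (auto intro!: derivative_eq_intros)
    then show ?thesis
      by (rule has_field_derivative_transform_within_open[of _ _ _ "{0<..}"]) (use 1 in auto)
  next
    case 2
    have "((\<lambda>s::real. 0) has_real_derivative 2 * max 0 s) (at s)"
      using 2 by (auto intro!: derivative_eq_intros)
    then show ?thesis
      by (rule has_field_derivative_transform_within_open[of _ _ _ "{..<0}"]) (use 2 in auto)
  next
    case 3
    have "((\<lambda>h. ((max 0 (0 + h))\<^sup>2 - (max 0 0)\<^sup>2) / h) \<longlongrightarrow> 0) (at (0::real))"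
    proof (rule Lim_null_comparison)
      show "\<forall>\<^sub>F h in at 0. norm (((max 0 (0 + h))\<^sup>2 - (max 0 0)\<^sup>2) / h) \<le> \<bar>h::real\<bar>"
        by (intro always_eventually allI) (auto simp: max_def power2_eq_square)
    qed (auto intro!: tendsto_eq_intros)
    then show ?thesis using 3 by (simp add: DERIV_def)
  qed
qed

text \<open>Only one derivative of the cutoff is ever taken, so composing squared positive parts is
  enough and no smooth bump function has to be built.\<close>

lemma cutoff_exists:
  fixes x\<^sub>0 :: "'a::euclidean_space"
  assumes "\<rho> > 0"
  obtains \<theta> :: "'a \<Rightarrow> real" and B where "B \<ge> 0" "\<And>y. \<theta> differentiable (at y)"
    "\<And>y. 0 \<le> \<theta> y" "\<And>y. \<theta> y \<le> 1"
    "\<And>y. y \<in> ball x\<^sub>0 (3 * \<rho>) \<Longrightarrow> \<theta> y = 1"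
    "\<And>y. y \<notin> cball x\<^sub>0 (4 * \<rho>) \<Longrightarrow> \<theta> y = 0"
    "\<And>y w. norm (frechet_derivative \<theta> (at y) w) \<le> B * norm w"
    "\<And>y w. y \<in> ball x\<^sub>0 (3 * \<rho>) \<Longrightarrow> frechet_derivative \<theta> (at y) w = 0"
proof -
  define p :: "real \<Rightarrow> real" where "p s = (max 0 s)\<^sup>2" for s
  \<comment> \<open>The function s below runs from 0 at radius 3\<rho> to (16 - 9) \<rho>^2 at
    radius 4\<rho>; \<kappa> is the square of the latter value, so the outer positive part vanishes
    from there on.\<close>
  define \<kappa> where "\<kappa> = 49 * \<rho> ^ 4"
  define s where "s y = (norm (y - x\<^sub>0))\<^sup>2 - 9 * \<rho>\<^sup>2" for y
  define \<theta> where "\<theta> y = p (1 - p (s y) / \<kappa>)" for y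
  define D where "D y w = 2 * max 0 (1 - p (s y) / \<kappa>) * (- (2 * max 0 (s y) * (2 * (w \<bullet> (y - x\<^sub>0)))) / \<kappa>)" for y w
  have k: "\<kappa> > 0" using assms by (simp add: \<kappa>_def)
  have pd: "(p has_derivative (\<lambda>h. 2 * max 0 t * h)) (at t)" for t
    using has_real_derivative_pos_part_square[of t] unfolding p_def[abs_def] has_field_derivative_def .
  have sd: "(s has_derivative (\<lambda>w. 2 * (w \<bullet> (y - x\<^sub>0)))) (at y)" for y
    unfolding s_def[abs_def] power2_norm_eq_inner
    by (auto intro!: derivative_eq_intros simp: inner_commute)
  have \<theta>d: "(\<theta> has_derivative D y) (at y)" for y
  proof -
    have "((\<lambda>y. p (s y)) has_derivative (\<lambda>w. 2 * max 0 (s y) * (2 * (w \<bullet> (y - x\<^sub>0))))) (at y)"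
      by (rule has_derivative_compose[OF sd pd])
    then have "((\<lambda>y. 1 - p (s y) / \<kappa>) has_derivative (\<lambda>w. - (2 * max 0 (s y) * (2 * (w \<bullet> (y - x\<^sub>0)))) / \<kappa>)) (at y)"
      using k by (auto intro!: derivative_eq_intros)
    from has_derivative_compose[OF this pd] show ?thesis
      unfolding \<theta>_def[abs_def] D_def[abs_def] .
  qed
  have fd: "frechet_derivative \<theta> (at y) = D y" for y
    using frechet_derivative_at[OF \<theta>d] by simp
  have out: "1 - p (s y) / \<kappa> \<le> 0" if "norm (y - x\<^sub>0) \<ge> 4 * \<rho>" for y
  proof -
    have "(4 * \<rho>)\<^sup>2 \<le> (norm (y - x\<^sub>0))\<^sup>2" using that assms by (intro power_mono) auto
    then have "7 * \<rho>\<^sup>2 \<le> s y" by (simp add: s_def power_mult_distrib)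
    then have "(7 * \<rho>\<^sup>2)\<^sup>2 \<le> p (s y)" unfolding p_def by (intro power_mono) auto
    then have "\<kappa> \<le> p (s y)" by (simp add: \<kappa>_def power_mult_distrib flip: power_mult)
    then show ?thesis using k by simp
  qed
  have ins: "max 0 (s y) = 0" if "norm (y - x\<^sub>0) < 3 * \<rho>" for y
  proof -
    have "(norm (y - x\<^sub>0))\<^sup>2 \<le> (3 * \<rho>)\<^sup>2" using that by (intro power_mono) auto
    then show ?thesis by (simp add: s_def power_mult_distrib)
  qed
  have p0: "p t \<ge> 0" for t by (simp add: p_def)
  define B where "B = 2 * (2 * (16 * \<rho>\<^sup>2) * (2 * (4 * \<rho>)) / \<kappa>)"
  show ?thesis
  proof (rule that[of B \<theta>])
    show "B \<ge> 0" using assms k by (simp add: B_def)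
    show "\<theta> differentiable (at y)" for y using \<theta>d by (auto simp: differentiable_def)
    show "0 \<le> \<theta> y" for y by (simp add: \<theta>_def p0)
    show "\<theta> y \<le> 1" for y
    proof -
      have "max 0 (1 - p (s y) / \<kappa>) \<le> 1" using p0[of "s y"] k by simp
      then show ?thesis unfolding \<theta>_def p_def[of "1 - _"] by (simp add: power_le_one)
    qed
    show "\<theta> y = 1" if "y \<in> ball x\<^sub>0 (3 * \<rho>)" for y
      using ins[of y] that by (simp add: \<theta>_def p_def dist_norm norm_minus_commute)
    show "\<theta> y = 0" if "y \<notin> cball x\<^sub>0 (4 * \<rho>)" for y
      using out[of y] that by (simp add: \<theta>_def p_def dist_norm norm_minus_commute)
    show "frechet_derivative \<theta> (at y) w = 0" if "y \<in> ball x\<^sub>0 (3 * \<rho>)" for y w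
      using ins[of y] that by (simp add: fd D_def dist_norm norm_minus_commute)
    show "norm (frechet_derivative \<theta> (at y) w) \<le> B * norm w" for y w
    proof (cases "norm (y - x\<^sub>0) \<ge> 4 * \<rho>")
      case True
      then show ?thesis using out[of y] \<open>B \<ge> 0\<close> by (simp add: fd D_def)
    next
      case False
      have "(norm (y - x\<^sub>0))\<^sup>2 \<le> (4 * \<rho>)\<^sup>2" using False by (intro power_mono) auto
      then have "(norm (y - x\<^sub>0))\<^sup>2 \<le> 16 * \<rho>\<^sup>2" by (simp add: power_mult_distrib)
      then have "s y \<le> 16 * \<rho>\<^sup>2" using zero_le_power2[of \<rho>] unfolding s_def by linarith
      then have s: "\<bar>max 0 (s y)\<bar> \<le> 16 * \<rho>\<^sup>2" by simp
      have "\<bar>w \<bullet> (y - x\<^sub>0)\<bar> \<le> norm w * norm (y - x\<^sub>0)" by (rule Cauchy_Schwarz_ineq2)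
      also have "\<dots> \<le> norm w * (4 * \<rho>)" using False by (intro mult_left_mono) auto
      finally have w: "\<bar>w \<bullet> (y - x\<^sub>0)\<bar> \<le> norm w * (4 * \<rho>)" .
      have m: "\<bar>max 0 (1 - p (s y) / \<kappa>)\<bar> \<le> 1" using p0[of "s y"] k by simp
      have "norm (D y w) = 2 * \<bar>max 0 (1 - p (s y) / \<kappa>)\<bar> * (2 * \<bar>max 0 (s y)\<bar> * (2 * \<bar>w \<bullet> (y - x\<^sub>0)\<bar>) / \<kappa>)"
        using k by (simp add: D_def abs_mult)
      also have "\<dots> \<le> 2 * 1 * (2 * (16 * \<rho>\<^sup>2) * (2 * (norm w * (4 * \<rho>))) / \<kappa>)"
        using s w m k by (intro mult_mono divide_right_mono) auto
      finally show ?thesis by (simp add: fd B_def mult_ac)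
    qed
  qed
qed

section \<open>The derivation along the homotopy\<close>

text \<open>Boundedness is part of the notion because it makes Lipschitz functions stable under
  products.\<close>

definition bounded_lipschitz :: "'a::metric_space set \<Rightarrow> ('a \<Rightarrow> 'b::real_normed_vector) \<Rightarrow> bool" where
  "bounded_lipschitz S f \<longleftrightarrow> bounded (f ` S) \<and> (\<exists>L. L-lipschitz_on S f)"

lemma bounded_lipschitz_compact:
  assumes "compact S" "L-lipschitz_on S f"
  shows "bounded_lipschitz S f"
  unfolding bounded_lipschitz_def
  using assms lipschitz_on_continuous_on[OF assms(2)]
  by (auto intro: compact_imp_bounded compact_continuous_image)

lemma bounded_lipschitz_mult:
  fixes f g :: "'a::metric_space \<Rightarrow> 'b::real_normed_algebra"
  assumes "bounded_lipschitz S f" "bounded_lipschitz S g"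
  shows "bounded_lipschitz S (\<lambda>x. f x * g x)"
proof -
  obtain A where A: "A > 0" "\<And>x. x \<in> S \<Longrightarrow> norm (f x) \<le> A"
    using assms(1) unfolding bounded_lipschitz_def bounded_pos by auto
  obtain B where B: "B > 0" "\<And>x. x \<in> S \<Longrightarrow> norm (g x) \<le> B"
    using assms(2) unfolding bounded_lipschitz_def bounded_pos by auto
  obtain L where L: "L-lipschitz_on S f" using assms(1) by (auto simp: bounded_lipschitz_def)
  obtain M where M: "M-lipschitz_on S g" using assms(2) by (auto simp: bounded_lipschitz_def)
  have "(A * M + L * B)-lipschitz_on S (\<lambda>x. f x * g x)"
  proof (rule lipschitz_onI)
    show "0 \<le> A * M + L * B"
      using A B lipschitz_on_nonneg[OF L] lipschitz_on_nonneg[OF M] by simp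
    fix x y assume xy: "x \<in> S" "y \<in> S"
    have "f x * g x - f y * g y = f x * (g x - g y) + (f x - f y) * g y" by (simp add: algebra_simps)
    then have "dist (f x * g x) (f y * g y) \<le> norm (f x) * norm (g x - g y) + norm (f x - f y) * norm (g y)"
      unfolding dist_norm by (metis norm_triangle_le add_mono norm_mult_ineq)
    also have "\<dots> \<le> A * (M * dist x y) + (L * dist x y) * B"
      using A B xy lipschitz_onD[OF L xy] lipschitz_onD[OF M xy]
      by (intro add_mono mult_mono) (auto simp: dist_norm intro: order_trans[OF norm_ge_zero])
    finally show "dist (f x * g x) (f y * g y) \<le> (A * M + L * B) * dist x y" by (simp add: algebra_simps)
  qed
  moreover have "bounded ((\<lambda>x. f x * g x) ` S)"
    unfolding bounded_iff
    by (rule exI[of _ "A * B"]) (use A B in \<open>auto intro!: order_trans[OF norm_mult_ineq] mult_mono\<close>)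
  ultimately show ?thesis by (auto simp: bounded_lipschitz_def)
qed

lemma bounded_lipschitz_diff:
  assumes "bounded_lipschitz S f" "bounded_lipschitz S g"
  shows "bounded_lipschitz S (\<lambda>x. f x - g x)"
  using assms unfolding bounded_lipschitz_def
  by (auto intro: bounded_minus_comp lipschitz_on_diff)

lemma bounded_lipschitz_const: "bounded_lipschitz S (\<lambda>x. c)"
  unfolding bounded_lipschitz_def
  by (auto simp: image_constant_conv intro: lipschitz_on_constant)

lemma bounded_lipschitz_compose:
  assumes f: "bounded_lipschitz T f" and m: "L-lipschitz_on S m" and "m ` S \<subseteq> T"
  shows "bounded_lipschitz S (\<lambda>x. f (m x))"
proof -
  obtain M where M: "M-lipschitz_on T f" using f by (auto simp: bounded_lipschitz_def)
  have "bounded ((\<lambda>x. f (m x)) ` S)"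
    by (rule bounded_subset[of "f ` T"]) (use f assms(3) in \<open>auto simp: bounded_lipschitz_def\<close>)
  moreover have "(M * L)-lipschitz_on S (\<lambda>x. f (m x))"
    by (rule lipschitz_on_compose2[OF m]) (rule lipschitz_on_subset[OF M assms(3)])
  ultimately show ?thesis by (auto simp: bounded_lipschitz_def)
qed

lemma bounded_lipschitz_exp:
  fixes f :: "'a::metric_space \<Rightarrow> complex"
  assumes f: "bounded_lipschitz S f"
  shows "bounded_lipschitz S (\<lambda>x. exp (f x))"
proof -
  obtain A where A: "A > 0" "\<And>x. x \<in> S \<Longrightarrow> norm (f x) \<le> A"
    using f unfolding bounded_lipschitz_def bounded_pos by auto
  obtain L where L: "L-lipschitz_on S f" using f by (auto simp: bounded_lipschitz_def)
  have "(exp A)-lipschitz_on (cball 0 A) (exp :: complex \<Rightarrow> complex)"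
  proof (rule lipschitz_onI)
    fix x y :: complex assume "x \<in> cball 0 A" "y \<in> cball 0 A"
    then show "dist (exp x) (exp y) \<le> exp A * dist x y"
      unfolding dist_norm
      by (intro field_differentiable_bound[where S = "cball 0 A" and f' = exp])
         (auto intro!: derivative_eq_intros intro: order_trans[OF complex_Re_le_cmod])
  qed simp
  then have "bounded_lipschitz (cball 0 A) (exp :: complex \<Rightarrow> complex)"
    by (rule bounded_lipschitz_compact[OF compact_cball])
  then show ?thesis
    by (rule bounded_lipschitz_compose[OF _ L]) (use A in auto)
qed

text \<open>Meant for \<open>cnj\<close> and \<open>complex_of_real\<close>; of the isometry
  property only the upper bound on distances enters.\<close>

lemma bounded_lipschitz_isometry:
  assumes f: "bounded_lipschitz S f" and k: "\<And>a b. dist (k a) (k b) \<le> dist a b"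
  shows "bounded_lipschitz S (\<lambda>x. k (f x))"
proof -
  obtain L where L: "L-lipschitz_on S f" using f by (auto simp: bounded_lipschitz_def)
  have K: "1-lipschitz_on UNIV k" by (rule lipschitz_onI) (use k in auto)
  obtain e where e: "\<And>x. x \<in> S \<Longrightarrow> dist 0 (f x) \<le> e"
    using f unfolding bounded_lipschitz_def bounded_any_center[where a = 0] by auto
  have "bounded ((\<lambda>x. k (f x)) ` S)"
    unfolding bounded_def by (intro exI[of _ "k 0"] exI[of _ e]) (use e in \<open>auto intro: order_trans[OF k]\<close>)
  moreover have "(1 * L)-lipschitz_on S (\<lambda>x. k (f x))"
    by (rule lipschitz_on_compose2[OF L lipschitz_on_subset[OF K]]) simp
  ultimately show ?thesis by (auto simp: bounded_lipschitz_def)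
qed

lemma lipschitz_on_bounded_linear_add:
  assumes "bounded_linear F"
  obtains L where "L-lipschitz_on S (\<lambda>x. F x + c)"
proof -
  interpret bounded_linear F by fact
  obtain K where K: "K > 0" "\<And>x. norm (F x) \<le> norm x * K" using pos_bounded by auto
  have "K-lipschitz_on S (\<lambda>x. F x + c)"
    by (rule lipschitz_onI) (use K in \<open>auto simp: dist_norm mult.commute simp flip: diff\<close>)
  then show ?thesis by (rule that)
qed

text \<open>Conjugation carries a ball about \<open>x\<^sub>0\<close> to the ball of equal radius
  about \<open>vcnj x\<^sub>0\<close>. The relevant region is thus a convex compact product, on
  which a derivative bound gives a Lipschitz bound.\<close>

lemma twist_bounded_lipschitz:
  assumes f: "smooth_on G f" and G: "\<And>x q. x \<in> cball x\<^sub>0 R \<Longrightarrow> q \<in> cball x\<^sub>0 R \<Longrightarrow> (x, vcnj q) \<in> G"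
  shows "bounded_lipschitz (cball x\<^sub>0 R \<times> cball x\<^sub>0 R) (twist f)"
proof -
  let ?K = "cball x\<^sub>0 R \<times> cball (vcnj x\<^sub>0) R"
  have K: "compact ?K" "convex ?K" by (auto intro: compact_Times convex_Times)
  have sub: "?K \<subseteq> G"
  proof
    fix p assume p: "p \<in> ?K"
    have "dist x\<^sub>0 (vcnj (snd p)) = dist (vcnj x\<^sub>0) (snd p)"
      using dist_vcnj[of x\<^sub>0 "vcnj (snd p)"] by simp
    then show "p \<in> G" using G[of "fst p" "vcnj (snd p)"] p by (auto simp: mem_Times_iff)
  qed
  obtain B where B: "B \<ge> 0" "\<And>x w. x \<in> ?K \<Longrightarrow> norm (frechet_derivative f (at x) w) \<le> B * norm w"
    using smooth_on_derivative_bound[OF f K(1) sub] by blast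
  have "B-lipschitz_on ?K f"
    by (rule lipschitz_on_derivative_bound[OF K(2) B(1) smooth_on_differentiable[OF f] B(2)]) (use sub in auto)
  then have "bounded_lipschitz ?K f" by (rule bounded_lipschitz_compact[OF K(1)])
  moreover have "1-lipschitz_on (cball x\<^sub>0 R \<times> cball x\<^sub>0 R) (\<lambda>p. (fst p, vcnj (snd p)))"
    by (rule lipschitz_onI) (auto simp: dist_Pair_Pair)
  ultimately show ?thesis
    unfolding twist_def[abs_def] by (rule bounded_lipschitz_compose) auto
qed

text \<open>\<open>\<partial>\<close>/\<open>\<partial>t\<close> minus the \<open>\<partial>\<close>-bar derivative in \<open>y\<close> in the direction \<open>z\<close>, a complex linear derivation.\<close>

definition lop :: "complex^'n \<Rightarrow> (real \<times> (complex^'n) \<Rightarrow> complex) \<Rightarrow> real \<times> (complex^'n) \<Rightarrow> complex" where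
  "lop z f p = frechet_derivative f (at p) (1, 0)
     - (frechet_derivative f (at p) (0, z) + \<i> * frechet_derivative f (at p) (0, \<i> *s z)) / 2"

text \<open>Existence and value in one relation, in the manner of \<open>has_derivative\<close>, so
  that product, difference and exponential rules can be chained without separate differentiability
  arguments.\<close>

definition has_lop :: "complex^'n \<Rightarrow> (real \<times> (complex^'n) \<Rightarrow> complex) \<Rightarrow> complex \<Rightarrow> real \<times> (complex^'n) \<Rightarrow> bool" where
  "has_lop z f d p \<longleftrightarrow> f differentiable (at p) \<and> lop z f p = d"

lemma has_lopI:
  assumes "(f has_derivative f') (at p)" "d = f' (1, 0) - (f' (0, z) + \<i> * f' (0, \<i> *s z)) / 2"
  shows "has_lop z f d p"
  using assms frechet_derivative_at[OF assms(1)] by (auto simp: has_lop_def lop_def differentiable_def)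

lemma has_lopE:
  assumes "has_lop z f d p"
  obtains f' where "(f has_derivative f') (at p)" "d = f' (1, 0) - (f' (0, z) + \<i> * f' (0, \<i> *s z)) / 2"
  using assms frechet_derivative_works unfolding has_lop_def lop_def by blast

lemma has_lop_mult:
  assumes "has_lop z f d p" "has_lop z g e p"
  shows "has_lop z (\<lambda>q. f q * g q) (f p * e + d * g p) p"
proof -
  obtain f' where f: "(f has_derivative f') (at p)" "d = f' (1, 0) - (f' (0, z) + \<i> * f' (0, \<i> *s z)) / 2"
    using assms(1) by (rule has_lopE)
  obtain g' where g: "(g has_derivative g') (at p)" "e = g' (1, 0) - (g' (0, z) + \<i> * g' (0, \<i> *s z)) / 2"
    using assms(2) by (rule has_lopE)
  show ?thesis
    by (rule has_lopI[OF has_derivative_mult[OF f(1) g(1)]]) (simp add: f(2) g(2) field_simps)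
qed

lemma has_lop_diff:
  assumes "has_lop z f d p" "has_lop z g e p"
  shows "has_lop z (\<lambda>q. f q - g q) (d - e) p"
proof -
  obtain f' where f: "(f has_derivative f') (at p)" "d = f' (1, 0) - (f' (0, z) + \<i> * f' (0, \<i> *s z)) / 2"
    using assms(1) by (rule has_lopE)
  obtain g' where g: "(g has_derivative g') (at p)" "e = g' (1, 0) - (g' (0, z) + \<i> * g' (0, \<i> *s z)) / 2"
    using assms(2) by (rule has_lopE)
  show ?thesis
    by (rule has_lopI[OF has_derivative_diff[OF f(1) g(1)]]) (simp add: f(2) g(2) field_simps)
qed

lemma has_lop_exp:
  assumes "has_lop z f d p"
  shows "has_lop z (\<lambda>q. exp (k * f q)) (exp (k * f p) * (k * d)) p"
proof -
  obtain f' where f: "(f has_derivative f') (at p)" "d = f' (1, 0) - (f' (0, z) + \<i> * f' (0, \<i> *s z)) / 2"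
    using assms(1) by (rule has_lopE)
  have "((\<lambda>q. exp (k * f q)) has_derivative (\<lambda>w. exp (k * f p) * (k * f' w))) (at p)"
    by (rule has_derivative_compose[OF has_derivative_mult_right[OF f(1)] DERIV_exp[unfolded has_field_derivative_def]])
  then show ?thesis
    by (rule has_lopI) (simp add: f(2) field_simps)
qed

text \<open>The hypothesis on \<open>m\<close> says that y translates both arguments while t moves
  only the second one, by z. This matches the two terms in \<open>defect\<close>. All three pairs of
  points in the homotopy are of this type and differ by constants only.\<close>

lemma has_lop_twist:
  assumes f: "f differentiable (at (x, vcnj q))" and m: "m p = (x, q)"
    and dm: "(m has_derivative (\<lambda>w. (snd w, snd w + fst w *\<^sub>R z))) (at p)"
  shows "has_lop z (\<lambda>p. twist f (m p)) (defect f (x, vcnj q) z) p"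
proof -
  have "((\<lambda>p. twist f (m p)) has_derivative
     (\<lambda>w. frechet_derivative f (at (x, vcnj q)) (fst (snd w, snd w + fst w *\<^sub>R z), vcnj (snd (snd w, snd w + fst w *\<^sub>R z))))) (at p)"
    by (rule has_derivative_compose[OF dm]) (use twist_has_derivative[OF f] m in simp)
  then show ?thesis
    by (rule has_lopI) (simp add: defect_def)
qed

lemma has_lop_hol:
  assumes u: "hol_on V u" and y: "y \<in> V"
  shows "has_lop z (\<lambda>p. u (snd p)) 0 (t, y)"
proof -
  have du: "(u has_derivative frechet_derivative u (at y)) (at y)"
    using u y frechet_derivative_works unfolding hol_on_def by blast
  have "((\<lambda>p. u (snd p)) has_derivative (\<lambda>w. frechet_derivative u (at y) (snd w))) (at (t, y))"
    by (rule has_derivative_compose[where g = u and f = snd]) (use du in \<open>auto intro!: derivative_eq_intros\<close>)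
  then show ?thesis
    by (rule has_lopI) (simp add: hol_on_derivative_imult[OF u y] linear_0[OF has_derivative_linear[OF du]] flip: mult.assoc)
qed

text \<open>Conjugating v turns its d-bar derivative in the direction z into its full derivative
  along z, and the motion y + t z produces the same quantity as t-derivative. The two cancel; this
  is why v must move with t while u stays at y.\<close>

lemma has_lop_antihol:
  assumes v: "hol_on V v" and p: "y + t *\<^sub>R z \<in> V"
  shows "has_lop z (\<lambda>p. cnj (v (snd p + fst p *\<^sub>R z))) 0 (t, y)"
proof -
  let ?v = "frechet_derivative v (at (y + t *\<^sub>R z))"
  have dv: "(v has_derivative ?v) (at (y + t *\<^sub>R z))"
    using v p frechet_derivative_works unfolding hol_on_def by blast
  have "((\<lambda>p. v (snd p + fst p *\<^sub>R z)) has_derivative (\<lambda>w. ?v (snd w + fst w *\<^sub>R z))) (at (t, y))"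
    by (rule has_derivative_compose[where g = v and f = "\<lambda>p. snd p + fst p *\<^sub>R z"]) (use dv in \<open>auto intro!: derivative_eq_intros\<close>)
  from bounded_linear.has_derivative[OF bounded_linear_cnj this]
  show ?thesis
    by (rule has_lopI) (simp add: hol_on_derivative_imult[OF v p])
qed

lemma has_lop_cutoff:
  assumes "\<theta> differentiable (at y)"
  shows "has_lop z (\<lambda>p. complex_of_real (\<theta> (snd p)))
     (- ((complex_of_real (frechet_derivative \<theta> (at y) z) + \<i> * complex_of_real (frechet_derivative \<theta> (at y) (\<i> *s z))) / 2)) (t, y)"
proof -
  have d: "(\<theta> has_derivative frechet_derivative \<theta> (at y)) (at y)"
    using assms frechet_derivative_works by blast
  have "((\<lambda>p. \<theta> (snd p)) has_derivative (\<lambda>w. frechet_derivative \<theta> (at y) (snd w))) (at (t, y))"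
    by (rule has_derivative_compose[where g = \<theta> and f = snd]) (use d in \<open>auto intro!: derivative_eq_intros\<close>)
  from has_derivative_of_real[OF this] show ?thesis
    by (rule has_lopI) (simp add: linear_0[OF has_derivative_linear[OF d]])
qed

lemma has_lop_zero:
  assumes "open S" "p \<in> S" "\<And>q. q \<in> S \<Longrightarrow> f q = 0"
  shows "has_lop z f 0 p"
proof -
  have "((\<lambda>q. 0::complex) has_derivative (\<lambda>w. 0)) (at p)" by simp
  then have "(f has_derivative (\<lambda>w. 0)) (at p)"
    by (rule has_derivative_transform_within_open[OF _ assms(1,2)]) (simp add: assms(3))
  then show ?thesis by (rule has_lopI) simp
qed

section \<open>The homotopy\<close>

text \<open>The half weight makes the square of this function the density of the weighted L^2 norm.
  Extension by zero allows integration and translation over the whole space.\<close>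

definition weighted_abs :: "real \<Rightarrow> (complex^'n \<Rightarrow> real) \<Rightarrow> (complex^'n) set \<Rightarrow> (complex^'n \<Rightarrow> complex) \<Rightarrow> complex^'n \<Rightarrow> real" where
  "weighted_abs h \<Phi> V u y = indicator V y * (norm (u y) * exp (- \<Phi> y / h))"

lemma weighted_abs_nonneg: "weighted_abs h \<Phi> V u y \<ge> 0"
  by (simp add: weighted_abs_def)

lemma weighted_abs_measurable:
  assumes "open V" "continuous_on V \<Phi>" "h > 0" "hol_on V w"
  shows "weighted_abs h \<Phi> V w \<in> borel_measurable borel"
proof -
  have "(\<lambda>y. indicator V y *\<^sub>R (norm (w y) * exp (- \<Phi> y / h))) \<in> borel_measurable borel"
    using assms(1,3)
    by (intro borel_measurable_continuous_on_indicator continuous_intros hol_on_continuous[OF assms(4)] assms(2)) auto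
  then show ?thesis by (simp add: weighted_abs_def[abs_def])
qed

text \<open>One value of h and one pair u, v are fixed, so that all asymptotic quantifiers are dealt
  with once at the end. \<open>A\<close>, \<open>B\<close>, \<open>B0\<close> are upper bounds
  rather than norms: \<open>B\<close> will be the norm of v in the smaller weight and
  \<open>B0\<close> that norm times an exponentially small factor. The radii increase as follows:
  3\<rho> where the cutoff is 1, 4\<rho> for its support, 5\<rho> for the Lipschitz bounds in y,
  6\<rho> for the points moved by the homotopy, 7\<rho> as room for the Cauchy inequality.\<close>

locale bergman_homotopy =
  fixes \<Phi> :: "complex^'n \<Rightarrow> real"
    and \<Psi> al :: "(complex^'n) \<times> (complex^'n) \<Rightarrow> complex"
    and x\<^sub>0 :: "complex^'n" and V :: "(complex^'n) set" and G :: "((complex^'n) \<times> (complex^'n)) set"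
    and \<rho> :: real and \<theta> :: "complex^'n \<Rightarrow> real" and Bt h c Ca CN :: real and N :: nat
    and u v :: "complex^'n \<Rightarrow> complex" and A B B0 :: real
  assumes h: "h > 0" and rho: "\<rho> > 0" and c: "c > 0" and Ca: "Ca \<ge> 0" and CN: "CN \<ge> 0"
    and V: "open V" "bounded V" "cball x\<^sub>0 (7 * \<rho>) \<subseteq> V"
    and Phi: "continuous_on V \<Phi>"
    and VG: "\<And>x q. x \<in> V \<Longrightarrow> q \<in> V \<Longrightarrow> (x, vcnj q) \<in> G"
    and Psi: "smooth_on G \<Psi>" and al: "smooth_on G al"
    and diag: "\<And>x. x \<in> V \<Longrightarrow> \<Psi> (x, vcnj x) = complex_of_real (\<Phi> x)"
    and alb: "\<And>x q. x \<in> V \<Longrightarrow> q \<in> V \<Longrightarrow> norm (al (x, vcnj q)) \<le> Ca"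
    and dia: "\<And>p q. p \<in> V \<Longrightarrow> q \<in> V \<Longrightarrow> c * (norm (p - q))\<^sup>2 \<le> diastasis \<Phi> \<Psi> p q"
    and hom: "\<And>y z t. t \<in> {0..1} \<Longrightarrow> y \<in> V \<Longrightarrow> y + z \<in> V \<Longrightarrow> y - (1 - t) *\<^sub>R z \<in> V \<Longrightarrow> y + t *\<^sub>R z \<in> V \<Longrightarrow>
        - diastasis \<Phi> \<Psi> (y + z) (y - (1 - t) *\<^sub>R z) + diastasis \<Phi> \<Psi> (y + z) (y + t *\<^sub>R z)
        + diastasis \<Phi> \<Psi> y (y - (1 - t) *\<^sub>R z) \<le> - c * (norm z)\<^sup>2"
    and Psid: "\<And>x q z. x \<in> V \<Longrightarrow> q \<in> V \<Longrightarrow> norm (defect \<Psi> (x, vcnj q) z) \<le> CN * norm (q - x) ^ N * norm z"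
    and ald: "\<And>x q z. x \<in> V \<Longrightarrow> q \<in> V \<Longrightarrow> norm (defect al (x, vcnj q) z) \<le> CN * (h ^ N + norm (q - x) ^ N) * norm z"
    and theta: "Bt \<ge> 0" "\<And>y. \<theta> differentiable (at y)" "\<And>y. 0 \<le> \<theta> y" "\<And>y. \<theta> y \<le> 1"
      "\<And>y. y \<in> ball x\<^sub>0 (3 * \<rho>) \<Longrightarrow> \<theta> y = 1"
      "\<And>y. y \<notin> cball x\<^sub>0 (4 * \<rho>) \<Longrightarrow> \<theta> y = 0"
      "\<And>y w. norm (frechet_derivative \<theta> (at y) w) \<le> Bt * norm w"
      "\<And>y w. y \<in> ball x\<^sub>0 (3 * \<rho>) \<Longrightarrow> frechet_derivative \<theta> (at y) w = 0"
    and u: "hol_on V u" and v: "hol_on V v"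
    and A: "A \<ge> 0" "integrable lborel (\<lambda>y. (weighted_abs h \<Phi> V u y)\<^sup>2)" "(\<integral>y. (weighted_abs h \<Phi> V u y)\<^sup>2 \<partial>lborel) \<le> A\<^sup>2"
    and B: "B \<ge> 0" "integrable lborel (\<lambda>y. (weighted_abs h \<Phi> V v y)\<^sup>2)" "(\<integral>y. (weighted_abs h \<Phi> V v y)\<^sup>2 \<partial>lborel) \<le> B\<^sup>2"
    and B0: "B0 \<ge> 0" "(\<integral>y. (indicator (- ball x\<^sub>0 (2 * \<rho>)) y * weighted_abs h \<Phi> V v y)\<^sup>2 \<partial>lborel) \<le> B0\<^sup>2"
begin

abbreviation "U \<equiv> weighted_abs h \<Phi> V u"
abbreviation "M \<equiv> weighted_abs h \<Phi> V v"
abbreviation "M0 \<equiv> \<lambda>y. indicator (- ball x\<^sub>0 (2 * \<rho>)) y * M y"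

lemma cball_V: "r \<le> 7 * \<rho> \<Longrightarrow> cball x\<^sub>0 r \<subseteq> V"
  using V(3) by auto

lemma shift_in:
  assumes "y \<in> cball x\<^sub>0 (5 * \<rho>)" "norm z \<le> \<rho> / 2" "\<bar>s\<bar> \<le> 2"
  shows "y + s *\<^sub>R z \<in> cball x\<^sub>0 (6 * \<rho>)" "y - s *\<^sub>R z \<in> cball x\<^sub>0 (6 * \<rho>)"
proof -
  have "norm (s *\<^sub>R z) \<le> 2 * (\<rho> / 2)"
    unfolding norm_scaleR using assms by (intro mult_mono) auto
  moreover have "dist x\<^sub>0 (y + w) \<le> dist x\<^sub>0 y + norm w" for w
    using dist_triangle[of x\<^sub>0 "y + w" y] by (simp add: dist_norm)
  from this[of "s *\<^sub>R z"] this[of "- (s *\<^sub>R z)"] have "dist x\<^sub>0 (y + s *\<^sub>R z) \<le> dist x\<^sub>0 y + norm (s *\<^sub>R z)"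
     "dist x\<^sub>0 (y - s *\<^sub>R z) \<le> dist x\<^sub>0 y + norm (s *\<^sub>R z)" by simp_all
  ultimately show "y + s *\<^sub>R z \<in> cball x\<^sub>0 (6 * \<rho>)" "y - s *\<^sub>R z \<in> cball x\<^sub>0 (6 * \<rho>)"
    using assms(1) by auto
qed

text \<open>The interval [-1, 2] leaves room for two-sided t-derivatives at both ends of [0, 1]. All
  displacements stay within 2 |z| \<le> \<rho>.\<close>

lemma points_in:
  assumes "y \<in> cball x\<^sub>0 (5 * \<rho>)" "norm z \<le> \<rho> / 2" "t \<in> {-1..2}"
  shows "y \<in> cball x\<^sub>0 (6 * \<rho>)" "y + z \<in> cball x\<^sub>0 (6 * \<rho>)" "y - (1 - t) *\<^sub>R z \<in> cball x\<^sub>0 (6 * \<rho>)"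
    "y + t *\<^sub>R z \<in> cball x\<^sub>0 (6 * \<rho>)"
  using shift_in[OF assms(1,2), of 0] shift_in[OF assms(1,2), of 1] shift_in(2)[OF assms(1,2), of "1 - t"]
    shift_in(1)[OF assms(1,2), of t] assms(3) by (auto simp: abs_le_iff)

lemma points_in_V:
  assumes "y \<in> cball x\<^sub>0 (5 * \<rho>)" "norm z \<le> \<rho> / 2" "t \<in> {-1..2}"
  shows "y \<in> V" "y + z \<in> V" "y - (1 - t) *\<^sub>R z \<in> V" "y + t *\<^sub>R z \<in> V"
  using points_in[OF assms] cball_V[of "6 * \<rho>"] rho by auto

text \<open>The polarized exponent of the kernel and the weights, with the arguments moved by the homotopy.\<close>

definition hphase :: "complex^'n \<Rightarrow> real \<times> (complex^'n) \<Rightarrow> complex" where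
  "hphase z p = twist \<Psi> (snd p + z, snd p - (1 - fst p) *\<^sub>R z) - twist \<Psi> (snd p + z, snd p + fst p *\<^sub>R z)
     - twist \<Psi> (snd p, snd p - (1 - fst p) *\<^sub>R z)"

text \<open>The factor u depends on y alone and the conjugate of v on y + t z, and the derivation
  annihilates both. Hence only the defects of \<Psi> and \<open>al\<close> and the derivative of the
  cutoff survive.\<close>

definition integrand :: "complex^'n \<Rightarrow> real \<times> (complex^'n) \<Rightarrow> complex" where
  "integrand z p = complex_of_real (\<theta> (snd p)) * (exp (2 / complex_of_real h * hphase z p) *
     (twist al (snd p + z, snd p - (1 - fst p) *\<^sub>R z) * (u (snd p) * cnj (v (snd p + fst p *\<^sub>R z)))))"

lemma integrand_zero: "y \<notin> cball x\<^sub>0 (4 * \<rho>) \<Longrightarrow> integrand z (t, y) = 0"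
  using theta(6) by (simp add: integrand_def)

lemma hol_bounded_lipschitz:
  assumes "hol_on V w"
  shows "bounded_lipschitz (cball x\<^sub>0 (6 * \<rho>)) w"
proof -
  obtain L where L: "L \<ge> 0" "\<And>y k. y \<in> cball x\<^sub>0 (6 * \<rho>) \<Longrightarrow> norm (frechet_derivative w (at y) k) \<le> L * norm k"
    using hol_on_derivative_bound[OF assms V(3), of "6 * \<rho>"] rho by auto
  have "L-lipschitz_on (cball x\<^sub>0 (6 * \<rho>)) w"
    by (rule lipschitz_on_derivative_bound[OF convex_cball L(1) _ L(2)])
       (use assms cball_V[of "6 * \<rho>"] rho in \<open>auto simp: hol_on_def\<close>)
  then show ?thesis by (rule bounded_lipschitz_compact[OF compact_cball])
qed

text \<open>Purely qualitative: the constant depends on z, h, u and v, justifies differentiation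
  under the integral sign, and enters no estimate.\<close>

lemma integrand_lipschitz:
  assumes z: "norm z \<le> \<rho> / 2"
  obtains L where "L-lipschitz_on ({-1..2} \<times> cball x\<^sub>0 (5 * \<rho>)) (integrand z)"
proof -
  let ?S = "{-1..2 :: real} \<times> cball x\<^sub>0 (5 * \<rho>)" and ?K = "cball x\<^sub>0 (6 * \<rho>)"
  have lin: "bounded_linear (\<lambda>p. (snd p, snd p + fst p *\<^sub>R z))"
    by (intro bounded_linear_Pair bounded_linear_snd bounded_linear_add
        bounded_linear_compose[OF bounded_linear_scaleR_left bounded_linear_fst])
  have comp: "bounded_lipschitz ?S (\<lambda>p. twist f (m p))"
    if f: "smooth_on G f" and m: "\<And>p. m p = (snd p, snd p + fst p *\<^sub>R z) + k" "m ` ?S \<subseteq> ?K \<times> ?K" for f m k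
  proof -
    obtain L where "L-lipschitz_on ?S (\<lambda>p. (snd p, snd p + fst p *\<^sub>R z) + k)"
      using lipschitz_on_bounded_linear_add[OF lin] .
    then have L: "L-lipschitz_on ?S m" by (simp add: m(1)[abs_def])
    show ?thesis
      by (rule bounded_lipschitz_compose[OF twist_bounded_lipschitz[OF f] L m(2)])
         (use rho in \<open>auto intro!: VG subsetD[OF cball_V[of "6 * \<rho>"]]\<close>)
  qed
  have m1: "bounded_lipschitz ?S (\<lambda>p. twist f (snd p + z, snd p - (1 - fst p) *\<^sub>R z))" if "smooth_on G f" for f
    by (rule comp[of f _ "(z, - z)", OF that]) (use points_in z in \<open>auto simp: algebra_simps\<close>)
  have m2: "bounded_lipschitz ?S (\<lambda>p. twist \<Psi> (snd p + z, snd p + fst p *\<^sub>R z))"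
    by (rule comp[of \<Psi> _ "(z, 0)", OF Psi]) (use points_in z in auto)
  have m3: "bounded_lipschitz ?S (\<lambda>p. twist \<Psi> (snd p, snd p - (1 - fst p) *\<^sub>R z))"
    by (rule comp[of \<Psi> _ "(0, - z)", OF Psi]) (use points_in z in \<open>auto simp: algebra_simps\<close>)
  have e: "bounded_lipschitz ?S (\<lambda>p. exp (2 / complex_of_real h * hphase z p))"
    unfolding hphase_def
    by (intro bounded_lipschitz_exp bounded_lipschitz_mult bounded_lipschitz_const bounded_lipschitz_diff m1 m2 m3 Psi)
  obtain L1 where L1: "L1-lipschitz_on ?S (\<lambda>p. snd p + (0 :: complex^'n))"
    using lipschitz_on_bounded_linear_add[OF bounded_linear_snd] .
  have "bounded_linear (\<lambda>p. snd p + fst p *\<^sub>R z)"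
    by (intro bounded_linear_snd bounded_linear_add bounded_linear_compose[OF bounded_linear_scaleR_left bounded_linear_fst])
  then obtain L2 where L2: "L2-lipschitz_on ?S (\<lambda>p. snd p + fst p *\<^sub>R z + 0)"
    using lipschitz_on_bounded_linear_add by blast
  have uu: "bounded_lipschitz ?S (\<lambda>p. u (snd p))"
    using bounded_lipschitz_compose[OF hol_bounded_lipschitz[OF u] L1] rho by fastforce
  have "bounded_lipschitz ?S (\<lambda>p. v (snd p + fst p *\<^sub>R z + 0))"
    by (rule bounded_lipschitz_compose[OF hol_bounded_lipschitz[OF v] L2]) (use points_in z in auto)
  then have vv: "bounded_lipschitz ?S (\<lambda>p. cnj (v (snd p + fst p *\<^sub>R z)))"
    by (intro bounded_lipschitz_isometry[where k = cnj]) (simp_all add: dist_norm flip: complex_cnj_diff)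
  have "Bt-lipschitz_on (cball x\<^sub>0 (5 * \<rho>)) \<theta>"
    by (rule lipschitz_on_derivative_bound[OF convex_cball theta(1) theta(2) theta(7)])
  then have "bounded_lipschitz (cball x\<^sub>0 (5 * \<rho>)) \<theta>"
    by (rule bounded_lipschitz_compact[OF compact_cball])
  from bounded_lipschitz_compose[OF this L1] have "bounded_lipschitz ?S (\<lambda>p. \<theta> (snd p))" by fastforce
  then have tt: "bounded_lipschitz ?S (\<lambda>p. complex_of_real (\<theta> (snd p)))"
    by (rule bounded_lipschitz_isometry) (simp add: dist_norm flip: of_real_diff)
  have "bounded_lipschitz ?S (integrand z)"
    unfolding integrand_def[abs_def] by (intro bounded_lipschitz_mult tt e m1 al uu vv)
  then show ?thesis using that by (auto simp: bounded_lipschitz_def)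
qed

text \<open>Twice the real part of the phase equals the combination of diastases in
  \<open>hom\<close> minus \<Phi>(y) minus \<Phi>(y + t z). These last two terms are the half
  weights at the points where u and v are evaluated, and \<open>hom\<close> supplies the
  gaussian.\<close>

lemma norm_integrand_exp:
  assumes "y \<in> cball x\<^sub>0 (5 * \<rho>)" "norm z \<le> \<rho> / 2" "t \<in> {0..1}"
  shows "norm (exp (2 / complex_of_real h * hphase z (t, y)) * (u y * cnj (v (y + t *\<^sub>R z))))
     \<le> exp (- c * (norm z)\<^sup>2 / h) * (U y * M (y + t *\<^sub>R z))"
proof -
  have t: "t \<in> {-1..2}" using assms by auto
  note P = points_in_V[OF assms(1,2) t]
  let ?p = "y + t *\<^sub>R z" and ?x = "y + z" and ?q = "y - (1 - t) *\<^sub>R z"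
  have "2 * Re (hphase z (t, y)) = (- diastasis \<Phi> \<Psi> ?x ?q + diastasis \<Phi> \<Psi> ?x ?p + diastasis \<Phi> \<Psi> y ?q) - \<Phi> y - \<Phi> ?p"
    by (simp add: hphase_def twist_def diastasis_def)
  also have "\<dots> \<le> - c * (norm z)\<^sup>2 - \<Phi> y - \<Phi> ?p"
    using hom[OF assms(3) P] by simp
  finally have "2 * Re (hphase z (t, y)) / h \<le> (- c * (norm z)\<^sup>2 - \<Phi> y - \<Phi> ?p) / h"
    using h by (intro divide_right_mono) auto
  then have "exp (2 * Re (hphase z (t, y)) / h) \<le> exp (- c * (norm z)\<^sup>2 / h) * (exp (- \<Phi> y / h) * exp (- \<Phi> ?p / h))"
    by (simp add: diff_divide_distrib flip: exp_add)
  moreover have "Re (2 / complex_of_real h * hphase z (t, y)) = 2 * Re (hphase z (t, y)) / h"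
    by (simp add: Re_divide_of_real)
  ultimately have "norm (exp (2 / complex_of_real h * hphase z (t, y))) \<le> exp (- c * (norm z)\<^sup>2 / h) * (exp (- \<Phi> y / h) * exp (- \<Phi> ?p / h))"
    by (simp only: norm_exp_eq_Re)
  then have "norm (exp (2 / complex_of_real h * hphase z (t, y))) * (norm (u y) * norm (v ?p))
      \<le> (exp (- c * (norm z)\<^sup>2 / h) * (exp (- \<Phi> y / h) * exp (- \<Phi> ?p / h))) * (norm (u y) * norm (v ?p))"
    by (rule mult_right_mono) simp
  then show ?thesis
    using P by (simp add: weighted_abs_def norm_mult mult_ac)
qed

text \<open>Gaussian times the defect of the symbol, plus 2/h times the three defects of \<Psi>
  times the bound of the symbol. The quantity 2 |z| dominates the distances (2 - t) |z| and (1 - t)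
  |z| between the points involved.\<close>

definition K1 :: "complex^'n \<Rightarrow> real" where
  "K1 z = exp (- c * (norm z)\<^sup>2 / h) *
     (CN * (h ^ N + (2 * norm z) ^ N) * norm z + 2 / h * (3 * (CN * (2 * norm z) ^ N * norm z)) * Ca)"

lemma integrand_lop:
  assumes z: "norm z \<le> \<rho> / 2" and t: "t \<in> {0..1}"
  obtains d where "has_lop z (integrand z) d (t, y)"
    "norm d \<le> K1 z * (U y * M (y + t *\<^sub>R z)) + (Bt * norm z * Ca) * (U y * M0 (y + t *\<^sub>R z))"
proof (cases "y \<in> cball x\<^sub>0 (4 * \<rho>)")
  case False
  \<comment> \<open>Away from the support of the cutoff the integrand vanishes on a whole
    neighborhood, so nothing is needed about u and v there.\<close>
  have "has_lop z (integrand z) 0 (t, y)"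
    by (rule has_lop_zero[of "UNIV \<times> (- cball x\<^sub>0 (4 * \<rho>))"])
       (use False in \<open>auto intro!: open_Times simp: integrand_zero open_Compl simp del: mem_cball\<close>)
  moreover have "K1 z \<ge> 0" using h c Ca CN by (simp add: K1_def)
  moreover have "U y * M (y + t *\<^sub>R z) \<ge> 0" "U y * M0 (y + t *\<^sub>R z) \<ge> 0" "Bt * norm z * Ca \<ge> 0"
    using Ca theta(1) by (simp_all add: weighted_abs_nonneg)
  ultimately show ?thesis using that[of 0] by simp
next
  case True
  then have y: "y \<in> cball x\<^sub>0 (5 * \<rho>)" using rho by auto
  have t': "t \<in> {-1..2}" using t by auto
  note P = points_in_V[OF y z t']
  let ?p = "y + t *\<^sub>R z" and ?x = "y + z" and ?q = "y - (1 - t) *\<^sub>R z"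
  let ?e = "exp (2 / complex_of_real h * hphase z (t, y))"
  let ?a = "twist al (?x, ?q)" and ?uv = "u y * cnj (v ?p)"
  let ?Np = "defect \<Psi> (?x, vcnj ?q) z - defect \<Psi> (?x, vcnj ?p) z - defect \<Psi> (y, vcnj ?q) z"
  let ?Na = "defect al (?x, vcnj ?q) z"
  let ?dt = "- ((complex_of_real (frechet_derivative \<theta> (at y) z) + \<i> * complex_of_real (frechet_derivative \<theta> (at y) (\<i> *s z))) / 2)"
  have tw: "has_lop z (\<lambda>p. twist f (m p)) (defect f (a, vcnj b) z) (t, y)"
    if "smooth_on G f" "a \<in> V" "b \<in> V" "m (t, y) = (a, b)"
      "(m has_derivative (\<lambda>w. (snd w, snd w + fst w *\<^sub>R z))) (at (t, y))" for f a b m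
    by (rule has_lop_twist[OF smooth_on_differentiable[OF that(1) VG[OF that(2,3)]] that(4,5)])
  have m1: "has_lop z (\<lambda>p. twist f (snd p + z, snd p - (1 - fst p) *\<^sub>R z)) (defect f (?x, vcnj ?q) z) (t, y)"
    if "smooth_on G f" for f
    by (rule tw[OF that P(2,3)]) (auto intro!: derivative_eq_intros)
  have m2: "has_lop z (\<lambda>p. twist \<Psi> (snd p + z, snd p + fst p *\<^sub>R z)) (defect \<Psi> (?x, vcnj ?p) z) (t, y)"
    by (rule tw[OF Psi P(2,4)]) (auto intro!: derivative_eq_intros)
  have m3: "has_lop z (\<lambda>p. twist \<Psi> (snd p, snd p - (1 - fst p) *\<^sub>R z)) (defect \<Psi> (y, vcnj ?q) z) (t, y)"
    by (rule tw[OF Psi P(1,3)]) (auto intro!: derivative_eq_intros)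
  have "has_lop z (hphase z) ?Np (t, y)"
    unfolding hphase_def[abs_def] by (intro has_lop_diff m1 m2 m3 Psi)
  from has_lop_exp[OF this] have e: "has_lop z (\<lambda>p. exp (2 / complex_of_real h * hphase z p)) (?e * (2 / complex_of_real h * ?Np)) (t, y)" .
  \<comment> \<open>The exponential is grouped with the values of u and v, the product bounded by
    \<open>norm_integrand_exp\<close>. The first summand collects the defects, the second the
    derivative of the cutoff.\<close>
  define d where "d = complex_of_real (\<theta> y) * (?e * ?uv * (?Na + 2 / complex_of_real h * ?Np * ?a)) + ?dt * (?a * (?e * ?uv))"
  have "has_lop z (integrand z) d (t, y)"
  proof -
    note * = has_lop_mult[OF has_lop_cutoff[OF theta(2), of z y t] has_lop_mult[OF e has_lop_mult[OF m1[OF al]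
       has_lop_mult[OF has_lop_hol[OF u P(1), of z t] has_lop_antihol[OF v P(4)]]]]]
    show ?thesis unfolding integrand_def[abs_def]
      by (rule back_subst[of "\<lambda>d. has_lop z _ d (t, y)", OF *]) (simp add: d_def algebra_simps)
  qed
  moreover have "norm d \<le> K1 z * (U y * M ?p) + (Bt * norm z * Ca) * (U y * M0 ?p)"
  proof -
    let ?E = "exp (- c * (norm z)\<^sup>2 / h)"
    have E: "norm (?e * ?uv) \<le> ?E * (U y * M ?p)" by (rule norm_integrand_exp[OF y z t])
    have UM: "0 \<le> U y * M ?p" by (simp add: weighted_abs_nonneg)
    have a: "norm ?a \<le> Ca" using alb[OF P(2,3)] by (simp add: twist_def)
    have pw: "norm w ^ N \<le> (2 * norm z) ^ N" if "w = s *\<^sub>R z" "\<bar>s\<bar> \<le> 2" for w s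
      using that by (intro power_mono) (auto simp: mult_right_mono)
    have q1: "norm (?q - ?x) ^ N \<le> (2 * norm z) ^ N"
      by (rule pw[of _ "-(2 - t)"]) (use t in \<open>auto simp: algebra_simps scaleR_2\<close>)
    have q2: "norm (?p - ?x) ^ N \<le> (2 * norm z) ^ N"
      by (rule pw[of _ "-(1 - t)"]) (use t in \<open>auto simp: algebra_simps\<close>)
    have q3: "norm (?q - y) ^ N \<le> (2 * norm z) ^ N"
      by (rule pw[of _ "-(1 - t)"]) (use t in \<open>auto simp: algebra_simps\<close>)
    have D: "norm (defect \<Psi> (a, vcnj b) z) \<le> CN * (2 * norm z) ^ N * norm z"
      if "a \<in> V" "b \<in> V" "norm (b - a) ^ N \<le> (2 * norm z) ^ N" for a b
      using Psid[OF that(1,2), of z] that(3) CN by (elim order_trans) (intro mult_right_mono mult_left_mono, auto)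
    have "norm ?Np \<le> norm (defect \<Psi> (?x, vcnj ?q) z) + norm (defect \<Psi> (?x, vcnj ?p) z) + norm (defect \<Psi> (y, vcnj ?q) z)"
      by (rule order_trans[OF norm_triangle_ineq4 add_right_mono[OF norm_triangle_ineq4]])
    then have Np: "norm ?Np \<le> 3 * (CN * (2 * norm z) ^ N * norm z)"
      using D[OF P(2,3) q1] D[OF P(2,4) q2] D[OF P(1,3) q3] by linarith
    have Na: "norm ?Na \<le> CN * (h ^ N + (2 * norm z) ^ N) * norm z"
      using ald[OF P(2,3), of z] q1 CN by (elim order_trans) (intro mult_right_mono mult_left_mono, auto)
    have "norm (2 / complex_of_real h * ?Np * ?a) = 2 / h * norm ?Np * norm ?a"
      unfolding norm_mult norm_divide using h by simp
    also have "\<dots> \<le> 2 / h * (3 * (CN * (2 * norm z) ^ N * norm z)) * Ca"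
      using Np a h CN by (intro mult_mono) auto
    finally have "norm (?Na + 2 / complex_of_real h * ?Np * ?a) \<le>
        CN * (h ^ N + (2 * norm z) ^ N) * norm z + 2 / h * (3 * (CN * (2 * norm z) ^ N * norm z)) * Ca"
      using Na by (rule norm_triangle_le[OF add_mono, rotated])
    then have "norm (complex_of_real (\<theta> y) * (?e * ?uv * (?Na + 2 / complex_of_real h * ?Np * ?a))) \<le> 1 * (?E * (U y * M ?p) *
        (CN * (h ^ N + (2 * norm z) ^ N) * norm z + 2 / h * (3 * (CN * (2 * norm z) ^ N * norm z)) * Ca))"
      unfolding norm_mult[of "complex_of_real (\<theta> y)"] norm_mult[of "?e * ?uv"]
      using theta(3,4)[of y] E UM by (intro mult_mono) auto
    also have "\<dots> = K1 z * (U y * M ?p)" by (simp add: K1_def)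
    finally have 1: "norm (complex_of_real (\<theta> y) * (?e * ?uv * (?Na + 2 / complex_of_real h * ?Np * ?a))) \<le> K1 z * (U y * M ?p)" .
    have 2: "norm (?dt * (?a * (?e * ?uv))) \<le> (Bt * norm z * Ca) * (U y * M0 ?p)"
    proof (cases "y \<in> ball x\<^sub>0 (3 * \<rho>)")
      case True
      then show ?thesis using theta(1,8) Ca by (simp add: weighted_abs_nonneg)
    next
      case False
      \<comment> \<open>Since y is at distance at least 3\<rho> and t z has length at most \<rho>/2,
        the argument of v stays outside radius 2\<rho>, where \<open>M\<close> and \<open>M0\<close>
        agree.\<close>
      have "norm (t *\<^sub>R z) \<le> 1 * (\<rho> / 2)" unfolding norm_scaleR using t z by (intro mult_mono) auto
      moreover have "dist x\<^sub>0 y \<le> dist x\<^sub>0 ?p + norm (t *\<^sub>R z)"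
        using dist_triangle[of x\<^sub>0 y ?p] by (simp add: dist_norm)
      ultimately have "?p \<notin> ball x\<^sub>0 (2 * \<rho>)" using False rho by simp
      then have M0: "M0 ?p = M ?p" by simp
      have "norm ?dt = norm (complex_of_real (frechet_derivative \<theta> (at y) z) + \<i> * complex_of_real (frechet_derivative \<theta> (at y) (\<i> *s z))) / 2"
        by (simp add: norm_divide)
      also have "\<dots> \<le> (norm (frechet_derivative \<theta> (at y) z) + norm (frechet_derivative \<theta> (at y) (\<i> *s z))) / 2"
        by (intro divide_right_mono order_trans[OF norm_triangle_ineq]) (auto simp: norm_mult)
      also have "\<dots> \<le> (Bt * norm z + Bt * norm z) / 2"
        using theta(7)[of y z] theta(7)[of y "\<i> *s z"] by (intro divide_right_mono add_mono) auto
      finally have dt: "norm ?dt \<le> Bt * norm z" by simp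
      have "?E \<le> 1" using c h by simp
      from mult_right_mono[OF this UM] E have E1: "norm (?e * ?uv) \<le> U y * M ?p" by linarith
      have "norm (?dt * (?a * (?e * ?uv))) \<le> (Bt * norm z) * (Ca * (U y * M ?p))"
        unfolding norm_mult[of ?dt] norm_mult[of ?a]
        using dt a E1 UM Ca theta(1) by (intro mult_mono) auto
      then show ?thesis unfolding M0 by (simp add: mult_ac)
    qed
    show ?thesis unfolding d_def by (rule norm_triangle_le[OF add_mono[OF 1 2]])
  qed
  ultimately show ?thesis by (rule that)
qed

lemmas U_measurable = weighted_abs_measurable[OF V(1) Phi h u]
lemmas M_measurable = weighted_abs_measurable[OF V(1) Phi h v]

lemma M0_square: "integrable lborel (\<lambda>y. (M0 y)\<^sup>2)"
proof (rule Bochner_Integration.integrable_bound[OF B(2)])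
  show "(\<lambda>y. (M0 y)\<^sup>2) \<in> borel_measurable lborel"
    using M_measurable by simp
  show "AE y in lborel. norm ((M0 y)\<^sup>2) \<le> norm ((M y)\<^sup>2)"
    by (intro AE_I2) (auto simp: indicator_def)
qed

text \<open>The shift does not change the L^2 norm of w, so the bound is the same for every t and z.
  This is the form in which the Cauchy-Schwarz inequality enters the homotopy.\<close>

lemma UM_translated:
  assumes w: "w \<in> borel_measurable borel" "integrable lborel (\<lambda>y. (w y)\<^sup>2)" "(\<integral>y. (w y)\<^sup>2 \<partial>lborel) \<le> D\<^sup>2" "D \<ge> 0"
  shows "integrable lborel (\<lambda>y. U y * w (y + s))" "(\<integral>y. U y * w (y + s) \<partial>lborel) \<le> A * D"
proof -
  have m: "(\<lambda>y. w (y + s)) \<in> borel_measurable borel"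
    by (rule measurable_compose[OF _ w(1)]) simp
  have i: "integrable lborel (\<lambda>y. (w (y + s))\<^sup>2)"
    using integrable_lborel_translation[OF w(2)] .
  have "(\<integral>y. (w (y + s))\<^sup>2 \<partial>lborel) = (\<integral>y. (w y)\<^sup>2 \<partial>lborel)"
    by (rule integral_lborel_translation) (use w(1) in simp)
  then have b: "(\<integral>y. (w (y + s))\<^sup>2 \<partial>lborel) \<le> D\<^sup>2" using w(3) by simp
  have mU: "U \<in> borel_measurable lborel" and mw: "(\<lambda>y. w (y + s)) \<in> borel_measurable lborel"
    using U_measurable m by simp_all
  show "integrable lborel (\<lambda>y. U y * w (y + s))" "(\<integral>y. U y * w (y + s) \<partial>lborel) \<le> A * D"
    using Cauchy_Schwarz_integral[OF mU mw A(2) i A(3) b A(1) w(4)] .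
qed

lemma homotopy_step:
  assumes z: "norm z \<le> \<rho> / 2"
  shows "norm ((\<integral>y. integrand z (1, y) \<partial>lborel) - (\<integral>y. integrand z (0, y) \<partial>lborel))
     \<le> K1 z * (A * B) + (Bt * norm z * Ca) * (A * B0)"
proof -
  obtain L where L: "L-lipschitz_on ({-1..2} \<times> cball x\<^sub>0 (5 * \<rho>)) (integrand z)"
    using integrand_lipschitz[OF z] .
  let ?g' = "\<lambda>t y. frechet_derivative (integrand z) (at (t, y))"
  let ?b = "\<lambda>t y. K1 z * (U y * M (y + t *\<^sub>R z)) + (Bt * norm z * Ca) * (U y * M0 (y + t *\<^sub>R z))"
  have mM0: "M0 \<in> borel_measurable borel" using M_measurable by simp
  note 1 = UM_translated[OF M_measurable B(2,3,1)]
  note 2 = UM_translated[OF mM0 M0_square B0(2,1)]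
  have K1: "K1 z \<ge> 0" and K2: "Bt * norm z * Ca \<ge> 0" using h c Ca CN theta(1) by (simp_all add: K1_def)
  show ?thesis
  proof (rule homotopy_integral_bound[OF L, where R = "4 * \<rho>" and g' = ?g' and b = ?b and z = z])
    show "4 * \<rho> < 5 * \<rho>" using rho by simp
    show "integrand z (t, y) = 0" if "y \<notin> cball x\<^sub>0 (4 * \<rho>)" for t y by (rule integrand_zero[OF that])
    fix t :: real assume t: "t \<in> {0..1}"
    show "(integrand z has_derivative ?g' t y) (at (t, y))" for y
      using integrand_lop[OF z t, of y] frechet_derivative_works unfolding has_lop_def by metis
    show "integrable lborel (?b t)" using 1(1)[of "t *\<^sub>R z"] 2(1)[of "t *\<^sub>R z"] by simp
    have "(\<integral>y. ?b t y \<partial>lborel) = K1 z * (\<integral>y. U y * M (y + t *\<^sub>R z) \<partial>lborel) + (Bt * norm z * Ca) * (\<integral>y. U y * M0 (y + t *\<^sub>R z) \<partial>lborel)"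
      using 1(1)[of "t *\<^sub>R z"] 2(1)[of "t *\<^sub>R z"] by simp
    also have "\<dots> \<le> K1 z * (A * B) + (Bt * norm z * Ca) * (A * B0)"
      by (intro add_mono mult_left_mono 1(2) 2(2) K1 K2)
    finally show "(\<integral>y. ?b t y \<partial>lborel) \<le> K1 z * (A * B) + (Bt * norm z * Ca) * (A * B0)" .
    fix y
    obtain d where d: "has_lop z (integrand z) d (t, y)" "norm d \<le> ?b t y" using integrand_lop[OF z t, of y] .
    show "norm (?g' t y (1, 0) - (?g' t y (0, z) + \<i> * ?g' t y (0, \<i> *s z)) / 2) \<le> ?b t y"
      using d unfolding has_lop_def lop_def by simp
  qed
qed

end

section \<open>The reduction of the sesquilinear form\<close>

lemma lborel_Fubini:
  fixes F :: "'a::euclidean_space \<times> 'b::euclidean_space \<Rightarrow> 'c::{banach, second_countable_topology}"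
  assumes "integrable lborel F"
  shows "(\<integral>x. \<integral>y. F (x, y) \<partial>lborel \<partial>lborel) = (\<integral>p. F p \<partial>lborel)"
    and "(\<integral>y. \<integral>x. F (x, y) \<partial>lborel \<partial>lborel) = (\<integral>p. F p \<partial>lborel)"
    and "integrable lborel (\<lambda>x. \<integral>y. F (x, y) \<partial>lborel)"
    and "integrable lborel (\<lambda>y. \<integral>x. F (x, y) \<partial>lborel)"
proof -
  have F: "integrable (lborel \<Otimes>\<^sub>M lborel) F"
    using assms by (simp add: lborel_prod)
  then have F': "integrable (lborel \<Otimes>\<^sub>M lborel) (\<lambda>(x, y). F (x, y))" by simp
  show 1: "(\<integral>x. \<integral>y. F (x, y) \<partial>lborel \<partial>lborel) = (\<integral>p. F p \<partial>lborel)"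
    using lborel_pair.integral_fst'[OF F] by (simp add: lborel_prod)
  show "(\<integral>y. \<integral>x. F (x, y) \<partial>lborel \<partial>lborel) = (\<integral>p. F p \<partial>lborel)"
    using lborel_pair.Fubini_integral[OF F'] 1 by simp
  show "integrable lborel (\<lambda>x. \<integral>y. F (x, y) \<partial>lborel)"
    by (rule lborel_pair.integrable_fst'[OF F])
  show "integrable lborel (\<lambda>y. \<integral>x. F (x, y) \<partial>lborel)"
    using lborel_pair.integrable_snd[OF F'] by simp
qed

lemma integrable_lborel_product:
  fixes f :: "'a::euclidean_space \<Rightarrow> real" and g :: "'b::euclidean_space \<Rightarrow> real"
  assumes "integrable lborel f" "integrable lborel g"
  shows "integrable lborel (\<lambda>p. f (fst p) * g (snd p))"
    and "(\<integral>p. f (fst p) * g (snd p) \<partial>lborel) = (\<integral>x. f x \<partial>lborel) * (\<integral>y. g y \<partial>lborel)"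
proof -
  have [measurable]: "f \<in> borel_measurable borel" "g \<in> borel_measurable borel"
    using assms[THEN borel_measurable_integrable] by simp_all
  have "integrable (lborel \<Otimes>\<^sub>M lborel) (\<lambda>p. f (fst p) * g (snd p))"
  proof (rule lborel_pair.Fubini_integrable)
    show "(\<lambda>p. f (fst p) * g (snd p)) \<in> borel_measurable (lborel \<Otimes>\<^sub>M lborel)" by measurable
    show "integrable lborel (\<lambda>x. \<integral>y. norm (f (fst (x, y)) * g (snd (x, y))) \<partial>lborel)"
      using assms by (simp add: abs_mult)
    show "AE x in lborel. integrable lborel (\<lambda>y. f (fst (x, y)) * g (snd (x, y)))"
      using assms by simp
  qed
  then show i: "integrable lborel (\<lambda>p. f (fst p) * g (snd p))" by (simp add: lborel_prod)
  show "(\<integral>p. f (fst p) * g (snd p) \<partial>lborel) = (\<integral>x. f x \<partial>lborel) * (\<integral>y. g y \<partial>lborel)"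
    using lborel_Fubini(1)[OF i] by simp
qed

lemma integrable_bounded_support:
  fixes F :: "'a::euclidean_space \<Rightarrow> complex"
  assumes "compact K" "continuous_on K F" "S \<subseteq> K" "S \<in> sets borel"
  shows "integrable lborel (\<lambda>p. indicator S p *\<^sub>R F p)"
proof -
  have "bounded (F ` K)" using assms by (intro compact_imp_bounded compact_continuous_image)
  then obtain C where C: "\<And>p. p \<in> K \<Longrightarrow> norm (F p) \<le> C" unfolding bounded_iff by blast
  have "bounded S" using assms compact_imp_bounded bounded_subset by blast
  then have f: "emeasure lborel S < \<infinity>" by (rule emeasure_bounded_finite)
  show ?thesis
  proof (rule Bochner_Integration.integrable_bound)
    show "integrable lborel (\<lambda>p. C * indicator S p :: real)"
      using f assms by (intro integrable_mult_right integrable_real_indicator) auto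
    show "(\<lambda>p. indicator S p *\<^sub>R F p) \<in> borel_measurable lborel"
      using assms by (simp add: borel_measurable_continuous_on_indicator continuous_on_subset)
    show "AE p in lborel. norm (indicator S p *\<^sub>R F p) \<le> norm (C * indicator S p :: real)"
      using C assms by (intro AE_I2) (auto simp: indicator_def intro: order_trans[OF _ abs_ge_self])
  qed
qed

section \<open>Cutting the kernel off near the diagonal\<close>

context bergman_homotopy
begin

abbreviation "vol \<equiv> measure lborel V"

text \<open>Cauchy-Schwarz against the indicator of the bounded set V. L^1 bounds are enough for
  errors that are already exponentially small pointwise.\<close>

lemma weighted_abs_integrable:
  assumes w: "w \<in> borel_measurable borel" "integrable lborel (\<lambda>y. (w y)\<^sup>2)" "(\<integral>y. (w y)\<^sup>2 \<partial>lborel) \<le> D\<^sup>2" "D \<ge> 0"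
    and supp: "\<And>y. y \<notin> V \<Longrightarrow> w y = 0"
  shows "integrable lborel w" "(\<integral>y. w y \<partial>lborel) \<le> sqrt vol * D"
proof -
  have fin: "emeasure lborel V < \<infinity>" using V(2) by (rule emeasure_bounded_finite)
  have sq: "(indicator V y :: real)\<^sup>2 = indicator V y" for y by (simp add: indicator_def)
  have i: "integrable lborel (\<lambda>y. (indicator V y :: real)\<^sup>2)"
    unfolding sq using fin V(1) by (intro integrable_real_indicator) auto
  have iv: "(\<integral>y. (indicator V y :: real)\<^sup>2 \<partial>lborel) \<le> (sqrt vol)\<^sup>2"
    unfolding sq by simp
  have e: "indicator V y * w y = w y" for y using supp[of y] by (auto simp: indicator_def)
  have m: "indicator V \<in> borel_measurable lborel" "w \<in> borel_measurable lborel" using V(1) w(1) by auto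
  show "integrable lborel w" "(\<integral>y. w y \<partial>lborel) \<le> sqrt vol * D"
    using Cauchy_Schwarz_integral[OF m i w(2) iv w(3) _ w(4)] by (simp_all add: e)
qed

lemma U_integral: "integrable lborel U" "(\<integral>y. U y \<partial>lborel) \<le> sqrt vol * A"
  by (rule weighted_abs_integrable[OF U_measurable A(2,3,1)]; simp add: weighted_abs_def)+

lemma M_integral: "integrable lborel M" "(\<integral>y. M y \<partial>lborel) \<le> sqrt vol * B"
  by (rule weighted_abs_integrable[OF M_measurable B(2,3,1)]; simp add: weighted_abs_def)+

lemma M0_measurable: "M0 \<in> borel_measurable borel"
  using M_measurable by simp

lemma M0_integral: "integrable lborel M0" "(\<integral>y. M0 y \<partial>lborel) \<le> sqrt vol * B0"
  by (rule weighted_abs_integrable[OF M0_measurable M0_square B0(2,1)]; simp add: weighted_abs_def)+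

lemma product_bound:
  fixes F :: "(complex^'n) \<times> (complex^'n) \<Rightarrow> complex"
  assumes F: "F \<in> borel_measurable borel" and a: "a \<ge> 0" "b \<ge> 0"
    and bd: "\<And>x y. norm (F (x, y)) \<le> a * (U y * M x) + b * (U y * M0 x)"
  shows "integrable lborel F" "norm (\<integral>p. F p \<partial>lborel) \<le> vol * A * (a * B + b * B0)"
proof -
  note 1 = integrable_lborel_product[OF M_integral(1) U_integral(1)]
  note 2 = integrable_lborel_product[OF M0_integral(1) U_integral(1)]
  let ?G = "\<lambda>p. a * (M (fst p) * U (snd p)) + b * (M0 (fst p) * U (snd p))"
  have G: "integrable lborel ?G"
    using 1(1) 2(1) by (intro Bochner_Integration.integrable_add integrable_mult_right)
  have bd': "norm (F p) \<le> ?G p" for p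
    using bd[of "fst p" "snd p"] by (simp add: mult_ac)
  show i: "integrable lborel F"
    by (rule Bochner_Integration.integrable_bound[OF G])
       (use F bd' in \<open>auto intro!: AE_I2 intro: order_trans[OF bd' abs_ge_self]\<close>)
  have nn: "(\<integral>y. U y \<partial>lborel) \<ge> 0" "(\<integral>y. M y \<partial>lborel) \<ge> 0" "(\<integral>y. M0 y \<partial>lborel) \<ge> 0"
    by (auto intro!: integral_nonneg_AE AE_I2 simp: weighted_abs_nonneg)
  have "norm (\<integral>p. F p \<partial>lborel) \<le> (\<integral>p. ?G p \<partial>lborel)"
    by (rule order_trans[OF integral_norm_bound integral_mono]) (use i G bd' in auto)
  also have "\<dots> = a * ((\<integral>y. M y \<partial>lborel) * (\<integral>y. U y \<partial>lborel)) + b * ((\<integral>y. M0 y \<partial>lborel) * (\<integral>y. U y \<partial>lborel))"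
    using 1 2 by simp
  also have "\<dots> \<le> a * ((sqrt vol * B) * (sqrt vol * A)) + b * ((sqrt vol * B0) * (sqrt vol * A))"
    using a A(1) B(1) B0(1) nn by (intro add_mono mult_left_mono mult_mono M_integral M0_integral U_integral) auto
  also have "\<dots> = vol * A * (a * B + b * B0)"
  proof -
    have "a * ((sqrt vol * B) * (sqrt vol * A)) + b * ((sqrt vol * B0) * (sqrt vol * A)) = (sqrt vol * sqrt vol) * A * (a * B + b * B0)"
      by (simp add: algebra_simps)
    then show ?thesis by simp
  qed
  finally show "norm (\<integral>p. F p \<partial>lborel) \<le> vol * A * (a * B + b * B0)" .
qed

text \<open>Pairs are (x, y), with u at y and v at x. The factor \<open>vol_const\<close> / h^n is
  left out and restored in \<open>weighted_inner_bergman_op\<close>.\<close>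

definition kern :: "(complex^'n) \<times> (complex^'n) \<Rightarrow> complex" where
  "kern p = indicator (V \<times> V) p *\<^sub>R (exp (2 / complex_of_real h * twist \<Psi> p) * twist al p * u (snd p) *
     complex_of_real (exp (- 2 * \<Phi> (snd p) / h)) * (cnj (v (fst p)) * complex_of_real (exp (- 2 * \<Phi> (fst p) / h))))"

lemma continuous_twist:
  assumes "smooth_on G f"
  shows "continuous_on (V \<times> V) (twist f)"
  unfolding twist_def[abs_def]
  by (rule continuous_on_compose2[OF smooth_on_continuous[OF assms, of "[]", simplified]])
     (auto intro!: continuous_intros VG continuous_on_compose2[OF continuous_on_vcnj[of UNIV]])

lemma kern_measurable: "kern \<in> borel_measurable borel"
  unfolding kern_def[abs_def]
proof (rule borel_measurable_continuous_on_indicator)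
  show "V \<times> V \<in> sets borel" using V(1) by (intro borel_open open_Times)
  have [continuous_intros]: "continuous_on (V \<times> V) (\<lambda>p. f (fst p))" "continuous_on (V \<times> V) (\<lambda>p. f (snd p))"
    if "continuous_on V f" for f :: "complex^'n \<Rightarrow> 'z::topological_space"
    by (rule continuous_on_compose2[OF that]; auto intro!: continuous_intros)+
  show "continuous_on (V \<times> V) (\<lambda>p. exp (2 / complex_of_real h * twist \<Psi> p) * twist al p * u (snd p) *
     complex_of_real (exp (- 2 * \<Phi> (snd p) / h)) * (cnj (v (fst p)) * complex_of_real (exp (- 2 * \<Phi> (fst p) / h))))"
    using h by (intro continuous_intros continuous_twist Psi al Phi hol_on_continuous[OF u] hol_on_continuous[OF v]) auto
qed

text \<open>Twice the real part of \<Psi>(x, cnj y) is \<Phi>(x) + \<Phi>(y) minus the diastasis. It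
  uses up half of each full weight and leaves a gaussian in x - y.\<close>

lemma norm_kern: "norm (kern (x, y)) \<le> Ca * exp (- c * (norm (x - y))\<^sup>2 / h) * (U y * M x)"
proof (cases "x \<in> V \<and> y \<in> V")
  case True
  have "2 * Re (\<Psi> (x, vcnj y)) / h = (- diastasis \<Phi> \<Psi> x y + \<Phi> x + \<Phi> y) / h"
    by (simp add: diastasis_def)
  also have "\<dots> \<le> (- c * (norm (x - y))\<^sup>2 + \<Phi> x + \<Phi> y) / h"
    using dia[of x y] True h by (intro divide_right_mono) auto
  finally have "exp (2 * Re (\<Psi> (x, vcnj y)) / h) \<le> exp ((- c * (norm (x - y))\<^sup>2 + \<Phi> x + \<Phi> y) / h)" by simp
  moreover have "Re (2 / complex_of_real h * \<Psi> (x, vcnj y)) = 2 * Re (\<Psi> (x, vcnj y)) / h"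
    by (simp add: Re_divide_of_real)
  ultimately have e: "norm (exp (2 / complex_of_real h * \<Psi> (x, vcnj y))) \<le> exp ((- c * (norm (x - y))\<^sup>2 + \<Phi> x + \<Phi> y) / h)"
    by (simp only: norm_exp_eq_Re)
  have "norm (kern (x, y)) = norm (exp (2 / complex_of_real h * \<Psi> (x, vcnj y))) * norm (al (x, vcnj y)) *
      (norm (u y) * norm (v x) * (exp (- 2 * \<Phi> y / h) * exp (- 2 * \<Phi> x / h)))"
    using True by (simp add: kern_def twist_def norm_mult)
  also have "\<dots> \<le> exp ((- c * (norm (x - y))\<^sup>2 + \<Phi> x + \<Phi> y) / h) * Ca *
      (norm (u y) * norm (v x) * (exp (- 2 * \<Phi> y / h) * exp (- 2 * \<Phi> x / h)))"
    using e alb[of x y] True by (intro mult_right_mono mult_mono) auto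
  also have "exp ((- c * (norm (x - y))\<^sup>2 + \<Phi> x + \<Phi> y) / h) * Ca *
      (norm (u y) * norm (v x) * (exp (- 2 * \<Phi> y / h) * exp (- 2 * \<Phi> x / h))) =
      Ca * (norm (u y) * norm (v x)) * (exp ((- c * (norm (x - y))\<^sup>2 + \<Phi> x + \<Phi> y) / h) * (exp (- 2 * \<Phi> y / h) * exp (- 2 * \<Phi> x / h)))"
    by (simp add: mult_ac)
  also have "exp ((- c * (norm (x - y))\<^sup>2 + \<Phi> x + \<Phi> y) / h) * (exp (- 2 * \<Phi> y / h) * exp (- 2 * \<Phi> x / h))
      = exp (- c * (norm (x - y))\<^sup>2 / h) * (exp (- \<Phi> y / h) * exp (- \<Phi> x / h))"
    by (simp add: add_divide_distrib diff_divide_distrib flip: exp_add)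
  finally show ?thesis using True by (simp add: weighted_abs_def mult_ac)
next
  case False
  then show ?thesis using Ca by (auto simp: kern_def weighted_abs_def)
qed

lemma norm_kern_le: "norm (kern (x, y)) \<le> Ca * (U y * M x)"
proof -
  have "exp (- c * (norm (x - y))\<^sup>2 / h) \<le> 1" using c h by simp
  then have "exp (- c * (norm (x - y))\<^sup>2 / h) * (Ca * (U y * M x)) \<le> 1 * (Ca * (U y * M x))"
    by (rule mult_right_mono) (simp add: Ca weighted_abs_nonneg)
  then show ?thesis using norm_kern[of x y] by (simp add: mult_ac)
qed

lemma kern_integrable: "integrable lborel kern"
  by (rule product_bound(1)[OF kern_measurable Ca order_refl]) (use norm_kern_le in simp)

definition kern1 :: "(complex^'n) \<times> (complex^'n) \<Rightarrow> complex" where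
  "kern1 p = complex_of_real (\<theta> (snd p)) * (indicator (ball 0 (\<rho> / 2)) (fst p - snd p) *\<^sub>R kern p)"

lemma theta_continuous: "continuous_on S \<theta>"
  using theta(2) by (intro continuous_at_imp_continuous_on) (auto intro: differentiable_imp_continuous_within)

lemma kern1_measurable: "kern1 \<in> borel_measurable borel"
proof -
  let ?S = "{p :: (complex^'n) \<times> (complex^'n). fst p - snd p \<in> ball 0 (\<rho> / 2)}"
  have "open ?S"
    unfolding mem_ball by (intro open_Collect_less continuous_intros)
  then have "?S \<in> sets borel" by (rule borel_open)
  then have "(\<lambda>p. indicator ?S p *\<^sub>R kern p) \<in> borel_measurable borel"
    using kern_measurable by simp
  moreover have "(\<lambda>p. complex_of_real (\<theta> (snd p :: complex^'n))) \<in> borel_measurable borel"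
    by (intro borel_measurable_continuous_onI continuous_intros continuous_on_compose2[OF theta_continuous[of UNIV]]) auto
  ultimately have "(\<lambda>p. complex_of_real (\<theta> (snd p)) * (indicator ?S p *\<^sub>R kern p)) \<in> borel_measurable borel"
    by (intro borel_measurable_times)
  moreover have "kern1 = (\<lambda>p. complex_of_real (\<theta> (snd p)) * (indicator ?S p *\<^sub>R kern p))"
    by (auto simp: kern1_def indicator_def)
  ultimately show ?thesis by simp
qed

text \<open>Off the strip |x - y| < \<rho>/2 the gaussian is at most its value at distance \<rho>/2.
  Inside the strip the two kernels differ only for y outside radius 3\<rho>; then x is outside
  radius 2\<rho> and the smallness of v takes over.\<close>

lemma kern_diff_bound:
  "norm (kern (x, y) - kern1 (x, y)) \<le> Ca * exp (- c * (\<rho> / 2)\<^sup>2 / h) * (U y * M x) + Ca * (U y * M0 x)"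
proof (cases "norm (x - y) < \<rho> / 2")
  case False
  then have "(\<rho> / 2)\<^sup>2 \<le> (norm (x - y))\<^sup>2" using rho by (intro power_mono) auto
  then have "- c * (norm (x - y))\<^sup>2 / h \<le> - c * (\<rho> / 2)\<^sup>2 / h"
    using c h by (intro divide_right_mono) auto
  then have "exp (- c * (norm (x - y))\<^sup>2 / h) * (Ca * (U y * M x)) \<le> exp (- c * (\<rho> / 2)\<^sup>2 / h) * (Ca * (U y * M x))"
    by (intro mult_right_mono) (auto simp: Ca weighted_abs_nonneg)
  moreover have "Ca * (U y * M0 x) \<ge> 0" by (simp add: Ca weighted_abs_nonneg)
  moreover have "kern1 (x, y) = 0" using False by (simp add: kern1_def)
  ultimately show ?thesis using norm_kern[of x y] by (simp add: mult_ac)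
next
  case True
  have e: "kern (x, y) - kern1 (x, y) = complex_of_real (1 - \<theta> y) * kern (x, y)"
    using True by (simp add: kern1_def algebra_simps)
  have nn: "0 \<le> Ca * exp (- c * (\<rho> / 2)\<^sup>2 / h) * (U y * M x)" "0 \<le> Ca * (U y * M0 x)"
    by (simp_all add: Ca weighted_abs_nonneg)
  show ?thesis
  proof (cases "y \<in> ball x\<^sub>0 (3 * \<rho>)")
    case True
    then show ?thesis unfolding e using theta(5) nn by simp
  next
    case False
    have "dist x\<^sub>0 y \<le> dist x\<^sub>0 x + norm (x - y)"
      using dist_triangle[of x\<^sub>0 y x] by (simp add: dist_norm)
    then have "x \<notin> ball x\<^sub>0 (2 * \<rho>)" using False True rho by simp
    then have M0: "M0 x = M x" by simp
    have "norm (complex_of_real (1 - \<theta> y)) \<le> 1" using theta(3,4)[of y] by (subst norm_of_real) simp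
    then have "norm (kern (x, y) - kern1 (x, y)) \<le> 1 * (Ca * (U y * M x))"
      unfolding e norm_mult by (intro mult_mono norm_kern_le) auto
    then show ?thesis using nn unfolding M0 by simp
  qed
qed

lemma kern_kern1:
  "norm ((\<integral>p. kern p \<partial>lborel) - (\<integral>p. kern1 p \<partial>lborel)) \<le> vol * A * (Ca * exp (- c * (\<rho> / 2)\<^sup>2 / h) * B + Ca * B0)"
  and kern1_integrable: "integrable lborel kern1"
proof -
  note 1 = product_bound[of "\<lambda>p. kern p - kern1 p" "Ca * exp (- c * (\<rho> / 2)\<^sup>2 / h)" Ca]
  have m: "(\<lambda>p. kern p - kern1 p) \<in> borel_measurable borel"
    using kern_measurable kern1_measurable by simp
  have i: "integrable lborel (\<lambda>p. kern p - kern1 p)"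
    by (rule 1(1)[OF m]) (use Ca kern_diff_bound in auto)
  show i1: "integrable lborel kern1"
    using Bochner_Integration.integrable_diff[OF kern_integrable i] by simp
  have "norm (\<integral>p. kern p - kern1 p \<partial>lborel) \<le> vol * A * (Ca * exp (- c * (\<rho> / 2)\<^sup>2 / h) * B + Ca * B0)"
    by (rule 1(2)[OF m]) (use Ca kern_diff_bound in auto)
  then show "norm ((\<integral>p. kern p \<partial>lborel) - (\<integral>p. kern1 p \<partial>lborel)) \<le> vol * A * (Ca * exp (- c * (\<rho> / 2)\<^sup>2 / h) * B + Ca * B0)"
    using kern_integrable i1 by simp
qed

text \<open>Pairs are \<open>(y, z)\<close>.\<close>

definition cut_integrand :: "real \<Rightarrow> (complex^'n) \<times> (complex^'n) \<Rightarrow> complex" where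
  "cut_integrand t p = indicator (ball 0 (\<rho> / 2)) (snd p) *\<^sub>R integrand (snd p) (t, fst p)"

lemma cut_integrand_integrable:
  assumes t: "t \<in> {0..1}"
  shows "integrable lborel (cut_integrand t)"
proof -
  let ?K = "cball x\<^sub>0 (5 * \<rho>) \<times> cball (0 :: complex^'n) (\<rho> / 2)"
  let ?S = "cball x\<^sub>0 (5 * \<rho>) \<times> ball (0 :: complex^'n) (\<rho> / 2)"
  have t': "t \<in> {-1..2}" using t by auto
  have P: "fst p \<in> V" "fst p + snd p \<in> V" "fst p - (1 - t) *\<^sub>R snd p \<in> V" "fst p + t *\<^sub>R snd p \<in> V" if "p \<in> ?K" for p
    using points_in_V[of "fst p" "snd p", OF _ _ t'] that by auto
  have tw: "continuous_on ?K (\<lambda>p. twist f (m p))"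
    if "smooth_on G f" "continuous_on ?K m" "\<And>p. p \<in> ?K \<Longrightarrow> m p \<in> V \<times> V" for f m
    by (rule continuous_on_compose2[OF continuous_twist[OF that(1)] that(2) image_subsetI[OF that(3)]])
  have w: "continuous_on ?K (\<lambda>p. w (m p))"
    if "continuous_on V w" "continuous_on ?K m" "\<And>p. p \<in> ?K \<Longrightarrow> m p \<in> V" for w :: "complex^'n \<Rightarrow> complex" and m
    by (rule continuous_on_compose2[OF that(1) that(2) image_subsetI[OF that(3)]])
  have th: "continuous_on ?K (\<lambda>p. \<theta> (fst p))"
    by (rule continuous_on_compose2[OF theta_continuous[of UNIV]]) (auto intro!: continuous_intros)
  have "continuous_on ?K (\<lambda>p. integrand (snd p) (t, fst p))"
    unfolding integrand_def hphase_def fst_conv snd_conv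
    using h by (intro continuous_intros tw w th Psi al hol_on_continuous[OF u] hol_on_continuous[OF v])
       (use P in \<open>auto intro!: continuous_intros\<close>)
  moreover have "compact ?K" by (intro compact_Times) auto
  moreover have "?S \<in> sets borel" by (intro borel_Times) auto
  ultimately have "integrable lborel (\<lambda>p. indicator ?S p *\<^sub>R integrand (snd p) (t, fst p))"
    by (intro integrable_bounded_support[of ?K]) auto
  \<comment> \<open>Restricting y to the ball of radius 5\<rho> changes nothing, since the cutoff
    already vanishes outside radius 4\<rho>; it only supplies a compact domain.\<close>
  moreover have "indicator ?S p *\<^sub>R integrand (snd p) (t, fst p) = cut_integrand t p" for p
  proof (cases "fst p \<in> cball x\<^sub>0 (5 * \<rho>)")
    case True
    then show ?thesis by (auto simp: cut_integrand_def indicator_def mem_Times_iff)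
  next
    case False
    then have "fst p \<notin> cball x\<^sub>0 (4 * \<rho>)" using rho by auto
    then show ?thesis using integrand_zero by (simp add: cut_integrand_def)
  qed
  ultimately show ?thesis by simp
qed

text \<open>With x = y + z and t = 1, the two subtracted terms of the polarized exponent are
  diagonal values of \<Psi>, that is \<Phi>(x) and \<Phi>(y), and they become the two weights of the
  kernel.\<close>

lemma kern1_shift: "kern1 (z + y, y) = cut_integrand 1 (y, z)"
proof (cases "z \<in> ball 0 (\<rho> / 2) \<and> y \<in> cball x\<^sub>0 (4 * \<rho>)")
  case True
  then have "y \<in> cball x\<^sub>0 (5 * \<rho>)" "norm z \<le> \<rho> / 2" using rho by auto
  note P = points_in_V[OF this, of 1, simplified]
  have k: "2 / complex_of_real h * hphase z (1, y) = 2 / complex_of_real h * twist \<Psi> (z + y, y)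
     + complex_of_real (- 2 * \<Phi> y / h) + complex_of_real (- 2 * \<Phi> (z + y) / h)"
    using diag[OF P(1)] diag[OF P(2)] by (simp add: hphase_def twist_def algebra_simps)
  have e: "exp (2 / complex_of_real h * hphase z (1, y)) = exp (2 / complex_of_real h * twist \<Psi> (z + y, y)) *
     complex_of_real (exp (- 2 * \<Phi> y / h)) * complex_of_real (exp (- 2 * \<Phi> (z + y) / h))"
    unfolding k exp_add exp_of_real ..
  show ?thesis
    unfolding cut_integrand_def integrand_def fst_conv snd_conv e kern1_def kern_def
    using True P by (simp add: add.commute mult_ac)
next
  case False
  then show ?thesis
    using theta(6)[of y] by (auto simp: kern1_def cut_integrand_def integrand_def)
qed

lemma integral_kern1: "(\<integral>p. kern1 p \<partial>lborel) = (\<integral>p. cut_integrand 1 p \<partial>lborel)"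
proof -
  have "(\<integral>x. kern1 (x, y) \<partial>lborel) = (\<integral>z. cut_integrand 1 (y, z) \<partial>lborel)" for y
  proof -
    have "(\<lambda>x. kern1 (x, y)) \<in> borel_measurable borel"
      by (rule measurable_compose[OF _ kern1_measurable]) simp
    from integral_lborel_translation[OF this, of y] show ?thesis
      by (simp add: kern1_shift)
  qed
  then show ?thesis
    using lborel_Fubini(2)[OF kern1_integrable] lborel_Fubini(1)[OF cut_integrand_integrable[of 1]] by simp
qed

text \<open>Fubini with z outermost: \<open>homotopy_step\<close> is uniform in z once
  \<open>K1\<close> is, and z ranges over a ball of finite measure.\<close>

lemma integral_cut_integrand_difference:
  assumes K: "\<And>z. norm z \<le> \<rho> / 2 \<Longrightarrow> K1 z \<le> Kb"
  shows "norm ((\<integral>p. cut_integrand 1 p \<partial>lborel) - (\<integral>p. cut_integrand 0 p \<partial>lborel))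
    \<le> measure lborel (ball (0 :: complex^'n) (\<rho> / 2)) * (Kb * (A * B) + Bt * \<rho> * Ca * (A * B0))"
proof -
  let ?Q = "Kb * (A * B) + Bt * \<rho> * Ca * (A * B0)"
  let ?D = "\<lambda>z. (\<integral>y. cut_integrand 1 (y, z) \<partial>lborel) - (\<integral>y. cut_integrand 0 (y, z) \<partial>lborel)"
  note 1 = lborel_Fubini[OF cut_integrand_integrable[of 1]] and 0 = lborel_Fubini[OF cut_integrand_integrable[of 0]]
  have b: "norm (?D z) \<le> indicator (ball 0 (\<rho> / 2)) z * ?Q" for z
  proof (cases "z \<in> ball 0 (\<rho> / 2)")
    case True
    then have z: "norm z \<le> \<rho> / 2" by simp
    have "norm (?D z) \<le> K1 z * (A * B) + (Bt * norm z * Ca) * (A * B0)"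
      using homotopy_step[OF z] True by (simp add: cut_integrand_def)
    also have "\<dots> \<le> ?Q"
      using K[OF z] z rho A(1) B(1) B0(1) theta(1) Ca
      by (intro add_mono mult_right_mono mult_left_mono) auto
    finally show ?thesis using True by simp
  qed (simp add: cut_integrand_def)
  have e: "(\<integral>p. cut_integrand 1 p \<partial>lborel) - (\<integral>p. cut_integrand 0 p \<partial>lborel) = (\<integral>z. ?D z \<partial>lborel)"
    using 1(2,4) 0(2,4) by simp
  have "norm (\<integral>z. ?D z \<partial>lborel) \<le> (\<integral>z. indicator (ball 0 (\<rho> / 2)) z * ?Q \<partial>(lborel :: (complex^'n) measure))"
  proof (rule order_trans[OF integral_norm_bound integral_mono])
    show "integrable lborel (\<lambda>z. norm (?D z))"
      using 1(4) 0(4) by simp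
    show "integrable lborel (\<lambda>z :: complex^'n. indicator (ball 0 (\<rho> / 2)) z * ?Q)"
      using emeasure_bounded_finite[OF bounded_ball, of "0 :: complex^'n" "\<rho> / 2"]
      by (intro integrable_mult_left integrable_real_indicator) auto
  qed (rule b)
  also have "\<dots> = measure lborel (ball (0 :: complex^'n) (\<rho> / 2)) * ?Q"
    by simp
  finally show ?thesis unfolding e .
qed

section \<open>The end t = 0 of the homotopy\<close>

definition uv :: "complex^'n \<Rightarrow> complex" where
  "uv y = indicator V y *\<^sub>R (u y * cnj (v y) * complex_of_real (exp (- 2 * \<Phi> y / h)))"

lemma norm_uv: "norm (uv y) = U y * M y"
proof -
  have "exp (- 2 * \<Phi> y / h) = exp (- \<Phi> y / h) * exp (- \<Phi> y / h)"
    by (simp flip: exp_add)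
  then show ?thesis
    by (simp add: uv_def weighted_abs_def norm_mult mult_ac indicator_def)
qed

lemma uv_measurable: "uv \<in> borel_measurable borel"
  unfolding uv_def[abs_def] using V(1) h
  by (intro borel_measurable_continuous_on_indicator continuous_intros Phi hol_on_continuous[OF u] hol_on_continuous[OF v]) auto

lemma UM_integral: "integrable lborel (\<lambda>y. U y * M y)" "(\<integral>y. U y * M y \<partial>lborel) \<le> A * B"
  using UM_translated[OF M_measurable B(2,3,1), of 0] by simp_all

lemma UM0_integral: "integrable lborel (\<lambda>y. U y * M0 y)" "(\<integral>y. U y * M0 y \<partial>lborel) \<le> A * B0"
  using UM_translated[OF M0_measurable M0_square B0(2,1), of 0] by simp_all

lemma uv_integrable: "integrable lborel uv"
  by (rule Bochner_Integration.integrable_bound[OF UM_integral(1)])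
     (use uv_measurable norm_uv in \<open>auto intro!: AE_I2\<close>)

lemma theta_uv_integrable: "integrable lborel (\<lambda>y. complex_of_real (\<theta> y) * uv y)"
proof (rule Bochner_Integration.integrable_bound[OF uv_integrable])
  have [measurable]: "\<theta> \<in> borel_measurable borel" "uv \<in> borel_measurable borel"
    using theta_continuous uv_measurable by (auto intro: borel_measurable_continuous_onI)
  show "(\<lambda>y. complex_of_real (\<theta> y) * uv y) \<in> borel_measurable lborel" by measurable
  show "AE y in lborel. norm (complex_of_real (\<theta> y) * uv y) \<le> norm (uv y)"
    using theta(3,4) by (intro AE_I2) (auto simp: norm_mult intro!: mult_left_le_one_le)
qed

text \<open>Removing the cutoff costs only the region beyond radius 3\<rho>, where v is
  small.\<close>

lemma theta_uv:
  "norm ((\<integral>y. complex_of_real (\<theta> y) * uv y \<partial>lborel) - (\<integral>y. uv y \<partial>lborel)) \<le> A * B0"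
proof -
  have "norm (complex_of_real (\<theta> y) * uv y - uv y) \<le> U y * M0 y" for y
  proof (cases "y \<in> ball x\<^sub>0 (3 * \<rho>)")
    case True
    then show ?thesis using theta(5) by (simp add: weighted_abs_nonneg)
  next
    case False
    then have M0: "M0 y = M y" using rho by simp
    have "complex_of_real (\<theta> y) * uv y - uv y = complex_of_real (\<theta> y - 1) * uv y" by (simp add: algebra_simps)
    also have "norm \<dots> \<le> 1 * norm (uv y)"
      unfolding norm_mult using theta(3,4)[of y] by (intro mult_right_mono) (simp_all only: norm_of_real, auto)
    finally show ?thesis unfolding M0 norm_uv by simp
  qed
  then have "norm (\<integral>y. complex_of_real (\<theta> y) * uv y - uv y \<partial>lborel) \<le> (\<integral>y. U y * M0 y \<partial>lborel)"
    using theta_uv_integrable uv_integrable UM0_integral(1)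
    by (intro order_trans[OF integral_norm_bound integral_mono]) auto
  then show ?thesis using theta_uv_integrable uv_integrable UM0_integral(2) by simp
qed

text \<open>The contour integral from the amplitude equation, without its prefactor and cut to
  radius \<rho>/2 instead of the radius that comes with the amplitude;
  \<open>contour_truncation\<close> compares the two.\<close>

definition contour :: "complex^'n \<Rightarrow> complex" where
  "contour y = (\<integral>z. indicator (ball 0 (\<rho> / 2)) z *\<^sub>R (exp (2 / complex_of_real h * phase \<Psi> y (vcnj y) (y + z) (vcnj y - vcnj z)) *
     al (y + z, vcnj y - vcnj z)) \<partial>lborel)"

text \<open>At t = 0 both u and v sit at y and leave the z-integral. The polarized exponent has
  three of the four terms of \<open>phase\<close>; the missing one is \<Psi>(y, cnj y) = \<Phi>(y),
  which accounts for the weight in \<open>uv\<close>.\<close>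

lemma cut_integrand0: "(\<integral>z. cut_integrand 0 (y, z) \<partial>lborel) = complex_of_real (\<theta> y) * uv y * contour y"
proof (cases "y \<in> cball x\<^sub>0 (4 * \<rho>)")
  case True
  then have y: "y \<in> V" using cball_V[of "4 * \<rho>"] rho by auto
  have e: "integrand z (0, y) = complex_of_real (\<theta> y) * uv y * (exp (2 / complex_of_real h * phase \<Psi> y (vcnj y) (y + z) (vcnj y - vcnj z)) *
     al (y + z, vcnj y - vcnj z))" for z
  proof -
    have k: "2 / complex_of_real h * hphase z (0, y) = 2 / complex_of_real h * phase \<Psi> y (vcnj y) (y + z) (vcnj y - vcnj z)
       + complex_of_real (- 2 * \<Phi> y / h)"
      using diag[OF y] by (simp add: hphase_def twist_def phase_def vcnj_diff algebra_simps)
    have "exp (2 / complex_of_real h * hphase z (0, y)) = exp (2 / complex_of_real h * phase \<Psi> y (vcnj y) (y + z) (vcnj y - vcnj z))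
       * complex_of_real (exp (- 2 * \<Phi> y / h))"
      unfolding k exp_add exp_of_real ..
    then show ?thesis
      using y by (simp add: integrand_def uv_def twist_def vcnj_diff mult_ac)
  qed
  have "cut_integrand 0 (y, z) = complex_of_real (\<theta> y) * uv y * (indicator (ball 0 (\<rho> / 2)) z *\<^sub>R (exp (2 / complex_of_real h * phase \<Psi> y (vcnj y) (y + z) (vcnj y - vcnj z)) *
     al (y + z, vcnj y - vcnj z)))" for z
    by (simp add: cut_integrand_def e)
  then show ?thesis unfolding contour_def by (simp only: integral_mult_right_zero)
next
  case False
  then show ?thesis using theta(6)[of y] by (simp add: cut_integrand_def integrand_def)
qed

lemma integral_cut_integrand0:
  assumes E: "\<And>y. y \<in> cball x\<^sub>0 (4 * \<rho>) \<Longrightarrow> norm (\<omega> * contour y - 1) \<le> E"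
  shows "norm (\<omega> * (\<integral>p. cut_integrand 0 p \<partial>lborel) - (\<integral>y. complex_of_real (\<theta> y) * uv y \<partial>lborel)) \<le> E * (A * B)"
proof -
  note F = lborel_Fubini[OF cut_integrand_integrable[of 0]]
  have i: "integrable lborel (\<lambda>y. complex_of_real (\<theta> y) * uv y * contour y)"
    using F(3) by (simp add: cut_integrand0)
  have "E \<ge> 0" using E[of x\<^sub>0] rho by (auto intro: order_trans[OF norm_ge_zero])
  have b: "norm (\<omega> * (complex_of_real (\<theta> y) * uv y * contour y) - complex_of_real (\<theta> y) * uv y) \<le> E * (U y * M y)" for y
  proof (cases "y \<in> cball x\<^sub>0 (4 * \<rho>)")
    case True
    have "\<omega> * (complex_of_real (\<theta> y) * uv y * contour y) - complex_of_real (\<theta> y) * uv y = (\<omega> * contour y - 1) * (complex_of_real (\<theta> y) * uv y)"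
      by (simp add: algebra_simps)
    also have "norm \<dots> \<le> E * (1 * (U y * M y))"
      unfolding norm_mult norm_uv[symmetric] using E[OF True] theta(3,4)[of y] \<open>E \<ge> 0\<close>
      by (intro mult_mono) auto
    finally show ?thesis by simp
  next
    case False
    then show ?thesis using theta(6)[of y] \<open>E \<ge> 0\<close> by (simp add: weighted_abs_nonneg)
  qed
  have "(\<integral>p. cut_integrand 0 p \<partial>lborel) = (\<integral>y. complex_of_real (\<theta> y) * uv y * contour y \<partial>lborel)"
    using F(1) by (simp add: cut_integrand0)
  then have "\<omega> * (\<integral>p. cut_integrand 0 p \<partial>lborel) - (\<integral>y. complex_of_real (\<theta> y) * uv y \<partial>lborel)
    = (\<integral>y. \<omega> * (complex_of_real (\<theta> y) * uv y * contour y) - complex_of_real (\<theta> y) * uv y \<partial>lborel)"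
    using i theta_uv_integrable by simp
  also have "norm \<dots> \<le> (\<integral>y. E * (U y * M y) \<partial>lborel)"
    using i theta_uv_integrable UM_integral(1) b by (intro order_trans[OF integral_norm_bound integral_mono]) auto
  also have "\<dots> \<le> E * (A * B)"
    using UM_integral \<open>E \<ge> 0\<close> by (simp add: mult_left_mono)
  finally show ?thesis .
qed

text \<open>A telescoping sum: localize the kernel, run the homotopy, evaluate the contour integral,
  remove the cutoff. Only the first two errors are multiplied by the prefactor \<omega>, which is of
  size h^(-n).\<close>

lemma kern_estimate:
  assumes E: "\<And>y. y \<in> cball x\<^sub>0 (4 * \<rho>) \<Longrightarrow> norm (\<omega> * contour y - 1) \<le> E"
    and K: "\<And>z. norm z \<le> \<rho> / 2 \<Longrightarrow> K1 z \<le> Kb"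
  shows "norm (\<omega> * (\<integral>x. \<integral>y. kern (x, y) \<partial>lborel \<partial>lborel) - (\<integral>y. uv y \<partial>lborel))
    \<le> norm \<omega> * (vol * A * (Ca * exp (- c * (\<rho> / 2)\<^sup>2 / h) * B + Ca * B0)
        + measure lborel (ball (0 :: complex^'n) (\<rho> / 2)) * (Kb * (A * B) + Bt * \<rho> * Ca * (A * B0)))
      + E * (A * B) + A * B0"
proof -
  let ?T = "\<integral>p. kern p \<partial>lborel" and ?I1 = "\<integral>p. cut_integrand 1 p \<partial>lborel" and ?I0 = "\<integral>p. cut_integrand 0 p \<partial>lborel"
  let ?t = "\<integral>y. complex_of_real (\<theta> y) * uv y \<partial>lborel" and ?u = "\<integral>y. uv y \<partial>lborel"
  let ?X = "\<omega> * ((?T - ?I1) + (?I1 - ?I0)) + (\<omega> * ?I0 - ?t) + (?t - ?u)"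
  have X: "\<omega> * ?T - ?u = ?X"
    by (simp add: algebra_simps)
  have "norm ?X \<le> norm \<omega> * (norm (?T - ?I1) + norm (?I1 - ?I0)) + norm (\<omega> * ?I0 - ?t) + norm (?t - ?u)"
    by (intro norm_triangle_le add_mono order_refl)
       (unfold norm_mult, intro mult_left_mono norm_triangle_ineq norm_ge_zero)
  also have "\<dots> \<le> norm \<omega> * (vol * A * (Ca * exp (- c * (\<rho> / 2)\<^sup>2 / h) * B + Ca * B0)
        + measure lborel (ball (0 :: complex^'n) (\<rho> / 2)) * (Kb * (A * B) + Bt * \<rho> * Ca * (A * B0)))
      + E * (A * B) + A * B0"
    using kern_kern1 integral_cut_integrand_difference[OF K] integral_cut_integrand0[OF E] theta_uv
    by (intro add_mono mult_left_mono) (auto simp: integral_kern1)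
  finally show ?thesis unfolding lborel_Fubini(1)[OF kern_integrable] X .
qed

end

section \<open>Remainder estimates\<close>

lemma exp_neg_le_power:
  fixes x :: real
  assumes "x > 0"
  shows "exp (- x) \<le> fact m / x ^ m"
proof -
  have "(\<Sum>n\<in>{m}. x ^ n /\<^sub>R fact n) \<le> (\<Sum>n. x ^ n /\<^sub>R fact n)"
    by (rule sum_le_suminf[OF summable_exp_generic]) (use assms in auto)
  then have "x ^ m / fact m \<le> exp x"
    by (simp add: exp_def divide_inverse mult.commute)
  then show ?thesis
    using assms by (simp add: exp_minus field_simps)
qed

lemma exp_neg_div_le_power:
  fixes k h :: real
  assumes "k > 0" "h > 0"
  shows "exp (- k / h) \<le> fact m / k ^ m * h ^ m"
  using exp_neg_le_power[of "k / h" m] assms by (simp add: power_divide)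

text \<open>Each power of s^2 is worth one power of h, because x^m exp(- x) is bounded by m! with x
  = c s^2 / h. The 4^m stems from the factor 2 in front of s.\<close>

lemma power_times_gaussian_le:
  fixes c h s :: real
  assumes "c > 0" "h > 0" "s \<ge> 0"
  shows "exp (- c * s\<^sup>2 / h) * (2 * s) ^ (2 * m) \<le> (if m = 0 then 1 else 4 ^ m * fact m / c ^ m) * h ^ m"
proof (cases "s = 0 \<or> m = 0")
  case True
  then show ?thesis using assms by (auto simp: power_0_left)
next
  case False
  then have s: "s > 0" and m: "m \<noteq> 0" using assms by auto
  have pw: "(2 * s) ^ (2 * m) = 4 ^ m * (s\<^sup>2) ^ m"
    by (simp add: power_mult power_mult_distrib)
  have "exp (- c * s\<^sup>2 / h) \<le> fact m / (c * s\<^sup>2) ^ m * h ^ m"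
    using exp_neg_div_le_power[of "c * s\<^sup>2" h m] assms s by simp
  then have "exp (- c * s\<^sup>2 / h) * (4 ^ m * (s\<^sup>2) ^ m) \<le> (fact m / (c * s\<^sup>2) ^ m * h ^ m) * (4 ^ m * (s\<^sup>2) ^ m)"
    by (rule mult_right_mono) simp
  also have "(fact m / (c * s\<^sup>2) ^ m * h ^ m) * (4 ^ m * (s\<^sup>2) ^ m) = 4 ^ m * fact m / c ^ m * h ^ m"
    using s by (simp add: power_mult_distrib)
  finally show ?thesis using m unfolding pw by simp
qed

text \<open>The squared distance minus \<rho>^2 is a defining function whose only critical point is
  the center, so the complement of the center serves as neighborhood of every boundary
  point.\<close>

lemma smooth_boundary_ball:
  fixes x\<^sub>0 :: "'a::euclidean_space"
  assumes "\<rho> > 0"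
  shows "smooth_boundary (ball x\<^sub>0 \<rho>)"
proof -
  define g where "g x = (x - x\<^sub>0) \<bullet> (x - x\<^sub>0) - \<rho>\<^sup>2" for x
  have gd: "(g has_derivative (\<lambda>w. 2 * (w \<bullet> (x - x\<^sub>0)))) (at x)" for x
    unfolding g_def[abs_def] by (auto intro!: derivative_eq_intros simp: inner_commute)
  then have fg: "frechet_derivative g (at x) = (\<lambda>w. 2 * (w \<bullet> (x - x\<^sub>0)))" for x
    using frechet_derivative_at[symmetric] by blast
  have ad: "((\<lambda>x. b \<bullet> x + c) has_derivative (\<lambda>w. b \<bullet> w)) (at x)" for b x :: 'a and c :: real
    by (auto intro!: derivative_eq_intros)
  \<comment> \<open>A derivative of the quadratic function is affine and every further one stays
    affine, so these two shapes cover all iterated derivatives.\<close>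
  have "iter_deriv vs g = g \<or> (\<exists>b c. iter_deriv vs g = (\<lambda>x. b \<bullet> x + c))" for vs
  proof (induction vs)
    case (Cons v vs)
    then show ?case
    proof (elim disjE exE)
      assume "iter_deriv vs g = g"
      then have "iter_deriv (v # vs) g = (\<lambda>x. (2 *\<^sub>R v) \<bullet> x + (- 2 * (v \<bullet> x\<^sub>0)))"
        by (simp add: fg inner_diff_right)
      then show ?thesis by blast
    next
      fix b c assume "iter_deriv vs g = (\<lambda>x. b \<bullet> x + c)"
      then have "iter_deriv (v # vs) g = (\<lambda>x. 0 \<bullet> x + b \<bullet> v)"
        by (simp add: frechet_derivative_at[OF ad, symmetric])
      then show ?thesis by blast
    qed
  qed simp
  then have "iter_deriv vs g differentiable (at x)" for vs x
    using gd ad unfolding differentiable_def by (smt (verit, best))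
  then have sm: "smooth_on S g" for S by (simp add: smooth_on_def)
  show ?thesis
    unfolding smooth_boundary_def
  proof
    fix p assume "p \<in> frontier (ball x\<^sub>0 \<rho>)"
    then have p: "dist x\<^sub>0 p = \<rho>" using assms by (simp add: frontier_ball)
    have iff: "dist x\<^sub>0 x < \<rho> \<longleftrightarrow> g x < 0" for x
    proof -
      have "dist x\<^sub>0 x < \<rho> \<longleftrightarrow> (dist x\<^sub>0 x)\<^sup>2 < \<rho>\<^sup>2"
        using assms by (simp add: power_mono_iff flip: not_le)
      moreover have "(x - x\<^sub>0) \<bullet> (x - x\<^sub>0) = (dist x\<^sub>0 x)\<^sup>2"
        by (metis dist_commute dist_norm power2_norm_eq_inner)
      ultimately show ?thesis by (simp add: g_def)
    qed
    show "\<exists>U g. open U \<and> p \<in> U \<and> smooth_on U g \<and> (\<forall>x\<in>U. frechet_derivative g (at x) \<noteq> (\<lambda>_. 0)) \<and>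
        ball x\<^sub>0 \<rho> \<inter> U = {x \<in> U. g x < (0::real)}"
    proof (intro exI[of _ "- {x\<^sub>0}"] exI[of _ g] conjI ballI)
      show "p \<in> - {x\<^sub>0}" using p assms by auto
      show "frechet_derivative g (at x) \<noteq> (\<lambda>_. 0)" if "x \<in> - {x\<^sub>0}" for x
      proof
        assume "frechet_derivative g (at x) = (\<lambda>_. 0)"
        from fun_cong[OF this, of "x - x\<^sub>0"] show False using that by (simp add: fg)
      qed
      show "ball x\<^sub>0 \<rho> \<inter> - {x\<^sub>0} = {x \<in> - {x\<^sub>0}. g x < 0}" unfolding set_eq_iff by (simp add: iff conj_commute)
    qed (auto simp: sm)
  qed
qed

lemma set_integral_lebesgue_lborel:
  fixes f :: "'a::euclidean_space \<Rightarrow> 'b::{banach, second_countable_topology}"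
  assumes "(\<lambda>x. indicator S x *\<^sub>R f x) \<in> borel_measurable borel"
  shows "(LINT x:S|lebesgue. f x) = (\<integral>x. indicator S x *\<^sub>R f x \<partial>lborel)"
  unfolding set_lebesgue_integral_def by (rule integral_completion) (use assms in simp)

lemma weighted_norm_lborel:
  fixes w :: "complex^'n \<Rightarrow> complex"
  assumes V: "open V" "continuous_on V \<Phi>" and h: "h > 0" and w: "w \<in> weighted_hol h \<Phi> V"
  shows "integrable lborel (\<lambda>y. (weighted_abs h \<Phi> V w y)\<^sup>2)"
    and "(\<integral>y. (weighted_abs h \<Phi> V w y)\<^sup>2 \<partial>lborel) = (weighted_norm h \<Phi> V w)\<^sup>2"
proof -
  let ?f = "\<lambda>y. (norm (w y))\<^sup>2 * exp (- 2 * \<Phi> y / h)"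
  have e: "(weighted_abs h \<Phi> V w y)\<^sup>2 = indicator V y *\<^sub>R ?f y" for y
  proof -
    have "(exp (- \<Phi> y / h))\<^sup>2 = exp (- 2 * \<Phi> y / h)"
      by (simp add: power2_eq_square flip: exp_add)
    then show ?thesis by (simp add: weighted_abs_def power_mult_distrib indicator_def)
  qed
  have hol: "hol_on V w" and i: "set_integrable lebesgue V ?f"
    using w by (auto simp: weighted_hol_def weighted_L2_def)
  have m: "(\<lambda>y. indicator V y *\<^sub>R ?f y) \<in> borel_measurable borel"
    using V h by (intro borel_measurable_continuous_on_indicator continuous_intros hol_on_continuous[OF hol]) auto
  show "integrable lborel (\<lambda>y. (weighted_abs h \<Phi> V w y)\<^sup>2)"
    unfolding e using i m by (simp add: set_integrable_def integrable_completion)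
  have "(LINT y:V|lebesgue. ?f y) = (\<integral>y. (weighted_abs h \<Phi> V w y)\<^sup>2 \<partial>lborel)"
    unfolding e by (rule set_integral_lebesgue_lborel[OF m])
  moreover have "(\<integral>y. (weighted_abs h \<Phi> V w y)\<^sup>2 \<partial>lborel) \<ge> 0"
    by (intro integral_nonneg_AE AE_I2) simp
  ultimately show "(\<integral>y. (weighted_abs h \<Phi> V w y)\<^sup>2 \<partial>lborel) = (weighted_norm h \<Phi> V w)\<^sup>2"
    by (simp add: weighted_norm_def)
qed

context bergman_homotopy
begin

lemma weighted_inner_uv: "weighted_inner h \<Phi> V u v = (\<integral>y. uv y \<partial>lborel)"
  unfolding weighted_inner_def uv_def
  by (rule set_integral_lebesgue_lborel) (use uv_measurable in \<open>simp add: uv_def[abs_def]\<close>)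

lemma weighted_inner_bergman_op:
  assumes "a h = al"
  shows "weighted_inner h \<Phi> V (bergman_op h \<Phi> \<Psi> a V u) v =
    vol_const TYPE('n) / complex_of_real h ^ CARD('n) * (\<integral>x. \<integral>y. kern (x, y) \<partial>lborel \<partial>lborel)"
proof -
  let ?w = "vol_const TYPE('n) / complex_of_real h ^ CARD('n)"
  have e: "indicator V x *\<^sub>R (bergman_op h \<Phi> \<Psi> a V u x * cnj (v x) * complex_of_real (exp (- 2 * \<Phi> x / h)))
     = ?w * (\<integral>y. kern (x, y) \<partial>lborel)" for x
  proof (cases "x \<in> V")
    case True
    let ?f = "\<lambda>y. exp (2 / complex_of_real h * \<Psi> (x, vcnj y)) * a h (x, vcnj y) * u y * complex_of_real (exp (- 2 * \<Phi> y / h))"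
    let ?k = "cnj (v x) * complex_of_real (exp (- 2 * \<Phi> x / h))"
    have tw: "continuous_on V (\<lambda>y. f (x, vcnj y))" if "smooth_on G f" for f :: "_ \<Rightarrow> complex"
      by (rule continuous_on_compose2[OF smooth_on_continuous[OF that, of "[]", simplified]])
         (use True in \<open>auto intro!: continuous_intros continuous_on_vcnj VG\<close>)
    have m: "(\<lambda>y. indicator V y *\<^sub>R ?f y) \<in> borel_measurable borel"
      unfolding assms using V(1) h
      by (intro borel_measurable_continuous_on_indicator continuous_intros tw Psi al Phi hol_on_continuous[OF u]) auto
    have "kern (x, y) = (indicator V y *\<^sub>R ?f y) * ?k" for y
      using True by (auto simp: kern_def twist_def assms indicator_def)
    then have "(\<integral>y. kern (x, y) \<partial>lborel) = (\<integral>y. indicator V y *\<^sub>R ?f y \<partial>lborel) * ?k"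
      by (simp only: integral_mult_left_zero)
    then show ?thesis
      unfolding bergman_op_def set_integral_lebesgue_lborel[OF m] using True by (simp add: mult_ac)
  next
    case False
    then show ?thesis by (simp add: kern_def)
  qed
  have m: "(\<lambda>x. \<integral>y. kern (x, y) \<partial>lborel) \<in> borel_measurable borel"
    using borel_measurable_integrable[OF lborel_Fubini(3)[OF kern_integrable]] by simp
  show ?thesis
    unfolding weighted_inner_def
    by (subst set_integral_lebesgue_lborel) (use m in \<open>simp_all only: e integral_mult_right_zero borel_measurable_times borel_measurable_const\<close>)
qed

text \<open>Flatness of order 2(m + 1) against the gaussian yields h^(m + 1); one of these powers
  compensates the 1/h from the derivative of the exponential, and h^m remains.\<close>

lemma K1_bound:
  assumes N: "N = 2 * Suc m" and h1: "h < 1" and z: "norm z \<le> \<rho> / 2"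
  defines "S \<equiv> 4 ^ Suc m * fact (Suc m) / c ^ Suc m"
  shows "K1 z \<le> \<rho> * CN * (1 + S + 6 * S * Ca) * h ^ m"
proof -
  let ?s = "norm z" and ?e = "exp (- c * (norm z)\<^sup>2 / h)"
  have s: "?s \<le> \<rho>" "?s \<ge> 0" using z rho norm_ge_zero[of z] by linarith+
  have S: "S \<ge> 0" using c by (simp add: S_def)
  have g: "?e * (2 * ?s) ^ N \<le> S * h ^ Suc m"
    using power_times_gaussian_le[OF c h, of ?s "Suc m"] unfolding N S_def by simp
  have e1: "?e \<le> 1" using c h by simp
  have hN: "h ^ N \<le> h ^ m" using h h1 unfolding N by (intro power_decreasing) auto
  have hm: "h ^ Suc m \<le> h ^ m" using h h1 by (intro power_decreasing) auto
  have "?e * h ^ N \<le> 1 * h ^ m" using e1 hN h by (intro mult_mono) auto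
  moreover have "S * h ^ Suc m \<le> S * h ^ m" using S hm by (rule mult_left_mono[rotated])
  ultimately have 1: "?e * (h ^ N + (2 * ?s) ^ N) \<le> (1 + S) * h ^ m"
    using g by (simp add: algebra_simps)
  have "?e * (2 * ?s) ^ N / h \<le> S * h ^ Suc m / h" using g h by (intro divide_right_mono) auto
  then have 2: "?e * (2 * ?s) ^ N / h \<le> S * h ^ m" using h by simp
  have "K1 z = (?s * CN) * (?e * (h ^ N + (2 * ?s) ^ N)) + (6 * Ca * (?s * CN)) * (?e * (2 * ?s) ^ N / h)"
    using h by (simp add: K1_def field_simps)
  also have "\<dots> \<le> (\<rho> * CN) * ((1 + S) * h ^ m) + (6 * Ca * (\<rho> * CN)) * (S * h ^ m)"
  proof (rule add_mono)
    have sc: "?s * CN \<le> \<rho> * CN" "0 \<le> \<rho> * CN" using s CN rho by (auto intro: mult_right_mono)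
    then have sc': "6 * Ca * (?s * CN) \<le> 6 * Ca * (\<rho> * CN)" "0 \<le> 6 * Ca * (\<rho> * CN)"
      using Ca by (auto intro!: mult_left_mono)
    show "(?s * CN) * (?e * (h ^ N + (2 * ?s) ^ N)) \<le> (\<rho> * CN) * ((1 + S) * h ^ m)"
      by (rule mult_mono[OF sc(1) 1 sc(2)]) (use h in simp)
    show "(6 * Ca * (?s * CN)) * (?e * (2 * ?s) ^ N / h) \<le> (6 * Ca * (\<rho> * CN)) * (S * h ^ m)"
      by (rule mult_mono[OF sc'(1) 2 sc'(2)]) (use h in simp)
  qed
  also have "\<dots> = \<rho> * CN * (1 + S + 6 * S * Ca) * h ^ m" by (simp add: algebra_simps)
  finally show ?thesis .
qed

end

text \<open>The two integrals differ over \<eta> \<le> |z| < r only, where goodness of the contour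
  makes the integrand exponentially small.\<close>

lemma contour_truncation:
  fixes \<Psi> al :: "(complex^'n) \<times> (complex^'n) \<Rightarrow> complex"
  assumes Psi: "smooth_on G \<Psi>" and al: "smooth_on G al"
    and G: "cball x\<^sub>0 (s + r) \<times> cball (vcnj x\<^sub>0) (s + r) \<subseteq> G"
    and alb: "\<And>p. p \<in> cball x\<^sub>0 (s + r) \<times> cball (vcnj x\<^sub>0) (s + r) \<Longrightarrow> norm (al p) \<le> Ca"
    and good: "\<And>z. z \<in> ball 0 r \<Longrightarrow> Re (phase \<Psi> y (vcnj y) (y + z) (vcnj y - vcnj z))
           \<le> - (dist (y + z, vcnj y - vcnj z) (y, vcnj y))\<^sup>2 / C\<^sub>0"
    and "0 < r" "0 < C\<^sub>0" "0 < h" "0 < \<eta>" "\<eta> \<le> r" and y: "y \<in> ball x\<^sub>0 s"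
  defines "F \<equiv> \<lambda>z. exp (2 / complex_of_real h * phase \<Psi> y (vcnj y) (y + z) (vcnj y - vcnj z)) * al (y + z, vcnj y - vcnj z)"
  shows "norm ((\<integral>z. indicator (ball 0 \<eta>) z *\<^sub>R F z \<partial>lborel) - (LINT z:ball 0 r|lebesgue. F z))
    \<le> measure lborel (ball (0 :: complex^'n) r) * (Ca * exp (- (4 * \<eta>\<^sup>2 / C\<^sub>0) / h))"
proof -
  have yz: "y + z \<in> cball x\<^sub>0 (s + r)" "vcnj y - vcnj z \<in> cball (vcnj x\<^sub>0) (s + r)" if "z \<in> cball 0 r" for z
  proof -
    have "dist x\<^sub>0 (y + w) \<le> dist x\<^sub>0 y + norm w" for w
      using dist_triangle[of x\<^sub>0 "y + w" y] by (simp add: dist_norm)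
    from this[of z] this[of "- z"] have "dist x\<^sub>0 (y + z) \<le> s + r" "dist x\<^sub>0 (y - z) \<le> s + r"
      using y that by auto
    then show "y + z \<in> cball x\<^sub>0 (s + r)" "vcnj y - vcnj z \<in> cball (vcnj x\<^sub>0) (s + r)"
      by (simp_all flip: vcnj_diff)
  qed
  have y0: "y \<in> cball x\<^sub>0 (s + r)" "vcnj y \<in> cball (vcnj x\<^sub>0) (s + r)"
    using y \<open>0 < r\<close> by auto
  have tw: "continuous_on (cball 0 r) (\<lambda>z. f (m1 z, m2 z))"
    if "smooth_on G f" "continuous_on (cball 0 r) m1" "continuous_on (cball 0 r) m2"
      "\<And>z. z \<in> cball 0 r \<Longrightarrow> m1 z \<in> cball x\<^sub>0 (s + r)" "\<And>z. z \<in> cball 0 r \<Longrightarrow> m2 z \<in> cball (vcnj x\<^sub>0) (s + r)"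
    for f :: "(complex^'n) \<times> (complex^'n) \<Rightarrow> complex" and m1 m2 :: "complex^'n \<Rightarrow> complex^'n"
  proof (rule continuous_on_compose2[OF smooth_on_continuous[OF that(1), of "[]", simplified]])
    show "continuous_on (cball 0 r) (\<lambda>z. (m1 z, m2 z))" by (intro continuous_on_Pair that)
    show "(\<lambda>z. (m1 z, m2 z)) ` cball 0 r \<subseteq> G"
    proof (rule image_subsetI)
      fix z :: "complex^'n" assume "z \<in> cball 0 r"
      then have "(m1 z, m2 z) \<in> cball x\<^sub>0 (s + r) \<times> cball (vcnj x\<^sub>0) (s + r)" using that(4,5) by blast
      then show "(m1 z, m2 z) \<in> G" using G by blast
    qed
  qed
  have cont: "continuous_on (cball 0 r) F"
    unfolding F_def phase_def using \<open>0 < h\<close>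
    by (intro continuous_intros tw Psi al continuous_on_vcnj yz y0) auto
  have i: "integrable lborel (\<lambda>z. indicator (ball 0 t) z *\<^sub>R F z)" if "t \<le> r" for t
    by (rule integrable_bounded_support[OF compact_cball cont]) (use that in auto)
  have eq: "(LINT z:ball 0 r|lebesgue. F z) = (\<integral>z. indicator (ball 0 r) z *\<^sub>R F z \<partial>lborel)"
    using borel_measurable_integrable[OF i[of r]] by (intro set_integral_lebesgue_lborel) simp
  have "Ca \<ge> 0" using alb[of "(y, vcnj y)"] y0 by (auto intro: order_trans[OF norm_ge_zero])
  have b: "norm (indicator (ball 0 \<eta>) z *\<^sub>R F z - indicator (ball 0 r) z *\<^sub>R F z)
     \<le> indicator (ball 0 r) z * (Ca * exp (- (4 * \<eta>\<^sup>2 / C\<^sub>0) / h))" for z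
  proof (cases "z \<in> ball 0 r \<and> z \<notin> ball 0 \<eta>")
    case True
    then have z: "z \<in> ball 0 r" and e: "\<eta> \<le> norm z" by auto
    \<comment> \<open>Both slots move by |z|, so the squared distance along the contour is 2 |z|^2;
      together with the factor 2/h this gives the 4 \<eta>^2 in the exponent.\<close>
    have "Re (phase \<Psi> y (vcnj y) (y + z) (vcnj y - vcnj z)) \<le> - (2 * (norm z)\<^sup>2) / C\<^sub>0"
      using good[OF z] by (simp add: dist_norm norm_Pair)
    also have "\<dots> \<le> - (2 * \<eta>\<^sup>2) / C\<^sub>0"
      using e \<open>0 < \<eta>\<close> \<open>0 < C\<^sub>0\<close> by (intro divide_right_mono) (auto intro!: power_mono)
    finally have "2 * Re (phase \<Psi> y (vcnj y) (y + z) (vcnj y - vcnj z)) / h \<le> 2 * (- (2 * \<eta>\<^sup>2) / C\<^sub>0) / h"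
      using \<open>0 < h\<close> by (intro divide_right_mono mult_left_mono) auto
    moreover have "Re (2 / complex_of_real h * phase \<Psi> y (vcnj y) (y + z) (vcnj y - vcnj z)) =
        2 * Re (phase \<Psi> y (vcnj y) (y + z) (vcnj y - vcnj z)) / h"
      by (simp add: Re_divide_of_real)
    ultimately have "norm (exp (2 / complex_of_real h * phase \<Psi> y (vcnj y) (y + z) (vcnj y - vcnj z))) \<le> exp (- (4 * \<eta>\<^sup>2 / C\<^sub>0) / h)"
      by (simp only: norm_exp_eq_Re exp_le_cancel_iff)
    moreover have "norm (al (y + z, vcnj y - vcnj z)) \<le> Ca"
      using yz[of z] z by (intro alb) auto
    ultimately have "norm (F z) \<le> exp (- (4 * \<eta>\<^sup>2 / C\<^sub>0) / h) * Ca"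
      unfolding F_def norm_mult by (intro mult_mono) auto
    then show ?thesis using True by (simp add: mult.commute)
  next
    case False
    then have "indicator (ball 0 \<eta>) z = (indicator (ball 0 r) z :: real)"
      using \<open>\<eta> \<le> r\<close> by (auto simp: indicator_def)
    then show ?thesis using \<open>Ca \<ge> 0\<close> by simp
  qed
  have ib: "integrable lborel (\<lambda>z :: complex^'n. indicator (ball 0 r) z * (Ca * exp (- (4 * \<eta>\<^sup>2 / C\<^sub>0) / h)))"
    using emeasure_bounded_finite[OF bounded_ball, of "0 :: complex^'n" r]
    by (intro integrable_mult_left integrable_real_indicator) auto
  have "norm (\<integral>z. indicator (ball 0 \<eta>) z *\<^sub>R F z - indicator (ball 0 r) z *\<^sub>R F z \<partial>lborel)
     \<le> (\<integral>z. indicator (ball (0 :: complex^'n) r) z * (Ca * exp (- (4 * \<eta>\<^sup>2 / C\<^sub>0) / h)) \<partial>lborel)"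
    using i[of \<eta>] i[of r] \<open>\<eta> \<le> r\<close> ib b
    by (intro order_trans[OF integral_norm_bound integral_mono]) auto
  then show ?thesis
    using i[of \<eta>] i[of r] \<open>\<eta> \<le> r\<close> unfolding eq by simp
qed

text \<open>Bookkeeping of powers: every small quantity is given with exponent m = N + n, so that
  h^N is left after division by h^n.\<close>

lemma remainder_estimate:
  fixes h :: real
  assumes h: "0 < h" "h < 1" and m: "m = N + n"
    and nn: "w \<ge> 0" "\<nu> \<ge> 0" "\<mu> \<ge> 0" "\<mu>' \<ge> 0" "A \<ge> 0" "B \<ge> 0" "Ca \<ge> 0" "b \<ge> 0"
    and X: "X1 \<le> D1 * h ^ m" "X2 \<le> D2 * h ^ m" "X3 \<le> D3 * h ^ m" and D2: "D2 \<ge> 0"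
  shows "w / h ^ n * (\<nu> * A * (Ca * X1 * B + Ca * (X2 * B)) + \<mu> * (Kc * h ^ m * (A * B) + b * Ca * (A * (X2 * B))))
      + (CE * h ^ N + w / h ^ n * (\<mu>' * (Ca * X3))) * (A * B) + A * (X2 * B)
    \<le> (w * (\<nu> * (Ca * D1 + Ca * D2) + \<mu> * (Kc + b * Ca * D2)) + (CE + w * (\<mu>' * (Ca * D3))) + D2) * h ^ N * A * B"
proof -
  have hm: "h ^ m / h ^ n = h ^ N" using h by (simp add: m power_add)
  have "h ^ m \<le> h ^ N" using h by (intro power_decreasing) (auto simp: m)
  then have X2': "X2 \<le> D2 * h ^ N" using X(2) D2 by (meson mult_left_mono order_trans)
  have wh: "w / h ^ n \<ge> 0" using nn h by simp
  have "w / h ^ n * (\<nu> * (Ca * X1 + Ca * X2) + \<mu> * (Kc * h ^ m + b * Ca * X2))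
      \<le> w / h ^ n * (\<nu> * (Ca * (D1 * h ^ m) + Ca * (D2 * h ^ m)) + \<mu> * (Kc * h ^ m + b * Ca * (D2 * h ^ m)))"
  proof -
    have 1: "Ca * X1 + Ca * X2 \<le> Ca * (D1 * h ^ m) + Ca * (D2 * h ^ m)"
      using nn X by (intro add_mono mult_left_mono)
    have "b * Ca * X2 \<le> b * Ca * (D2 * h ^ m)"
      using nn X by (intro mult_left_mono) auto
    then have 2: "Kc * h ^ m + b * Ca * X2 \<le> Kc * h ^ m + b * Ca * (D2 * h ^ m)" by simp
    show ?thesis
      by (rule mult_left_mono[OF add_mono[OF mult_left_mono[OF 1] mult_left_mono[OF 2]] wh]) (use nn in auto)
  qed
  also have "\<dots> = w * (\<nu> * (Ca * D1 + Ca * D2) + \<mu> * (Kc + b * Ca * D2)) * (h ^ m / h ^ n)"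
    by (simp add: field_simps)
  finally have 1: "w / h ^ n * (\<nu> * (Ca * X1 + Ca * X2) + \<mu> * (Kc * h ^ m + b * Ca * X2))
      \<le> w * (\<nu> * (Ca * D1 + Ca * D2) + \<mu> * (Kc + b * Ca * D2)) * h ^ N" unfolding hm .
  have "w / h ^ n * (\<mu>' * (Ca * X3)) \<le> w / h ^ n * (\<mu>' * (Ca * (D3 * h ^ m)))"
    using nn X wh by (intro mult_left_mono) auto
  also have "\<dots> = w * (\<mu>' * (Ca * D3)) * (h ^ m / h ^ n)" by (simp add: field_simps)
  finally have 2: "w / h ^ n * (\<mu>' * (Ca * X3)) \<le> w * (\<mu>' * (Ca * D3)) * h ^ N" unfolding hm .
  have "(w / h ^ n * (\<nu> * (Ca * X1 + Ca * X2) + \<mu> * (Kc * h ^ m + b * Ca * X2)) + (CE * h ^ N + w / h ^ n * (\<mu>' * (Ca * X3))) + X2) * (A * B)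
     \<le> (w * (\<nu> * (Ca * D1 + Ca * D2) + \<mu> * (Kc + b * Ca * D2)) * h ^ N + (CE * h ^ N + w * (\<mu>' * (Ca * D3)) * h ^ N) + D2 * h ^ N) * (A * B)"
    by (rule mult_right_mono[OF add_mono[OF add_mono[OF 1 add_left_mono[OF 2]] X2']]) (use nn in simp)
  then show ?thesis by (simp add: algebra_simps)
qed

theorem theorem3p1:
  fixes \<Omega> :: "(complex^'n) set"
    and \<Phi> :: "complex^'n \<Rightarrow> real"
    and x\<^sub>0 :: "complex^'n"
    and G :: "((complex^'n) \<times> (complex^'n)) set"
    and \<Psi> :: "(complex^'n) \<times> (complex^'n) \<Rightarrow> complex"
    and a :: "real \<Rightarrow> (complex^'n) \<times> (complex^'n) \<Rightarrow> complex"
  assumes "open \<Omega>"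
    and "smooth_on \<Omega> \<Phi>"
    and "strictly_psh_on \<Omega> \<Phi>"
    and "x\<^sub>0 \<in> \<Omega>"
    and "open G"
    and "(x\<^sub>0, vcnj x\<^sub>0) \<in> G"
    and "almost_holomorphic_polarization x\<^sub>0 \<Phi> G \<Psi>"
    and "bergman_amplitude x\<^sub>0 G \<Psi> a"
  shows "\<exists>\<delta>>0. \<forall>V.
    open V \<and> x\<^sub>0 \<in> V \<and> V \<subseteq> ball x\<^sub>0 \<delta> \<and> smooth_boundary V \<and>
    compact (closure V) \<and> closure V \<subseteq> \<Omega> \<and> closure (V \<times> vcnj ` V) \<subseteq> G \<longrightarrow>
    (\<exists>W. open W \<and> x\<^sub>0 \<in> W \<and> smooth_boundary W \<and> compact (closure W) \<and> closure W \<subseteq> V \<and>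
      (\<forall>\<Phi>\<^sub>1. continuous_on \<Omega> \<Phi>\<^sub>1 \<and> (\<forall>x\<in>\<Omega>. \<Phi>\<^sub>1 x \<le> \<Phi> x) \<and> (\<forall>x\<in>\<Omega> - closure W. \<Phi>\<^sub>1 x < \<Phi> x) \<longrightarrow>
        (\<forall>N::nat. \<exists>C::real. \<forall>\<^sub>F h in at_right 0.
          \<forall>u\<in>weighted_hol h \<Phi> V. \<forall>v\<in>weighted_hol h \<Phi>\<^sub>1 V.
            norm (weighted_inner h \<Phi> V (bergman_op h \<Phi> \<Psi> a V u) v - weighted_inner h \<Phi> V u v)
            \<le> C * h ^ N * weighted_norm h \<Phi> V u * weighted_norm h \<Phi>\<^sub>1 V v)))"
proof -
  let ?n = "CARD('n)"
  obtain as where as: "classical_symbol G a as" "\<And>j. almost_holomorphic G (as j)"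
    using assms(8) unfolding bergman_amplitude_def by blast
  obtain r s C\<^sub>0 where rs: "0 < r" "0 < s" "0 < C\<^sub>0"
      and K2: "cball x\<^sub>0 (s + r) \<times> cball (vcnj x\<^sub>0) (s + r) \<subseteq> G"
      and good: "\<And>y z. y \<in> ball x\<^sub>0 s \<Longrightarrow> z \<in> ball 0 r \<Longrightarrow>
           Re (phase \<Psi> y (vcnj y) (y + z) (vcnj y - vcnj z))
           \<le> - (dist (y + z, vcnj y - vcnj z) (y, vcnj y))\<^sup>2 / C\<^sub>0"
      and unit: "\<And>N::nat. \<exists>C. \<forall>\<^sub>F h in at_right 0. \<forall>y\<in>ball x\<^sub>0 s.
           norm (vol_const TYPE('n) / complex_of_real h ^ ?n *
                   (LINT z:ball 0 r|lebesgue.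
                      exp (2 / complex_of_real h * phase \<Psi> y (vcnj y) (y + z) (vcnj y - vcnj z)) *
                      a h (y + z, vcnj y - vcnj z))
                 - 1) \<le> C * h ^ N"
    using assms(8) unfolding bergman_amplitude_def by blast
  have x0s: "x\<^sub>0 \<in> ball x\<^sub>0 s" using rs by simp
  have sm\<Psi>: "smooth_on G \<Psi>" and ah\<Psi>: "almost_holomorphic G \<Psi>"
    using assms(7) by (auto simp: almost_holomorphic_polarization_def almost_holomorphic_def)
  obtain c d where c: "c > 0" and d: "d > 0" "ball x\<^sub>0 d \<subseteq> \<Omega>"
    and diag: "\<And>x. x \<in> ball x\<^sub>0 d \<Longrightarrow> \<Psi> (x, vcnj x) = complex_of_real (\<Phi> x)"
    and inG: "\<And>p q. p \<in> ball x\<^sub>0 d \<Longrightarrow> q \<in> ball x\<^sub>0 d \<Longrightarrow> (p, vcnj q) \<in> G"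
    and dia: "\<And>p q. p \<in> ball x\<^sub>0 d \<Longrightarrow> q \<in> ball x\<^sub>0 d \<Longrightarrow> c * (norm (p - q))\<^sup>2 \<le> diastasis \<Phi> \<Psi> p q"
    and hom: "\<And>y z t. t \<in> {0..1} \<Longrightarrow> y \<in> ball x\<^sub>0 d \<Longrightarrow> y + z \<in> ball x\<^sub>0 d \<Longrightarrow> y - (1 - t) *\<^sub>R z \<in> ball x\<^sub>0 d \<Longrightarrow> y + t *\<^sub>R z \<in> ball x\<^sub>0 d \<Longrightarrow>
        - diastasis \<Phi> \<Psi> (y + z) (y - (1 - t) *\<^sub>R z) + diastasis \<Phi> \<Psi> (y + z) (y + t *\<^sub>R z)
        + diastasis \<Phi> \<Psi> y (y - (1 - t) *\<^sub>R z) \<le> - c * (norm z)\<^sup>2"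
    using diastasis_bounds[OF assms(1,2,4,5,6,7) rs(1,3) good[OF x0s]] by blast
  \<comment> \<open>On d the polarization and diastasis bounds hold, on s the amplitude equation,
    and r keeps the truncated contour shorter than the given one.\<close>
  define \<delta> where "\<delta> = min d (min r s)"
  have \<delta>: "\<delta> > 0" "\<delta> \<le> d" "\<delta> \<le> r" "\<delta> \<le> s" using d rs by (auto simp: \<delta>_def)
  show ?thesis
  proof (intro exI[of _ \<delta>] conjI allI impI)
    fix V assume "open V \<and> x\<^sub>0 \<in> V \<and> V \<subseteq> ball x\<^sub>0 \<delta> \<and> smooth_boundary V \<and>
      compact (closure V) \<and> closure V \<subseteq> \<Omega> \<and> closure (V \<times> vcnj ` V) \<subseteq> G"
    then have V: "open V" "x\<^sub>0 \<in> V" "V \<subseteq> ball x\<^sub>0 \<delta>" "compact (closure V)" "closure V \<subseteq> \<Omega>"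
      and K: "closure (V \<times> vcnj ` V) \<subseteq> G" by auto
    have Vd: "V \<subseteq> ball x\<^sub>0 d" and Vs: "V \<subseteq> ball x\<^sub>0 s" and V\<Omega>: "V \<subseteq> \<Omega>"
      using V(3) \<delta> V(5) closure_subset by (auto simp: subset_iff)
    have bV: "bounded V" using V(3) bounded_ball bounded_subset by blast
    obtain e where e: "e > 0" "ball x\<^sub>0 e \<subseteq> V" using V openE by blast
    \<comment> \<open>The factor 8 puts the closed ball of radius 7\<rho> inside V.\<close>
    define \<rho> where "\<rho> = min e \<delta> / 8"
    have \<rho>: "\<rho> > 0" "8 * \<rho> \<le> e" "8 * \<rho> \<le> \<delta>" using e \<delta> by (auto simp: \<rho>_def)
    have c7: "cball x\<^sub>0 (7 * \<rho>) \<subseteq> V" using e(2) \<rho> by (auto simp: subset_iff)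
    have clW: "closure (ball x\<^sub>0 \<rho>) = cball x\<^sub>0 \<rho>" using \<rho> by simp
    have bK: "compact (closure (V \<times> vcnj ` V))"
    proof -
      have "bounded (vcnj ` V)" by (rule bounded_linear_image[OF bV bounded_linear_vcnj])
      then show ?thesis using bV by (simp add: bounded_Times)
    qed
    have VK: "(p, vcnj q) \<in> closure (V \<times> vcnj ` V)" if "p \<in> V" "q \<in> V" for p q
      by (rule subsetD[OF closure_subset]) (use that in simp)
    obtain \<theta> Bt where \<theta>: "Bt \<ge> 0" "\<And>y. (\<theta> :: complex^'n \<Rightarrow> real) differentiable (at y)"
      "\<And>y. 0 \<le> \<theta> y" "\<And>y. \<theta> y \<le> 1"
      "\<And>y. y \<in> ball x\<^sub>0 (3 * \<rho>) \<Longrightarrow> \<theta> y = 1"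
      "\<And>y. y \<notin> cball x\<^sub>0 (4 * \<rho>) \<Longrightarrow> \<theta> y = 0"
      "\<And>y w. norm (frechet_derivative \<theta> (at y) w) \<le> Bt * norm w"
      "\<And>y w. y \<in> ball x\<^sub>0 (3 * \<rho>) \<Longrightarrow> frechet_derivative \<theta> (at y) w = 0"
      by (rule cutoff_exists[OF \<rho>(1), of x\<^sub>0]) (rule that)
    have cont\<Phi>: "continuous_on \<Omega> \<Phi>" using smooth_on_continuous[OF assms(2), of "[]"] by simp
    show "\<exists>W. open W \<and> x\<^sub>0 \<in> W \<and> smooth_boundary W \<and> compact (closure W) \<and> closure W \<subseteq> V \<and>
      (\<forall>\<Phi>\<^sub>1. continuous_on \<Omega> \<Phi>\<^sub>1 \<and> (\<forall>x\<in>\<Omega>. \<Phi>\<^sub>1 x \<le> \<Phi> x) \<and> (\<forall>x\<in>\<Omega> - closure W. \<Phi>\<^sub>1 x < \<Phi> x) \<longrightarrow>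
        (\<forall>N::nat. \<exists>C::real. \<forall>\<^sub>F h in at_right 0.
          \<forall>u\<in>weighted_hol h \<Phi> V. \<forall>v\<in>weighted_hol h \<Phi>\<^sub>1 V.
            norm (weighted_inner h \<Phi> V (bergman_op h \<Phi> \<Psi> a V u) v - weighted_inner h \<Phi> V u v)
            \<le> C * h ^ N * weighted_norm h \<Phi> V u * weighted_norm h \<Phi>\<^sub>1 V v))"
    \<comment> \<open>W is chosen before \<open>\<Phi>\<^sub>1\<close> and N, since \<rho> depends
      only on V and the data.\<close>
    proof (intro exI[of _ "ball x\<^sub>0 \<rho>"] conjI allI impI)
      show "open (ball x\<^sub>0 \<rho>)" "x\<^sub>0 \<in> ball x\<^sub>0 \<rho>" "compact (closure (ball x\<^sub>0 \<rho>))" using \<rho> by auto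
      show "smooth_boundary (ball x\<^sub>0 \<rho>)" by (rule smooth_boundary_ball[OF \<rho>(1)])
      show "closure (ball x\<^sub>0 \<rho>) \<subseteq> V" using c7 \<rho> unfolding clW by (auto simp: subset_iff)
      fix \<Phi>\<^sub>1 :: "complex^'n \<Rightarrow> real" and N :: nat
      assume "continuous_on \<Omega> \<Phi>\<^sub>1 \<and> (\<forall>x\<in>\<Omega>. \<Phi>\<^sub>1 x \<le> \<Phi> x) \<and> (\<forall>x\<in>\<Omega> - closure (ball x\<^sub>0 \<rho>). \<Phi>\<^sub>1 x < \<Phi> x)"
      then have \<Phi>1: "continuous_on \<Omega> \<Phi>\<^sub>1" "\<And>x. x \<in> \<Omega> \<Longrightarrow> \<Phi>\<^sub>1 x \<le> \<Phi> x" "\<And>x. x \<in> \<Omega> \<Longrightarrow> x \<notin> cball x\<^sub>0 \<rho> \<Longrightarrow> \<Phi>\<^sub>1 x < \<Phi> x"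
        unfolding clW by auto
      \<comment> \<open>The closure of W is the closed ball of radius \<rho>, so the weights differ
        strictly on the compact set left after removing radius 2\<rho>; \<kappa> is their minimal
        gap. If that set is empty, any positive value will do.\<close>
      obtain \<kappa> where \<kappa>: "\<kappa> > 0" "\<And>x. x \<in> V \<Longrightarrow> x \<notin> ball x\<^sub>0 (2 * \<rho>) \<Longrightarrow> \<Phi>\<^sub>1 x + \<kappa> \<le> \<Phi> x"
      proof (cases "closure V - ball x\<^sub>0 (2 * \<rho>) = {}")
        case True
        then have "V \<subseteq> ball x\<^sub>0 (2 * \<rho>)" using closure_subset[of V] by blast
        then show ?thesis using that[of 1] by (auto simp: subset_iff)
      next
        case False
        have cp: "compact (closure V - ball x\<^sub>0 (2 * \<rho>))" using V(4) by (intro compact_diff) auto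
        have "continuous_on (closure V - ball x\<^sub>0 (2 * \<rho>)) (\<lambda>x. \<Phi> x - \<Phi>\<^sub>1 x)"
          by (rule continuous_on_subset[of \<Omega>]) (use cont\<Phi> \<Phi>1(1) V(5) in \<open>auto intro!: continuous_intros\<close>)
        then obtain p where p: "p \<in> closure V - ball x\<^sub>0 (2 * \<rho>)"
            "\<And>x. x \<in> closure V - ball x\<^sub>0 (2 * \<rho>) \<Longrightarrow> \<Phi> p - \<Phi>\<^sub>1 p \<le> \<Phi> x - \<Phi>\<^sub>1 x"
          using continuous_attains_inf[OF cp False] by blast
        show ?thesis
        proof (rule that[of "\<Phi> p - \<Phi>\<^sub>1 p"])
          show "0 < \<Phi> p - \<Phi>\<^sub>1 p" using \<Phi>1(3)[of p] p(1) V(5) \<rho>(1) by auto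
          show "\<Phi>\<^sub>1 x + (\<Phi> p - \<Phi>\<^sub>1 p) \<le> \<Phi> x" if "x \<in> V" "x \<notin> ball x\<^sub>0 (2 * \<rho>)" for x
            using p(2)[of x] that closure_subset[of V] by auto
        qed
      qed
      \<comment> \<open>The summand n pays for the factor h^(-n). The flatness order N' = 2(m + 1)
        is the one required by \<open>K1_bound\<close>.\<close>
      define m where "m = N + ?n"
      define N' where "N' = 2 * Suc m"
      obtain C1 where C1: "C1 \<ge> 0" "\<And>x y z. (x, y) \<in> closure (V \<times> vcnj ` V) \<Longrightarrow>
          norm (defect \<Psi> (x, y) z) \<le> C1 * norm (y - vcnj x) ^ N' * norm z"
        using almost_holomorphic_defect[OF ah\<Psi> bK K, of N'] by blast
      obtain C2 where C2: "C2 \<ge> 0" "\<forall>\<^sub>F h in at_right 0. \<forall>x y z. (x, y) \<in> closure (V \<times> vcnj ` V) \<longrightarrow>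
          norm (defect (a h) (x, y) z) \<le> C2 * (h ^ N' + norm (y - vcnj x) ^ N') * norm z"
        using classical_symbol_defect[OF as bK K, of N'] by blast
      define CN where "CN = max C1 C2"
      have CN: "CN \<ge> 0" "C1 \<le> CN" "C2 \<le> CN" using C1 C2 by (auto simp: CN_def)
      \<comment> \<open>One bound for the symbol has to serve both the kernel on V and the contour
        integrals, whose points may leave V.\<close>
      let ?KK = "closure (V \<times> vcnj ` V) \<union> cball x\<^sub>0 (s + r) \<times> cball (vcnj x\<^sub>0) (s + r)"
      have KK: "compact ?KK" "?KK \<subseteq> G" using bK K K2 by (auto intro!: compact_Un compact_Times)
      \<comment> \<open>The symbol estimate with no derivatives and N = 0, where the sum is empty,
        says that the symbol is bounded uniformly in h.\<close>
      have "\<exists>C. \<forall>\<^sub>F h in at_right 0. \<forall>p\<in>?KK.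
           norm (iter_deriv [] (\<lambda>q. a h q - (\<Sum>j<(0::nat). complex_of_real h ^ j * as j q)) p) \<le> C * h ^ 0"
        using as(1) KK unfolding classical_symbol_def by blast
      then obtain C3 where C3: "\<forall>\<^sub>F h in at_right 0. \<forall>p\<in>?KK. norm (a h p) \<le> C3" by auto
      define Ca where "Ca = max C3 0"
      have Cab: "Ca \<ge> 0" "C3 \<le> Ca" by (auto simp: Ca_def)
      obtain CE where CE: "\<forall>\<^sub>F h in at_right 0. \<forall>y\<in>ball x\<^sub>0 s.
           norm (vol_const TYPE('n) / complex_of_real h ^ ?n *
                   (LINT z:ball 0 r|lebesgue.
                      exp (2 / complex_of_real h * phase \<Psi> y (vcnj y) (y + z) (vcnj y - vcnj z)) *
                      a h (y + z, vcnj y - vcnj z))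
                 - 1) \<le> CE * h ^ N"
        using unit by blast
      define w where "w = norm (vol_const TYPE('n))"
      define \<mu> where "\<mu> = measure lborel (ball (0 :: complex^'n) (\<rho> / 2))"
      define \<mu>' where "\<mu>' = measure lborel (ball (0 :: complex^'n) r)"
      define D1 where "D1 = fact m / (c * (\<rho> / 2)\<^sup>2) ^ m"
      define D2 where "D2 = fact m / \<kappa> ^ m"
      define D3 where "D3 = fact m / (4 * (\<rho> / 2)\<^sup>2 / C\<^sub>0) ^ m"
      define S where "S = 4 ^ Suc m * fact (Suc m) / c ^ Suc m"
      define Kc where "Kc = \<rho> * CN * (1 + S + 6 * S * Ca)"
      define CF where "CF = w * (measure lborel V * (Ca * D1 + Ca * D2) + \<mu> * (Kc + (Bt * \<rho>) * Ca * D2)) + (CE + w * (\<mu>' * (Ca * D3))) + D2"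
      have sma: "\<forall>\<^sub>F h in at_right 0. smooth_on G (a h)" using as(1) by (simp add: classical_symbol_def)
      have h01: "\<forall>\<^sub>F h::real in at_right 0. 0 < h \<and> h < 1"
        by (simp add: eventually_at_right[of 0 1]) (metis zero_less_one)
      show "\<exists>C. \<forall>\<^sub>F h in at_right 0. \<forall>u\<in>weighted_hol h \<Phi> V. \<forall>v\<in>weighted_hol h \<Phi>\<^sub>1 V.
            norm (weighted_inner h \<Phi> V (bergman_op h \<Phi> \<Psi> a V u) v - weighted_inner h \<Phi> V u v)
            \<le> C * h ^ N * weighted_norm h \<Phi> V u * weighted_norm h \<Phi>\<^sub>1 V v"
        using sma h01 C2(2) C3 CE
      proof (intro exI[of _ CF], eventually_elim, intro ballI)
        fix h u v
        assume sma: "smooth_on G (a h)" and h: "0 < h \<and> h < 1"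
          and ad: "\<forall>x y z. (x, y) \<in> closure (V \<times> vcnj ` V) \<longrightarrow>
            norm (defect (a h) (x, y) z) \<le> C2 * (h ^ N' + norm (y - vcnj x) ^ N') * norm z"
          and ab: "\<forall>p\<in>?KK. norm (a h p) \<le> C3"
          and un: "\<forall>y\<in>ball x\<^sub>0 s. norm (vol_const TYPE('n) / complex_of_real h ^ ?n *
                   (LINT z:ball 0 r|lebesgue.
                      exp (2 / complex_of_real h * phase \<Psi> y (vcnj y) (y + z) (vcnj y - vcnj z)) *
                      a h (y + z, vcnj y - vcnj z)) - 1) \<le> CE * h ^ N"
          and u: "u \<in> weighted_hol h \<Phi> V" and v: "v \<in> weighted_hol h \<Phi>\<^sub>1 V"
        let ?A = "weighted_norm h \<Phi> V u" and ?B = "weighted_norm h \<Phi>\<^sub>1 V v"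
        let ?U = "weighted_abs h \<Phi> V u" and ?M = "weighted_abs h \<Phi> V v" and ?M1 = "weighted_abs h \<Phi>\<^sub>1 V v"
        have hp: "h > 0" and h1: "h < 1" using h by auto
        have cV: "continuous_on V \<Phi>" "continuous_on V \<Phi>\<^sub>1"
          using cont\<Phi> \<Phi>1(1) V\<Omega> continuous_on_subset by blast+
        have hu: "hol_on V u" and hv: "hol_on V v" using u v by (auto simp: weighted_hol_def)
        note nu = weighted_norm_lborel[OF V(1) cV(1) hp u]
        note nv = weighted_norm_lborel[OF V(1) cV(2) hp v]
        have AB: "?A \<ge> 0" "?B \<ge> 0"
          by (auto simp: weighted_norm_def set_lebesgue_integral_def intro!: integral_nonneg_AE AE_I2)
        have MM: "?M y \<le> ?M1 y" for y
        proof (cases "y \<in> V")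
          case True
          then have "- \<Phi> y / h \<le> - \<Phi>\<^sub>1 y / h" using \<Phi>1(2) V\<Omega> hp by (intro divide_right_mono) auto
          then show ?thesis by (auto simp: weighted_abs_def intro!: mult_left_mono)
        qed (simp add: weighted_abs_def)
        have MM0: "indicator (- ball x\<^sub>0 (2 * \<rho>)) y * ?M y \<le> exp (- \<kappa> / h) * ?M1 y" for y
        proof (cases "y \<in> V \<and> y \<notin> ball x\<^sub>0 (2 * \<rho>)")
          case True
          then have "- \<Phi> y / h \<le> (- \<kappa> + - \<Phi>\<^sub>1 y) / h" using \<kappa>(2)[of y] hp by (intro divide_right_mono) auto
          then have "exp (- \<Phi> y / h) \<le> exp (- \<kappa> / h) * exp (- \<Phi>\<^sub>1 y / h)"
            by (simp only: add_divide_distrib exp_add[symmetric] exp_le_cancel_iff)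
          then have "norm (v y) * exp (- \<Phi> y / h) \<le> norm (v y) * (exp (- \<kappa> / h) * exp (- \<Phi>\<^sub>1 y / h))"
            by (rule mult_left_mono) simp
          then show ?thesis using True by (simp add: weighted_abs_def mult_ac)
        next
          case False
          then show ?thesis using weighted_abs_nonneg[of h \<Phi>\<^sub>1 V v y] by (auto simp: weighted_abs_def)
        qed
        note mM = weighted_abs_measurable[OF V(1) cV(1) hp hv]
        have Mi: "integrable lborel (\<lambda>y. (?M y)\<^sup>2)"
          by (rule Bochner_Integration.integrable_bound[OF nv(1)])
             (use mM MM in \<open>auto intro!: AE_I2 power_mono simp: weighted_abs_nonneg\<close>)
        have Mb: "(\<integral>y. (?M y)\<^sup>2 \<partial>lborel) \<le> ?B\<^sup>2"
          unfolding nv(2)[symmetric] by (rule integral_mono[OF Mi nv(1)]) (use MM in \<open>auto intro!: power_mono simp: weighted_abs_nonneg\<close>)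
        have M0i: "integrable lborel (\<lambda>y. (indicator (- ball x\<^sub>0 (2 * \<rho>)) y * ?M y)\<^sup>2)"
          by (rule Bochner_Integration.integrable_bound[OF Mi])
             (use mM in \<open>auto intro!: AE_I2 simp: indicator_def\<close>)
        have "(\<integral>y. (indicator (- ball x\<^sub>0 (2 * \<rho>)) y * ?M y)\<^sup>2 \<partial>lborel) \<le> (\<integral>y. (exp (- \<kappa> / h))\<^sup>2 * (?M1 y)\<^sup>2 \<partial>lborel)"
        proof (rule integral_mono[OF M0i])
          show "integrable lborel (\<lambda>y. (exp (- \<kappa> / h))\<^sup>2 * (?M1 y)\<^sup>2)" using nv(1) by simp
          show "(indicator (- ball x\<^sub>0 (2 * \<rho>)) y * ?M y)\<^sup>2 \<le> (exp (- \<kappa> / h))\<^sup>2 * (?M1 y)\<^sup>2" for y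
            unfolding power_mult_distrib[of "exp (- \<kappa> / h)", symmetric]
            by (rule power_mono[OF MM0]) (simp add: weighted_abs_nonneg)
        qed
        then have M0b: "(\<integral>y. (indicator (- ball x\<^sub>0 (2 * \<rho>)) y * ?M y)\<^sup>2 \<partial>lborel) \<le> (exp (- \<kappa> / h) * ?B)\<^sup>2"
          by (simp add: nv(2) power_mult_distrib)
        have dd: "norm (vcnj q - vcnj x) = norm (q - x)" for q x :: "complex^'n"
          by (simp flip: vcnj_diff)
        \<comment> \<open>The locale measures v with the weight \<Phi>, but the bounds are given by
          its norm for \<open>\<Phi>\<^sub>1\<close>: that norm is larger since
          \<open>\<Phi>\<^sub>1\<close> \<le> \<Phi>, and outside radius 2\<rho> the gap \<kappa>
          gains the factor exp(- \<kappa> / h).\<close>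
        interpret bergman_homotopy \<Phi> \<Psi> "a h" x\<^sub>0 V G \<rho> \<theta> Bt h c Ca CN N' u v ?A ?B "exp (- \<kappa> / h) * ?B"
        proof
          show "(x, vcnj q) \<in> G" if "x \<in> V" "q \<in> V" for x q using inG that Vd by blast
          show "\<Psi> (x, vcnj x) = complex_of_real (\<Phi> x)" if "x \<in> V" for x using diag that Vd by blast
          show "norm (a h (x, vcnj q)) \<le> Ca" if "x \<in> V" "q \<in> V" for x q
            using ab VK[OF that] Cab(2) by (meson UnI1 order_trans)
          show "c * (norm (p - q))\<^sup>2 \<le> diastasis \<Phi> \<Psi> p q" if "p \<in> V" "q \<in> V" for p q using dia that Vd by blast
          show "- diastasis \<Phi> \<Psi> (y + z) (y - (1 - t) *\<^sub>R z) + diastasis \<Phi> \<Psi> (y + z) (y + t *\<^sub>R z)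
              + diastasis \<Phi> \<Psi> y (y - (1 - t) *\<^sub>R z) \<le> - c * (norm z)\<^sup>2"
            if "t \<in> {0..1}" "y \<in> V" "y + z \<in> V" "y - (1 - t) *\<^sub>R z \<in> V" "y + t *\<^sub>R z \<in> V" for y z t
            using hom[OF that(1)] that Vd by blast
          show "norm (defect \<Psi> (x, vcnj q) z) \<le> CN * norm (q - x) ^ N' * norm z" if "x \<in> V" "q \<in> V" for x q z
            by (rule order_trans[OF C1(2)[OF VK[OF that]]]) (use CN in \<open>auto simp: dd intro!: mult_right_mono\<close>)
          show "norm (defect (a h) (x, vcnj q) z) \<le> CN * (h ^ N' + norm (q - x) ^ N') * norm z" if "x \<in> V" "q \<in> V" for x q z
            by (rule order_trans[OF ad[rule_format, OF VK[OF that]]]) (use CN hp in \<open>auto simp: dd intro!: mult_right_mono\<close>)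
          show "integrable lborel (\<lambda>y. (?U y)\<^sup>2)" by (rule nu(1))
          show "(\<integral>y. (?U y)\<^sup>2 \<partial>lborel) \<le> ?A\<^sup>2" by (simp add: nu(2))
        qed (use hp \<rho> c Cab CN V bV c7 cV sm\<Psi> sma hu hv AB Mi Mb M0b \<theta> in auto)
        let ?\<omega> = "vol_const TYPE('n) / complex_of_real h ^ ?n"
        have \<omega>: "norm ?\<omega> = w / h ^ ?n" using hp by (simp add: w_def norm_divide norm_power)
        \<comment> \<open>The first term is the error in the amplitude equation; the second is the
          truncation from radius r to \<rho>/2, multiplied by the prefactor.\<close>
        have E: "norm (?\<omega> * contour y - 1) \<le> CE * h ^ N + w / h ^ ?n * (\<mu>' * (Ca * exp (- (4 * (\<rho> / 2)\<^sup>2 / C\<^sub>0) / h)))"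
          if y: "y \<in> cball x\<^sub>0 (4 * \<rho>)" for y
        proof -
          have ys: "y \<in> ball x\<^sub>0 s" using y c7 Vs \<rho> by (auto simp: subset_iff)
          let ?L = "LINT z:ball 0 r|lebesgue. exp (2 / complex_of_real h * phase \<Psi> y (vcnj y) (y + z) (vcnj y - vcnj z)) *
                      a h (y + z, vcnj y - vcnj z)"
          have ct: "norm (contour y - ?L) \<le> \<mu>' * (Ca * exp (- (4 * (\<rho> / 2)\<^sup>2 / C\<^sub>0) / h))"
            unfolding contour_def \<mu>'_def
          proof (rule contour_truncation[OF sm\<Psi> sma K2 _ good[OF ys] rs(1,3) hp _ _ ys])
            show "norm (a h p) \<le> Ca" if "p \<in> cball x\<^sub>0 (s + r) \<times> cball (vcnj x\<^sub>0) (s + r)" for p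
              using ab that Cab(2) by (meson UnI2 order_trans)
          qed (use \<rho> \<delta> in auto)
          have eq: "?\<omega> * contour y - 1 = (?\<omega> * ?L - 1) + ?\<omega> * (contour y - ?L)" by (simp add: algebra_simps)
          have "norm (?\<omega> * (contour y - ?L)) \<le> w / h ^ ?n * (\<mu>' * (Ca * exp (- (4 * (\<rho> / 2)\<^sup>2 / C\<^sub>0) / h)))"
            unfolding norm_mult \<omega> using ct hp by (intro mult_left_mono) (auto simp: w_def)
          then show ?thesis unfolding eq using un ys by (intro norm_triangle_le add_mono) auto
        qed
        have Kb: "K1 z \<le> Kc * h ^ m" if "norm z \<le> \<rho> / 2" for z
          using K1_bound[OF N'_def h1 that] unfolding Kc_def S_def .
        have main: "norm (weighted_inner h \<Phi> V (bergman_op h \<Phi> \<Psi> a V u) v - weighted_inner h \<Phi> V u v)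
          \<le> w / h ^ ?n * (measure lborel V * ?A * (Ca * exp (- c * (\<rho> / 2)\<^sup>2 / h) * ?B + Ca * (exp (- \<kappa> / h) * ?B))
              + \<mu> * (Kc * h ^ m * (?A * ?B) + (Bt * \<rho>) * Ca * (?A * (exp (- \<kappa> / h) * ?B))))
            + (CE * h ^ N + w / h ^ ?n * (\<mu>' * (Ca * exp (- (4 * (\<rho> / 2)\<^sup>2 / C\<^sub>0) / h)))) * (?A * ?B) + ?A * (exp (- \<kappa> / h) * ?B)"
          using kern_estimate[OF E Kb] unfolding \<omega> \<mu>_def weighted_inner_uv weighted_inner_bergman_op[of a, OF refl] .
        also have "\<dots> \<le> CF * h ^ N * ?A * ?B"
          unfolding CF_def
        proof (rule remainder_estimate)
          show "exp (- c * (\<rho> / 2)\<^sup>2 / h) \<le> D1 * h ^ m"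
            using exp_neg_div_le_power[of "c * (\<rho> / 2)\<^sup>2" h m] c \<rho> hp by (simp add: D1_def)
          show "exp (- \<kappa> / h) \<le> D2 * h ^ m"
            using exp_neg_div_le_power[of \<kappa> h m] \<kappa> hp by (simp add: D2_def)
          show "exp (- (4 * (\<rho> / 2)\<^sup>2 / C\<^sub>0) / h) \<le> D3 * h ^ m"
            unfolding D3_def by (rule exp_neg_div_le_power) (use rs \<rho> hp in auto)
        qed (use hp h1 \<rho> Cab \<theta>(1) AB \<kappa> in \<open>auto simp: m_def w_def \<mu>_def \<mu>'_def D2_def\<close>)
        finally show "norm (weighted_inner h \<Phi> V (bergman_op h \<Phi> \<Psi> a V u) v - weighted_inner h \<Phi> V u v)
            \<le> CF * h ^ N * ?A * ?B" .
      qed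
    qed
  qed (rule \<delta>(1))
qed

end
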